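(* Let $(X_j,Y_j,S_j)$, $j\in\mathbb{Z}$, be a FAIM process, and let $Z_n$ be its Bhattacharyya process. Then $Z_n$ polarizes fast to $1$, and for every $\beta<1/2$, \[\lim_{N\to\infty}\frac{1}{N}\left|\left\{i\in\{1,\dots,N\}: Z(U_i\mid Q_i)>1-2^{-N^{\beta}}\right\}\right| = \bar H(X\mid Y),\] where $N=2^n$ and $n\to\infty$.
   Context: Parameters: for a binary random variable $U$ and a random variable $Q$ taking values in a finite alphabet, with joint law $P_{U,Q}$, the Bhattacharyya parameter is $Z(U|Q)=2\sum_q\sqrt{P_{U,Q}(0,q)P_{U,Q}(1,q)}$, the total variation distance is $K(U|Q)=\sum_q|P_{U,Q}(0,q)-P_{U,Q}(1,q)|$, and $H(U|Q)$ is the conditional entropy (base 2). Conditioning on several variables means treating their tuple as the observation. FAIM process: $(X_j,Y_j,S_j)$, $j\in\mathbb{Z}$, is strictly stationary, $X_j\in\{0,1\}$, $Y_j$ takes values in a finite alphabet $\mathcal{Y}$, $S_j$ takes values in a finite set $\mathcal{S}$; the conditional law $P_{X_j,Y_j,S_j|S_{j-1}}$ does not depend on $j$; and (Markov property) conditioned on $S_{j-1}$, the variables $\{X_k,Y_k,S_k\}_{k\ge j}$ are independent of $\{X_l,Y_l,S_{l-1}\}_{l<j}$. The state sequence $(S_j)$ is a homogeneous, finite-state, stationary, aperiodic and irreducible Markov chain. Polarization setup: for $n\ge1$, $N=2^n$, $G_N=B_NG_2^{\otimes n}$ with $G_2=\begin{bmatrix}1&0\\1&1\end{bmatrix}$,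 $G_2^{\otimes n}$ its $n$-fold Kronecker power and $B_N$ the $N\times N$ bit-reversal permutation matrix (arithmetic modulo 2). Set $U_1^N=X_1^NG_N$ and $Q_i=(U_1^{i-1},Y_1^N)$. Let $B_1,B_2,\dots$ be i.i.d. Bernoulli$(1/2)$ and let $i$ be defined by $i-1=\sum_{j=1}^nB_j2^{n-j}$. The Bhattacharyya process is $Z_n=Z(U_i|Q_i)$ (a random variable through $B_1,\dots,B_n$). Also $\bar H(X|Y)=\lim_{N\to\infty}\frac1N H(X_1^N|Y_1^N)$. A $[0,1]$-valued sequence $A_n$ polarizes if it converges almost surely to a $\{0,1\}$-valued random variable $A_\infty$; it polarizes fast to $1$ (with $\beta>0$) if it polarizes and $\lim_{n\to\infty}\Pr(A_n>1-2^{-2^{n\beta}})=\Pr(A_\infty=1)$. "Polarizes fast to 1" without $\beta$ means for some $\beta>0$. *)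

theory Defs
  imports "HOL-Probability.Probability"
begin

definition ev_prob :: "'w measure \<Rightarrow> ('w \<Rightarrow> bool) \<Rightarrow> real" where
  "ev_prob M P = measure M {\<omega> \<in> space M. P \<omega>}"

definition triple :: "(int \<Rightarrow> 'w \<Rightarrow> bool) \<Rightarrow> (int \<Rightarrow> 'w \<Rightarrow> 'y) \<Rightarrow> (int \<Rightarrow> 'w \<Rightarrow> 's)
    \<Rightarrow> int \<Rightarrow> 'w \<Rightarrow> bool \<times> 'y \<times> 's" where
  "triple X Y S j \<omega> = (X j \<omega>, Y j \<omega>, S j \<omega>)"

text \<open>Strict stationarity: the joint law of every window of consecutive times is
  shift invariant (alphabets are finite, so cylinder probabilities determine the laws).\<close>

definition strictly_stationary where
  "strictly_stationary M X Y S \<longleftrightarrow>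
     (\<forall>(a::int) (m::nat) (f :: nat \<Rightarrow> bool \<times> 'y \<times> 's).
        ev_prob M (\<lambda>\<omega>. \<forall>t<m. triple X Y S (a + int t) \<omega> = f t)
      = ev_prob M (\<lambda>\<omega>. \<forall>t<m. triple X Y S (int t) \<omega> = f t))"

definition time_invariant_kernel where
  "time_invariant_kernel M X Y S \<longleftrightarrow>
     (\<forall>(j::int) (v :: bool \<times> 'y \<times> 's) (s' :: 's).
        ev_prob M (\<lambda>\<omega>. S (j - 1) \<omega> = s') > 0 \<longrightarrow> ev_prob M (\<lambda>\<omega>. S 0 \<omega> = s') > 0 \<longrightarrow>
        ev_prob M (\<lambda>\<omega>. triple X Y S j \<omega> = v \<and> S (j - 1) \<omega> = s') / ev_prob M (\<lambda>\<omega>. S (j - 1) \<omega> = s')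
      = ev_prob M (\<lambda>\<omega>. triple X Y S 1 \<omega> = v \<and> S 0 \<omega> = s') / ev_prob M (\<lambda>\<omega>. S 0 \<omega> = s'))"

text \<open>Markov property: given S (j-1), the future {(X k, Y k, S k)}, k \<ge> j, is independent of the
  past {(X l, Y l, S (l-1))}, l < j.  Stated on the generating pi-systems of cylinder events
  (windows of consecutive times starting at j, resp. going back from j-1).\<close>

definition markov_property where
  "markov_property M X Y S \<longleftrightarrow>
     (\<forall>(j::int) (s::'s) (m::nat) (m'::nat) (f :: nat \<Rightarrow> bool \<times> 'y \<times> 's) (g :: nat \<Rightarrow> bool \<times> 'y \<times> 's).
        let A = (\<lambda>\<omega>. \<forall>t<m. triple X Y S (j + int t) \<omega> = f t);
            B = (\<lambda>\<omega>. \<forall>t<m'. (X (j - 1 - int t) \<omega>, Y (j - 1 - int t) \<omega>, S (j - 2 - int t) \<omega>) = g t);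
            C = (\<lambda>\<omega>. S (j - 1) \<omega> = s)
        in ev_prob M (\<lambda>\<omega>. A \<omega> \<and> B \<omega> \<and> C \<omega>) * ev_prob M C
         = ev_prob M (\<lambda>\<omega>. A \<omega> \<and> C \<omega>) * ev_prob M (\<lambda>\<omega>. B \<omega> \<and> C \<omega>))"

text \<open>Irreducibility and aperiodicity of the state chain on the state set 's
  (n-step transition probability P(S n = s' | S 0 = s) is positive iff the joint probability is).\<close>

definition state_chain_irreducible where
  "state_chain_irreducible M (S :: int \<Rightarrow> 'w \<Rightarrow> 's) \<longleftrightarrow>
     (\<forall>s s'. \<exists>n::nat. n > 0 \<and> ev_prob M (\<lambda>\<omega>. S 0 \<omega> = s \<and> S (int n) \<omega> = s') > 0)"

definition state_chain_aperiodic where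
  "state_chain_aperiodic M (S :: int \<Rightarrow> 'w \<Rightarrow> 's) \<longleftrightarrow>
     (\<forall>s. Gcd {n::nat. n > 0 \<and> ev_prob M (\<lambda>\<omega>. S 0 \<omega> = s \<and> S (int n) \<omega> = s) > 0} = 1)"

definition faim_process ::
  "'w measure \<Rightarrow> (int \<Rightarrow> 'w \<Rightarrow> bool) \<Rightarrow> (int \<Rightarrow> 'w \<Rightarrow> 'y::finite) \<Rightarrow> (int \<Rightarrow> 'w \<Rightarrow> 's::finite) \<Rightarrow> bool" where
  "faim_process M X Y S \<longleftrightarrow>
     prob_space M \<and>
     (\<forall>j. X j \<in> measurable M (count_space UNIV)) \<and>
     (\<forall>j. Y j \<in> measurable M (count_space UNIV)) \<and>
     (\<forall>j. S j \<in> measurable M (count_space UNIV)) \<and>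
     strictly_stationary M X Y S \<and>
     time_invariant_kernel M X Y S \<and>
     markov_property M X Y S \<and>
     state_chain_irreducible M S \<and>
     state_chain_aperiodic M S"

text \<open>Binary U (False = 0, True = 1), observation Q with finite range.\<close>

definition bhattacharyya :: "'w measure \<Rightarrow> ('w \<Rightarrow> bool) \<Rightarrow> ('w \<Rightarrow> 'q) \<Rightarrow> real" where
  "bhattacharyya M U Q = 2 * (\<Sum>q \<in> Q ` space M.
      sqrt (ev_prob M (\<lambda>\<omega>. U \<omega> = False \<and> Q \<omega> = q) * ev_prob M (\<lambda>\<omega>. U \<omega> = True \<and> Q \<omega> = q)))"

definition cond_entropy :: "'w measure \<Rightarrow> ('w \<Rightarrow> 'a) \<Rightarrow> ('w \<Rightarrow> 'b) \<Rightarrow> real" where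
  "cond_entropy M A B = - (\<Sum>(a, b) \<in> (\<lambda>\<omega>. (A \<omega>, B \<omega>)) ` space M.
      ev_prob M (\<lambda>\<omega>. A \<omega> = a \<and> B \<omega> = b) *
      log 2 (ev_prob M (\<lambda>\<omega>. A \<omega> = a \<and> B \<omega> = b) / ev_prob M (\<lambda>\<omega>. B \<omega> = b)))"

definition block :: "(int \<Rightarrow> 'w \<Rightarrow> 'a) \<Rightarrow> nat \<Rightarrow> 'w \<Rightarrow> 'a list" where
  "block X N \<omega> = map (\<lambda>k. X (int k) \<omega>) [1..<N + 1]"

text \<open>Matrices are functions nat \<Rightarrow> nat \<Rightarrow> bool (0-based indices, True = 1).\<close>

definition G2 :: "nat \<Rightarrow> nat \<Rightarrow> bool" where
  "G2 i j = (i < 2 \<and> j < 2 \<and> (i = 1 \<or> j = 0))"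

definition kron :: "nat \<Rightarrow> (nat \<Rightarrow> nat \<Rightarrow> bool) \<Rightarrow> (nat \<Rightarrow> nat \<Rightarrow> bool) \<Rightarrow> nat \<Rightarrow> nat \<Rightarrow> bool" where
  "kron q A B i j = (A (i div q) (j div q) \<and> B (i mod q) (j mod q))"

fun kron_pow :: "nat \<Rightarrow> nat \<Rightarrow> nat \<Rightarrow> bool" where
  "kron_pow 0 = (\<lambda>i j. i = 0 \<and> j = 0)"
| "kron_pow (Suc n) = kron (2 ^ n) G2 (kron_pow n)"

definition matmul2 :: "nat \<Rightarrow> (nat \<Rightarrow> nat \<Rightarrow> bool) \<Rightarrow> (nat \<Rightarrow> nat \<Rightarrow> bool) \<Rightarrow> nat \<Rightarrow> nat \<Rightarrow> bool" where
  "matmul2 N A B i j = odd (card {k. k < N \<and> A i k \<and> B k j})"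

definition bitrev :: "nat \<Rightarrow> nat \<Rightarrow> nat" where
  "bitrev n a = (\<Sum>k<n. if bit a k then 2 ^ (n - 1 - k) else 0)"

definition bitrev_perm :: "nat \<Rightarrow> nat \<Rightarrow> nat \<Rightarrow> bool" where
  "bitrev_perm n i j = (i < 2 ^ n \<and> j = bitrev n i)"

definition polar_matrix :: "nat \<Rightarrow> nat \<Rightarrow> nat \<Rightarrow> bool" where
  "polar_matrix n = matmul2 (2 ^ n) (bitrev_perm n) (kron_pow n)"

text \<open>U_i (1-based i) of U_1^N = X_1^N G_N.\<close>
definition polar_U :: "nat \<Rightarrow> (int \<Rightarrow> 'w \<Rightarrow> bool) \<Rightarrow> nat \<Rightarrow> 'w \<Rightarrow> bool" where
  "polar_U n X i \<omega> = odd (card {k. k < 2 ^ n \<and> X (int k + 1) \<omega> \<and> polar_matrix n k (i - 1)})"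

definition polar_Q :: "nat \<Rightarrow> (int \<Rightarrow> 'w \<Rightarrow> bool) \<Rightarrow> (int \<Rightarrow> 'w \<Rightarrow> 'y) \<Rightarrow> nat \<Rightarrow> 'w \<Rightarrow> bool list \<times> 'y list" where
  "polar_Q n X Y i \<omega> = (map (\<lambda>k. polar_U n X k \<omega>) [1..<i], block Y (2 ^ n) \<omega>)"

text \<open>Space of i.i.d. Bernoulli(1/2) bits B_1, B_2, ... (B_j = b !! (j-1)).\<close>
definition coin_space :: "bool stream measure" where
  "coin_space = stream_space (measure_pmf (bernoulli_pmf (1/2)))"

definition random_index :: "nat \<Rightarrow> bool stream \<Rightarrow> nat" where
  "random_index n b = 1 + (\<Sum>j\<in>{1..n}. if b !! (j - 1) then 2 ^ (n - j) else 0)"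

definition bhatt_process where
  "bhatt_process M X Y n b =
     bhattacharyya M (polar_U n X (random_index n b)) (polar_Q n X Y (random_index n b))"

definition polarizes_with_limit :: "'b measure \<Rightarrow> (nat \<Rightarrow> 'b \<Rightarrow> real) \<Rightarrow> ('b \<Rightarrow> real) \<Rightarrow> bool" where
  "polarizes_with_limit P A Ainf \<longleftrightarrow>
     (\<forall>n \<omega>. A n \<omega> \<in> {0..1}) \<and>
     Ainf \<in> borel_measurable P \<and> (\<forall>\<omega>. Ainf \<omega> \<in> {0, 1}) \<and>
     (AE \<omega> in P. (\<lambda>n. A n \<omega>) \<longlonglongrightarrow> Ainf \<omega>)"

definition polarizes_fast_to_1 :: "'b measure \<Rightarrow> (nat \<Rightarrow> 'b \<Rightarrow> real) \<Rightarrow> bool" where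
  "polarizes_fast_to_1 P A \<longleftrightarrow>
     (\<exists>Ainf \<beta>. \<beta> > 0 \<and> polarizes_with_limit P A Ainf \<and>
        (\<lambda>n. measure P {\<omega> \<in> space P. A n \<omega> > 1 - 2 powr (- (2 powr (real n * \<beta>)))})
          \<longlonglongrightarrow> measure P {\<omega> \<in> space P. Ainf \<omega> = 1})"

end

theory Submission
  imports Defs "HOL-Real_Asymp.Real_Asymp"
begin

text \<open>
  Write \<open>H\<close>, \<open>K\<close>, \<open>Z\<close> for the parameters of \<open>U\<^sub>i\<close> given \<open>Q\<^sub>i\<close>, and \<open>H'\<close>, \<open>K'\<close> for those given
  \<open>Q\<^sub>i\<close> and the states at both ends of the block. Adjacent blocks are conditionally independent given
  the state between them, so along the tree of polar transforms \<open>H\<close> is a supermartingale and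
  \<open>H' \<le> H\<close> a submartingale; as the two boundary states carry bounded entropy, \<open>H - H' \<longlonglongrightarrow> 0\<close> in mean.

  Condition on all states and on the two middle blocks of four consecutive ones. Since the chain
  mixes, the outer two blocks are independent up to a constant factor, which gives for the
  minus-minus child \<open>H'' \<ge> H' + c (1 - K') (1 - H')\<close>. With the monotonicity of the second moments
  of \<open>H'\<close> this forces \<open>H'\<close>, hence \<open>H\<close>, towards \<open>{0, 1}\<close> in probability. The maximal inequality for
  the nonnegative supermartingales \<open>H\<close> and \<open>1 - H'\<close> then shows that paths near \<open>0\<close> or \<open>1\<close> stay there.

  On the paths that stay near \<open>1\<close>, \<open>K'\<close> is small and satisfies \<open>K' \<mapsto> \<kappa> K'\<^sup>2\<close> (minus) or
  \<open>2 K'\<close> (plus), so that it decays like \<open>2 powr (- (2 powr (n \<beta>)))\<close> by counting minus steps, and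
  \<open>Z \<ge> 1 - K'\<close>. Symmetrically \<open>Z\<close> decays fast on the paths that stay near \<open>0\<close>; this is needed
  for \<open>\<beta> < 0\<close>, where the threshold in the statement tends to \<open>0\<close>.
\<close>

section \<open>Entropy of binary weights\<close>

text \<open>Each parameter is kept in the version that survives its own transform. \<open>Z\<close>
  increases with the joint weights, so it tolerates replacing the law of two adjacent blocks by
  \<open>\<kappa>\<close> times the product of their laws, and needs no states. \<open>K\<close>
  measures differences of weights, which such a domination does not control; it needs exact
  conditional independence, hence the boundary states. Since further observations only raise
  \<open>K\<close>, smallness of \<open>K'\<close> passes to \<open>K\<close>.

  A single minus step may fail to move \<open>H'\<close>. Given the one state shared by two blocks,
  the gain is a sum over that state of products of what the left and the right block contribute, and
  all these products can vanish although both averages lie strictly between \<open>0\<close> and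
  \<open>1\<close>: some states may make the bit uniform, the others deterministic. Two blocks in
  between replace the single sum by a double sum over two states that are independent up to a
  constant factor, and this double sum is the product of the averages.\<close>

definition eta :: "real \<Rightarrow> real" where
  "eta x = - x * log 2 x"

text \<open>Entropy of a bit with unnormalised weights: \<open>a + b\<close> times the binary
  entropy of \<open>a / (a + b)\<close>. Being homogeneous, it lets conditional entropies be summed
  over joint weights without dividing by the probability of an observation.\<close>

definition hent :: "real \<Rightarrow> real \<Rightarrow> real" where
  "hent a b = eta a + eta b - eta (a + b)"

lemma eta_0 [simp]: "eta 0 = 0"
  by (simp add: eta_def)

lemma hent_0 [simp]: "hent 0 b = 0" "hent a 0 = 0"
  by (simp_all add: hent_def)

lemma hent_commute: "hent a b = hent b a"
  by (simp add: hent_def add.commute)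

lemma hent_pos_eq:
  assumes "a > 0" "b > 0"
  shows "hent a b * ln 2 = a * ln ((a + b) / a) + b * ln ((a + b) / b)"
  using assms by (simp add: hent_def eta_def log_def ln_div field_simps)

text \<open>Gibbs' inequality with a free test law \<open>(t, 1 - t)\<close>: the uniform law yields
  \<open>hent_le\<close>, the normalised total of two weight pairs yields superadditivity.\<close>

lemma hent_gibbs:
  assumes "a \<ge> 0" "b \<ge> 0" "0 < t" "t < 1"
  shows "hent a b * ln 2 \<le> - a * ln t - b * ln (1 - t)"
proof -
  consider "a = 0" | "b = 0" | "a > 0" "b > 0" using assms by fastforce
  then show ?thesis
  proof cases
    case 3
    have "ln ((a + b) / a) + ln t \<le> (a + b) * t / a - 1"
      using ln_le_minus_one[of "(a + b) / a * t"] ln_mult_pos[of "(a + b) / a" t] 3 assms by simp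
    then have 1: "a * (ln ((a + b) / a) + ln t) \<le> (a + b) * t - a"
      using 3 mult_left_mono[of _ "(a + b) * t / a - 1" a] by (simp add: right_diff_distrib)
    have "ln ((a + b) / b) + ln (1 - t) \<le> (a + b) * (1 - t) / b - 1"
      using ln_le_minus_one[of "(a + b) / b * (1 - t)"] ln_mult_pos[of "(a + b) / b" "1 - t"] 3 assms
      by simp
    then have 2: "b * (ln ((a + b) / b) + ln (1 - t)) \<le> (a + b) * (1 - t) - b"
      using mult_left_mono[of "ln ((a + b) / b) + ln (1 - t)" "(a + b) * (1 - t) / b - 1" b] 3
      by (simp add: field_simps)
    show ?thesis using 1 2 unfolding hent_pos_eq[OF 3]
        by (simp add: distrib_left right_diff_distrib distrib_right)
  qed (use assms in \<open>auto simp: mult_nonneg_nonpos\<close>)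
qed

lemma hent_le:
  assumes "a \<ge> 0" "b \<ge> 0"
  shows "hent a b \<le> a + b"
proof -
  have "hent a b * ln 2 \<le> (a + b) * ln 2"
    using hent_gibbs[OF assms, of "1/2"] by (simp add: ln_div algebra_simps)
  then show ?thesis by simp
qed

text \<open>From \<open>ln x \<ge> 1 - 1 / x\<close>, with the factor \<open>ln 2 < 1\<close>
  dropped. After Cauchy-Schwarz this becomes the bound of \<open>Z\<close> by the root of
  \<open>H\<close>.\<close>

lemma hent_ge:
  assumes "a \<ge> 0" "b \<ge> 0"
  shows "2 * (a * b) \<le> hent a b * (a + b)"
proof -
  consider "a = 0" | "b = 0" | "a > 0" "b > 0" using assms by fastforce
  then show ?thesis
  proof cases
    case 3
    have 1: "b / (a + b) \<le> ln ((a + b) / a)"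
      using ln_le_minus_one[of "a / (a + b)"] 3 by (simp add: ln_div field_simps)
    have 2: "a / (a + b) \<le> ln ((a + b) / b)"
      using ln_le_minus_one[of "b / (a + b)"] 3 by (simp add: ln_div field_simps)
    have "2 * (a * b) / (a + b) = a * (b / (a + b)) + b * (a / (a + b))" by (simp add: field_simps)
    also have "\<dots> \<le> hent a b * ln 2"
      unfolding hent_pos_eq[OF 3] using 1 2 3 by (intro add_mono mult_left_mono) auto
    finally have 4: "2 * (a * b) / (a + b) \<le> hent a b * ln 2" .
    moreover have "0 \<le> 2 * (a * b) / (a + b)" using 3 by simp
    ultimately have "0 \<le> hent a b * ln 2" by linarith
    then have "0 \<le> hent a b" by (simp add: zero_le_mult_iff)
    then have "hent a b * ln 2 \<le> hent a b * 1"
      by (intro mult_left_mono) (use ln_2_less_1 in auto)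
    then have "2 * (a * b) / (a + b) \<le> hent a b" using 4 by simp
    then show ?thesis using 3 by (simp add: pos_divide_le_eq)
  qed auto
qed

lemma hent_nonneg:
  assumes "a \<ge> 0" "b \<ge> 0"
  shows "0 \<le> hent a b"
proof (cases "a + b = 0")
  case False
  then have "a + b > 0" using assms by linarith
  moreover have "0 \<le> hent a b * (a + b)"
    using hent_ge[OF assms] assms by (meson mult_nonneg_nonneg order_trans zero_le_numeral)
  ultimately show ?thesis by (simp add: zero_le_mult_iff)
qed (use assms in \<open>simp add: add_nonneg_eq_0_iff\<close>)

lemma hent_scale:
  assumes "a \<ge> 0" "b \<ge> 0" "c \<ge> 0"
  shows "hent (c * a) (c * b) = c * hent a b"
proof -
  consider "c = 0" | "a = 0" | "b = 0" | "a > 0" "b > 0" "c > 0" using assms by fastforce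
  then show ?thesis
  proof cases
    case 4
    then have "hent (c * a) (c * b) * ln 2 = c * (hent a b * ln 2)"
      using hent_pos_eq[of "c * a" "c * b"] hent_pos_eq[of a b]
      by (simp add: distrib_left[symmetric] mult.assoc)
    then show ?thesis by simp
  qed auto
qed

lemma hent_diag: "a \<ge> 0 \<Longrightarrow> hent a a = 2 * a"
  using hent_pos_eq[of a a] by (cases "a = 0") auto

text \<open>Concavity of the entropy in homogeneous form: one test law for both pairs, chosen so
  that Gibbs' inequality is tight for their sum.\<close>

lemma hent_superadditive:
  assumes "a \<ge> 0" "b \<ge> 0" "a' \<ge> 0" "b' \<ge> 0"
  shows "hent a b + hent a' b' \<le> hent (a + a') (b + b')"
proof -
  consider "a + a' = 0" | "b + b' = 0" | "a + a' > 0" "b + b' > 0" using assms by fastforce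
  then show ?thesis
  proof cases
    case 3
    define t where "t = (a + a') / (a + a' + (b + b'))"
    have t: "0 < t" "t < 1" "1 - t = (b + b') / (a + a' + (b + b'))"
      using 3 by (auto simp: t_def field_simps)
    have "hent a b * ln 2 + hent a' b' * ln 2 \<le> - (a + a') * ln t - (b + b') * ln (1 - t)"
      using hent_gibbs[of a b t] hent_gibbs[of a' b' t] assms t(1,2) by (simp add: algebra_simps)
    also have "\<dots> = hent (a + a') (b + b') * ln 2"
      unfolding hent_pos_eq[OF 3] t(3) unfolding t_def
      using 3 by (simp add: ln_div algebra_simps)
    finally have "(hent a b + hent a' b') * ln 2 \<le> hent (a + a') (b + b') * ln 2"
      by (simp add: algebra_simps)
    then show ?thesis by simp
  next
    case 1 then show ?thesis using assms by (simp add: add_nonneg_eq_0_iff)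
  next
    case 2 then show ?thesis using assms by (simp add: add_nonneg_eq_0_iff)
  qed
qed

text \<open>The weights on the left are those of the sum modulo 2 of two independent bits. As a mixture
  of the weights \<open>(a0, a1)\<close> and of uniform weights, their entropy is controlled by concavity.\<close>

lemma hent_convolution:
  assumes "a0 \<ge> 0" "a1 \<ge> 0" "b0 \<ge> 0" "b1 \<ge> 0"
  shows "hent a0 a1 * (b0 + b1) + (b0 + b1 - \<bar>b0 - b1\<bar>) * (a0 + a1 - hent a0 a1)
    \<le> hent (a0 * b0 + a1 * b1) (a0 * b1 + a1 * b0)"
proof -
  have *: "hent a0 a1 * (b0 + b1) + (b0 + b1 - \<bar>b0 - b1\<bar>) * (a0 + a1 - hent a0 a1)
    \<le> hent (a0 * b0 + a1 * b1) (a0 * b1 + a1 * b0)" if "b1 \<le> b0" "b1 \<ge> 0" for b0 b1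
  proof -
    have "hent ((b0 - b1) * a0) ((b0 - b1) * a1) + hent (b1 * (a0 + a1)) (b1 * (a0 + a1))
        \<le> hent ((b0 - b1) * a0 + b1 * (a0 + a1)) ((b0 - b1) * a1 + b1 * (a0 + a1))"
      using that assms by (intro hent_superadditive) auto
    also have "\<dots> = hent (a0 * b0 + a1 * b1) (a0 * b1 + a1 * b0)"
      by (rule arg_cong2[where f = hent]) (auto simp: algebra_simps)
    finally show ?thesis
      using that assms by (simp add: hent_scale[of _ _ "b0 - b1"] hent_diag) (simp add: algebra_simps)
  qed
  show ?thesis
  proof (cases "b1 \<le> b0")
    case True
    then show ?thesis using *[of b1 b0] assms by simp
  next
    case False
    then show ?thesis using *[of b0 b1] assms
      by (subst hent_commute, subst abs_minus_commute) (simp add: add.commute)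
  qed
qed

text \<open>The smaller weight is half of \<open>a + b - \<bar>a - b\<bar>\<close>, so this is the
  pointwise form of a bound of \<open>H\<close> by a multiple of
  \<open>sqrt (1 - K)\<close>.\<close>

lemma hent_le_sqrt:
  assumes "a \<ge> 0" "b \<ge> 0"
  shows "hent a b \<le> 3 / ln 2 * (sqrt (min a b) * sqrt (a + b))"
proof -
  have *: "hent a b \<le> 3 / ln 2 * (sqrt b * sqrt (a + b))" if "b \<le> a" "b > 0" for a b
  proof -
    have "a * ln ((a + b) / a) \<le> b"
      using mult_left_mono[OF ln_le_minus_one[of "(a + b) / a"], of a] that by (simp add: field_simps)
    moreover have "b \<le> sqrt b * sqrt (a + b)"
      using that by (metis abs_of_pos le_add_same_cancel2 less_eq_real_def mult_left_mono order_trans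
          real_sqrt_abs2 real_sqrt_ge_0_iff real_sqrt_le_mono real_sqrt_mult)
    moreover have "b * ln ((a + b) / b) \<le> 2 * (sqrt b * sqrt (a + b))"
    proof -
      \<comment> \<open>Taking the root inside the logarithm first gives
        \<open>ln x \<le> 2 * sqrt x\<close>, which loses only a square root of the small
        weight.\<close>
      have "ln ((a + b) / b) = 2 * ln (sqrt ((a + b) / b))"
        using that by (simp add: ln_sqrt)
      also have "\<dots> \<le> 2 * sqrt ((a + b) / b)"
        using ln_le_minus_one[of "sqrt ((a + b) / b)"] that by simp
      finally have "b * ln ((a + b) / b) \<le> b * (2 * sqrt ((a + b) / b))"
        using that by (intro mult_left_mono) auto
      also have "\<dots> = 2 * (sqrt b * sqrt (a + b))"
      proof -
        have "b = sqrt b * sqrt b" using that by simp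
        then have "b * sqrt ((a + b) / b) = sqrt b * sqrt (a + b)"
          using that by (simp add: real_sqrt_divide field_simps)
        then show ?thesis by simp
      qed
      finally show ?thesis .
    qed
    ultimately have "hent a b * ln 2 \<le> 3 * (sqrt b * sqrt (a + b))"
      using hent_pos_eq[of a b] that by simp
    then show ?thesis by (simp add: field_simps)
  qed
  consider "a = 0" | "b = 0" | "b \<le> a" "b > 0" | "a \<le> b" "a > 0" using assms by fastforce
  then show ?thesis
  proof cases
    case 3 then show ?thesis using *[of b a] by (simp add: min.absorb2)
  next
    case 4 then show ?thesis using *[of a b] by (simp add: min.absorb1 hent_commute[of a b]
        add.commute[of a b])
  qed (use assms in \<open>auto simp: min_def\<close>)
qed

text \<open>Pinsker's inequality up to a constant, through the Hellinger distance:
  \<open>- ln y \<ge> 2 (1 - sqrt y)\<close> bounds the divergence from the uniform weights below.\<close>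

lemma hent_pinsker:
  assumes "a \<ge> 0" "b \<ge> 0"
  shows "(a - b)\<^sup>2 \<le> 4 * (a + b) * (a + b - hent a b)"
proof -
  consider "a = 0" | "b = 0" | "a > 0" "b > 0" using assms by fastforce
  then show ?thesis
  proof cases
    case 3
    define x y T where "x = sqrt a" and "y = sqrt b" and "T = a + b"
    have xy: "x > 0" "y > 0" "a = x * x" "b = y * y" using 3 by (auto simp: x_def y_def)
    have T: "T > 0" "T = a + b" using 3 by (auto simp: T_def)
    \<comment> \<open>\<open>r\<close> is the root of the uniform weight;
      \<open>4 * (r * r) - 2 * r * (x + y)\<close> is then the squared distance of
      \<open>(x, y)\<close> from \<open>(r, r)\<close>.\<close>
    define r where "r = sqrt (T / 2)"
    have r: "r > 0" "r * r = T / 2" using T by (auto simp: r_def)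
    have log: "z * z * (2 * (1 - r / z)) \<le> z * z * ln (2 * (z * z) / T)" if "z > 0" for z
    proof (intro mult_left_mono)
      have "ln (2 * (z * z) / T) = - ln ((r / z) * (r / z))"
        using r that T by (subst ln_inverse[symmetric]) (auto simp: field_simps)
      also have "\<dots> = - 2 * ln (r / z)" using r that ln_mult_pos[of "r / z" "r / z"] by simp
      also have "\<dots> \<ge> 2 * (1 - r / z)" using ln_le_minus_one[of "r / z"] r that by simp
      finally show "2 * (1 - r / z) \<le> ln (2 * (z * z) / T)" by simp
    qed auto
    have eq: "(T - hent a b) * ln 2 = x * x * ln (2 * (x * x) / T) + y * y * ln (2 * (y * y) / T)"
      using hent_pos_eq[OF 3] 3 T unfolding xy(3,4)[symmetric]
          by (simp add: ln_div ln_mult algebra_simps)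
    have "x * x * (2 * (1 - r / x)) + y * y * (2 * (1 - r / y)) = 4 * (r * r) - 2 * r * (x + y)"
      using xy r T by (simp add: algebra_simps)
    then have 1: "4 * (r * r) - 2 * r * (x + y) \<le> (T - hent a b) * ln 2"
      using log[OF xy(1)] log[OF xy(2)] unfolding eq by linarith
    have 2: "4 * (r * r) = (x + y)\<^sup>2 + (x - y)\<^sup>2"
      using xy T r by (simp add: power2_eq_square algebra_simps)
    have "(x + y)\<^sup>2 \<le> (2 * r)\<^sup>2" using 2 zero_le_power2[of "x - y"] by (simp add: power2_eq_square)
    then have 3: "x + y \<le> 2 * r" by (rule power2_le_imp_le) (use r in auto)
    have "(x - y)\<^sup>2 = (2 * r - (x + y)) * (2 * r + (x + y))"
      using 2 by (simp add: power2_eq_square algebra_simps)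
    also have "\<dots> \<le> (2 * r - (x + y)) * (4 * r)"
      using 3 by (intro mult_left_mono) auto
    also have "\<dots> = 2 * (4 * (r * r) - 2 * r * (x + y))" by (simp add: algebra_simps)
    also have "\<dots> \<le> 2 * ((T - hent a b) * ln 2)" using 1 by simp
    also have "\<dots> \<le> 2 * (T - hent a b)"
      using hent_le[OF assms] ln_2_less_1 T mult_left_le[of "ln 2" "T - hent a b"] by simp
    finally have 4: "(x - y)\<^sup>2 \<le> 2 * (T - hent a b)" .
    have "(a - b)\<^sup>2 = (x + y)\<^sup>2 * (x - y)\<^sup>2"
      unfolding xy(3,4) by (simp add: power2_eq_square algebra_simps)
    also have "\<dots> \<le> (4 * (r * r)) * (2 * (T - hent a b))"
      using \<open>(x + y)\<^sup>2 \<le> (2 * r)\<^sup>2\<close> 4 hent_le[OF assms] T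
      by (intro mult_mono) (auto simp: power2_eq_square)
    also have "\<dots> = 4 * T * (T - hent a b)" unfolding r(2) by simp
    finally show ?thesis by (simp add: T_def)
  qed (auto simp: power2_eq_square)
qed

text \<open>Under the root the product expands into one term with \<open>a0 * a1\<close> and one
  with \<open>b0 * b1\<close>; roots are subadditive, and sums of squares are at most squares of
  sums.\<close>

lemma bhatt_convolution:
  fixes a0 a1 b0 b1 :: real
  assumes "a0 \<ge> 0" "a1 \<ge> 0" "b0 \<ge> 0" "b1 \<ge> 0"
  shows "sqrt ((a0 * b0 + a1 * b1) * (a0 * b1 + a1 * b0))
    \<le> sqrt (a0 * a1) * (b0 + b1) + sqrt (b0 * b1) * (a0 + a1)"
proof -
  have "(a0 * b0 + a1 * b1) * (a0 * b1 + a1 * b0)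
      = (a0 * a1) * (b0\<^sup>2 + b1\<^sup>2) + (b0 * b1) * (a0\<^sup>2 + a1\<^sup>2)"
    by (simp add: power2_eq_square algebra_simps)
  also have "\<dots> \<le> (a0 * a1) * (b0 + b1)\<^sup>2 + (b0 * b1) * (a0 + a1)\<^sup>2"
    using assms by (intro add_mono mult_left_mono) (auto simp: power2_sum)
  finally have "sqrt ((a0 * b0 + a1 * b1) * (a0 * b1 + a1 * b0))
      \<le> sqrt ((a0 * a1) * (b0 + b1)\<^sup>2 + (b0 * b1) * (a0 + a1)\<^sup>2)" by simp
  also have "\<dots> \<le> sqrt ((a0 * a1) * (b0 + b1)\<^sup>2) + sqrt ((b0 * b1) * (a0 + a1)\<^sup>2)"
    using assms by (intro sqrt_add_le_add_sqrt) auto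
  also have "\<dots> = sqrt (a0 * a1) * (b0 + b1) + sqrt (b0 * b1) * (a0 + a1)"
    using assms by (simp add: real_sqrt_mult)
  finally show ?thesis .
qed

text \<open>In terms of sums and differences of the weights, the two quantities are half the sum and
  half the difference of the same two products \<open>p\<close> and \<open>q\<close>; their absolute
  values add up to the larger of \<open>\<bar>p\<bar>\<close> and
  \<open>\<bar>q\<bar>\<close>.\<close>

lemma abs_convolution_plus:
  fixes a0 a1 b0 b1 :: real
  assumes "a0 \<ge> 0" "a1 \<ge> 0" "b0 \<ge> 0" "b1 \<ge> 0"
  shows "\<bar>a0 * b0 - a1 * b1\<bar> + \<bar>a1 * b0 - a0 * b1\<bar>
    \<le> \<bar>a0 - a1\<bar> * (b0 + b1) + (a0 + a1) * \<bar>b0 - b1\<bar>"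
proof -
  have 1: "2 * (a0 * b0 - a1 * b1) = (a0 - a1) * (b0 + b1) + (a0 + a1) * (b0 - b1)"
    and 2: "2 * (a1 * b0 - a0 * b1) = - ((a0 - a1) * (b0 + b1)) + (a0 + a1) * (b0 - b1)"
    by (auto simp: algebra_simps)
  have "\<bar>(a0 - a1) * (b0 + b1)\<bar> = \<bar>a0 - a1\<bar> * (b0 + b1)"
       "\<bar>(a0 + a1) * (b0 - b1)\<bar> = (a0 + a1) * \<bar>b0 - b1\<bar>"
    using assms by (auto simp: abs_mult)
  moreover have "\<bar>x\<bar> + \<bar>y\<bar> \<le> \<bar>p\<bar> + \<bar>q\<bar>" if "2 * x = p + q" "2 * y = - p + q" for x y p q :: real
    using that by linarith
  ultimately show ?thesis using 1 2 by metis
qed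

section \<open>Entropy, total variation and Bhattacharyya functionals\<close>

definition ent :: "'w measure \<Rightarrow> ('w \<Rightarrow> 'a) \<Rightarrow> real" where
  "ent M V = (\<Sum>v\<in>V ` space M. eta (ev_prob M (\<lambda>\<omega>. V \<omega> = v)))"

text \<open>Common form of \<open>H\<close>, \<open>K\<close>, \<open>Z\<close> and the total mass.
  Monotonicity under finer observations becomes superadditivity of \<open>f\<close>.\<close>

definition obs_sum :: "'w measure \<Rightarrow> (real \<Rightarrow> real \<Rightarrow> real) \<Rightarrow> ('w \<Rightarrow> bool) \<Rightarrow> ('w \<Rightarrow> 'q) \<Rightarrow> real" where
  "obs_sum M f U Q = (\<Sum>q\<in>Q ` space M.
     f (ev_prob M (\<lambda>\<omega>. \<not> U \<omega> \<and> Q \<omega> = q)) (ev_prob M (\<lambda>\<omega>. U \<omega> \<and> Q \<omega> = q)))"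

text \<open>Observations matter only through the partition they induce. Saying this without a
  bijection of values identifies tuples of different types and orders.\<close>

definition same_partition :: "'w measure \<Rightarrow> ('w \<Rightarrow> 'a) \<Rightarrow> ('w \<Rightarrow> 'b) \<Rightarrow> bool" where
  "same_partition M V W \<longleftrightarrow> (\<forall>\<omega>\<in>space M. \<forall>\<omega>'\<in>space M. V \<omega> = V \<omega>' \<longleftrightarrow> W \<omega> = W \<omega>')"

lemma inj_on_fibres: "inj_on (\<lambda>v. {\<omega>\<in>space M. V \<omega> = v}) (V ` space M)"
  by (auto simp: inj_on_def)

lemma sum_same_partition:
  fixes G :: "'w set \<Rightarrow> 'c::comm_monoid_add"
  assumes "same_partition M V W"
  shows "(\<Sum>v\<in>V ` space M. G {\<omega>\<in>space M. V \<omega> = v}) = (\<Sum>w\<in>W ` space M. G {\<omega>\<in>space M. W \<omega> = w})"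
proof -
  have eq: "(\<lambda>v. {\<omega>\<in>space M. V \<omega> = v}) ` V ` space M = (\<lambda>w. {\<omega>\<in>space M. W \<omega> = w}) ` W ` space M"
    using assms unfolding same_partition_def image_image by (intro image_cong refl) auto
  have "(\<Sum>v\<in>V ` space M. G {\<omega>\<in>space M. V \<omega> = v}) = sum G ((\<lambda>v. {\<omega>\<in>space M. V \<omega> = v}) ` V ` space M)"
    by (simp add: sum.reindex[OF inj_on_fibres])
  also have "\<dots> = (\<Sum>w\<in>W ` space M. G {\<omega>\<in>space M. W \<omega> = w})"
    unfolding eq by (simp add: sum.reindex[OF inj_on_fibres])
  finally show ?thesis .
qed

lemma ent_same_partition: "same_partition M V W \<Longrightarrow> ent M V = ent M W"
  unfolding ent_def ev_prob_def by (rule sum_same_partition)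

lemma obs_sum_fibres:
  "obs_sum M f U Q = (\<Sum>q\<in>Q ` space M. (\<lambda>A. f (measure M {\<omega>\<in>A. \<not> U \<omega>}) (measure M {\<omega>\<in>A. U \<omega>}))
    {\<omega>\<in>space M. Q \<omega> = q})"
  unfolding obs_sum_def ev_prob_def
  by (intro sum.cong refl arg_cong2[where f = f] arg_cong[where f = "measure M"]) auto

lemma obs_sum_same_partition:
  "same_partition M Q R \<Longrightarrow> obs_sum M f U Q = obs_sum M f U R"
  unfolding obs_sum_fibres by (rule sum_same_partition)

text \<open>A bit that is a function of the observation merely swaps the two weights at some
  observed values.\<close>

lemma obs_sum_xor:
  assumes sym: "\<And>a b. f a b = f b a"
    and U: "\<And>\<omega>. \<omega> \<in> space M \<Longrightarrow> U \<omega> \<longleftrightarrow> U' \<omega> \<noteq> g (Q \<omega>)"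
  shows "obs_sum M f U Q = obs_sum M f U' Q"
  unfolding obs_sum_def
proof (intro sum.cong refl)
  fix q
  show "f (ev_prob M (\<lambda>\<omega>. \<not> U \<omega> \<and> Q \<omega> = q)) (ev_prob M (\<lambda>\<omega>. U \<omega> \<and> Q \<omega> = q)) =
    f (ev_prob M (\<lambda>\<omega>. \<not> U' \<omega> \<and> Q \<omega> = q)) (ev_prob M (\<lambda>\<omega>. U' \<omega> \<and> Q \<omega> = q))"
  proof (cases "g q")
    case True
    then have "ev_prob M (\<lambda>\<omega>. \<not> U \<omega> \<and> Q \<omega> = q) = ev_prob M (\<lambda>\<omega>. U' \<omega> \<and> Q \<omega> = q)"
      "ev_prob M (\<lambda>\<omega>. U \<omega> \<and> Q \<omega> = q) = ev_prob M (\<lambda>\<omega>. \<not> U' \<omega> \<and> Q \<omega> = q)"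
      unfolding ev_prob_def by (auto intro!: arg_cong[where f = "measure M"] simp: U)
    then show ?thesis using sym by simp
  next
    case False
    then have "ev_prob M (\<lambda>\<omega>. \<not> U \<omega> \<and> Q \<omega> = q) = ev_prob M (\<lambda>\<omega>. \<not> U' \<omega> \<and> Q \<omega> = q)"
      "ev_prob M (\<lambda>\<omega>. U \<omega> \<and> Q \<omega> = q) = ev_prob M (\<lambda>\<omega>. U' \<omega> \<and> Q \<omega> = q)"
      unfolding ev_prob_def by (auto intro!: arg_cong[where f = "measure M"] simp: U)
    then show ?thesis by simp
  qed
qed

section \<open>Finite-range random variables and their event probabilities\<close>

lemma ev_prob_nonneg [simp]: "0 \<le> ev_prob M P"
  by (simp add: ev_prob_def)

lemma simple_functionI_finite:
  assumes "V \<in> measurable M (count_space UNIV)" "finite (V ` space M)"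
  shows "simple_function M V"
  unfolding simple_function_def using assms by auto

context prob_space
begin

lemma simple_pred_sets:
  assumes "simple_function M V"
  shows "{\<omega>\<in>space M. P (V \<omega>)} \<in> events"
proof -
  have "{\<omega>\<in>space M. P (V \<omega>)} = (\<Union>v\<in>{v\<in>V ` space M. P v}. V -` {v} \<inter> space M)" by auto
  also have "\<dots> \<in> events"
    using assms by (intro sets.finite_UN) (auto simp: simple_function_def)
  finally show ?thesis .
qed

lemma ev_prob_sum:
  assumes "simple_function M V" "simple_function M W" "finite D" "W ` space M \<subseteq> D"
  shows "ev_prob M (\<lambda>\<omega>. P (V \<omega>)) = (\<Sum>w\<in>D. ev_prob M (\<lambda>\<omega>. P (V \<omega>) \<and> W \<omega> = w))"
proof -
  have sf: "simple_function M (\<lambda>\<omega>. (V \<omega>, W \<omega>))" using assms by auto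
  have "(\<Sum>w\<in>D. ev_prob M (\<lambda>\<omega>. P (V \<omega>) \<and> W \<omega> = w))
      = measure M (\<Union>w\<in>D. {\<omega>\<in>space M. P (V \<omega>) \<and> W \<omega> = w})"
    unfolding ev_prob_def
    using simple_pred_sets[OF sf, of "\<lambda>x. P (fst x) \<and> snd x = _"] assms(3)
    by (intro finite_measure_finite_Union[symmetric]) (auto simp: disjoint_family_on_def)
  also have "(\<Union>w\<in>D. {\<omega>\<in>space M. P (V \<omega>) \<and> W \<omega> = w}) = {\<omega>\<in>space M. P (V \<omega>)}"
    using assms(4) by auto
  finally show ?thesis by (simp add: ev_prob_def)
qed

lemma ev_prob_mono:
  assumes "simple_function M V" "\<And>\<omega>. \<omega> \<in> space M \<Longrightarrow> P \<omega> \<Longrightarrow> R (V \<omega>)"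
  shows "ev_prob M P \<le> ev_prob M (\<lambda>\<omega>. R (V \<omega>))"
  unfolding ev_prob_def using simple_pred_sets[OF assms(1), of R] assms(2)
  by (intro finite_measure_mono) auto

lemma ev_prob_cong:
  assumes "\<And>\<omega>. \<omega> \<in> space M \<Longrightarrow> P \<omega> \<longleftrightarrow> R \<omega>"
  shows "ev_prob M P = ev_prob M R"
  unfolding ev_prob_def using assms by (auto intro: arg_cong[where f = "measure M"])

lemma ev_prob_impossible: "(\<And>\<omega>. \<omega> \<in> space M \<Longrightarrow> \<not> P \<omega>) \<Longrightarrow> ev_prob M P = 0"
  using ev_prob_cong[of P "\<lambda>_. False"] by (simp add: ev_prob_def)

lemma ev_prob_image:
  assumes "v \<notin> V ` space M"
  shows "ev_prob M (\<lambda>\<omega>. P \<omega> \<and> V \<omega> = v) = 0"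
proof -
  have "{\<omega>\<in>space M. P \<omega> \<and> V \<omega> = v} = {}" using assms by auto
  then show ?thesis unfolding ev_prob_def by (metis measure_empty)
qed

lemma ev_prob_total:
  assumes "simple_function M V" "finite D" "V ` space M \<subseteq> D"
  shows "(\<Sum>v\<in>D. ev_prob M (\<lambda>\<omega>. V \<omega> = v)) = 1"
  using ev_prob_sum[OF assms(1,1,2,3), of "\<lambda>_. True"] prob_space
  by (simp add: ev_prob_def)

text \<open>The value of \<open>f\<close> at the origin makes unattained observations contribute
  nothing, so that sums may run over product sets.\<close>

lemma obs_sum_superset:
  assumes "finite D" "Q ` space M \<subseteq> D" "f 0 0 = 0"
  shows "obs_sum M f U Q
    = (\<Sum>q\<in>D. f (ev_prob M (\<lambda>\<omega>. \<not> U \<omega> \<and> Q \<omega> = q)) (ev_prob M (\<lambda>\<omega>. U \<omega> \<and> Q \<omega> = q)))"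
  unfolding obs_sum_def using assms by (intro sum.mono_neutral_left) (auto simp: ev_prob_image)

lemma sum_superadditive:
  fixes f :: "real \<Rightarrow> real \<Rightarrow> real"
  assumes "f 0 0 = 0"
    and "\<And>a b a' b'. \<lbrakk>0 \<le> a; 0 \<le> b; 0 \<le> a'; 0 \<le> b'\<rbrakk> \<Longrightarrow> f a b + f a' b' \<le> f (a + a') (b + b')"
    and "\<And>i. 0 \<le> x i" "\<And>i. 0 \<le> y i"
  shows "(\<Sum>i\<in>I. f (x i) (y i)) \<le> f (\<Sum>i\<in>I. x i) (\<Sum>i\<in>I. y i)"
proof (cases "finite I")
  case True
  then show ?thesis
  proof induction
    case (insert i I)
    then have "(\<Sum>i\<in>insert i I. f (x i) (y i)) \<le> f (x i) (y i) + f (sum x I) (sum y I)" by simp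
    also have "\<dots> \<le> f (x i + sum x I) (y i + sum y I)"
      using assms by (intro assms(2)) (auto simp: sum_nonneg)
    finally show ?case using insert by simp
  qed (use assms in auto)
qed (use assms in auto)

text \<open>Data processing: a finer observation splits each pair of weights into a sum of pairs,
  and superadditivity of \<open>f\<close> fixes the direction.\<close>

lemma obs_sum_refine:
  assumes "f 0 0 = 0"
    and "\<And>a b a' b'. \<lbrakk>0 \<le> a; 0 \<le> b; 0 \<le> a'; 0 \<le> b'\<rbrakk> \<Longrightarrow> f a b + f a' b' \<le> f (a + a') (b + b')"
    and U: "simple_function M U" and Q: "simple_function M Q" and R: "simple_function M R"
  shows "obs_sum M f U (\<lambda>\<omega>. (Q \<omega>, R \<omega>)) \<le> obs_sum M f U Q"
proof -
  let ?DQ = "Q ` space M" and ?DR = "R ` space M"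
  have fin: "finite ?DQ" "finite ?DR" using Q R by (auto simp: simple_function_def)
  let ?p = "\<lambda>u q r. ev_prob M (\<lambda>\<omega>. (U \<omega> \<longleftrightarrow> u) \<and> Q \<omega> = q \<and> R \<omega> = r)"
  have sfUQ: "simple_function M (\<lambda>\<omega>. (U \<omega>, Q \<omega>))" using U Q by auto
  have sm: "ev_prob M (\<lambda>\<omega>. (U \<omega> \<longleftrightarrow> u) \<and> Q \<omega> = q) = (\<Sum>r\<in>?DR. ?p u q r)" for u q
    using ev_prob_sum[OF sfUQ R fin(2) subset_refl, of "\<lambda>x. (fst x \<longleftrightarrow> u) \<and> snd x = q"] by simp
  have "obs_sum M f U (\<lambda>\<omega>. (Q \<omega>, R \<omega>)) = (\<Sum>(q, r)\<in>?DQ \<times> ?DR. f (?p False q r) (?p True q r))"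
    using fin assms(1) by (subst obs_sum_superset[where D
        = "?DQ \<times> ?DR"]) (auto simp: split_def prod_eq_iff)
  also have "\<dots> = (\<Sum>q\<in>?DQ. \<Sum>r\<in>?DR. f (?p False q r) (?p True q r))"
    by (simp add: sum.cartesian_product)
  also have "\<dots> \<le> (\<Sum>q\<in>?DQ. f (\<Sum>r\<in>?DR. ?p False q r) (\<Sum>r\<in>?DR. ?p True q r))"
    by (intro sum_mono sum_superadditive assms(1,2)) auto
  also have "\<dots> = obs_sum M f U Q"
    unfolding sm[symmetric] by (simp add: obs_sum_def)
  finally show ?thesis .
qed

lemma obs_sum_mass:
  assumes U: "simple_function M U" and Q: "simple_function M Q"
  shows "obs_sum M (+) U Q = 1"
proof -
  have fin: "finite (Q ` space M)" using Q by (auto simp: simple_function_def)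
  have "ev_prob M (\<lambda>\<omega>. Q \<omega> = q)
      = ev_prob M (\<lambda>\<omega>. \<not> U \<omega> \<and> Q \<omega> = q) + ev_prob M (\<lambda>\<omega>. U \<omega> \<and> Q \<omega> = q)" for q
    using ev_prob_sum[OF Q U finite_class.finite_UNIV subset_UNIV, of "\<lambda>x. x
        = q"] by (simp add: UNIV_bool conj_commute)
  then show ?thesis
    using ev_prob_total[OF Q fin subset_refl] by (simp add: obs_sum_def)
qed

section \<open>Shannon entropy: submodularity, conditional independence, chain rule\<close>

lemma sum_image_compose:
  assumes V: "simple_function M V" and W: "simple_function M W"
    and g: "\<And>\<omega>. \<omega> \<in> space M \<Longrightarrow> V \<omega> = g (W \<omega>)"
  shows "(\<Sum>v\<in>V ` space M. ev_prob M (\<lambda>\<omega>. V \<omega> = v) * \<phi> v)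
    = (\<Sum>w\<in>W ` space M. ev_prob M (\<lambda>\<omega>. W \<omega> = w) * \<phi> (g w))"
proof -
  have fin: "finite (V ` space M)" "finite (W ` space M)" using V W by (auto simp: simple_function_def)
  have "(\<Sum>v\<in>V ` space M. ev_prob M (\<lambda>\<omega>. V \<omega> = v) * \<phi> v)
      = (\<Sum>v\<in>V ` space M. \<Sum>w\<in>W ` space M. ev_prob M (\<lambda>\<omega>. V \<omega> = v \<and> W \<omega> = w) * \<phi> v)"
    using ev_prob_sum[OF V W fin(2) subset_refl, of "\<lambda>x. x = _"] by (simp add: sum_distrib_right)
  also have "\<dots> = (\<Sum>w\<in>W ` space M. \<Sum>v\<in>V ` space M. ev_prob M (\<lambda>\<omega>. V \<omega> = v \<and> W \<omega> = w) * \<phi> v)"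
    by (rule sum.swap)
  also have "\<dots> = (\<Sum>w\<in>W ` space M. \<Sum>v\<in>V ` space M.
      if v = g w then ev_prob M (\<lambda>\<omega>. W \<omega> = w) * \<phi> v else 0)"
  proof (intro sum.cong refl)
    fix v w
    show "ev_prob M (\<lambda>\<omega>. V \<omega> = v \<and> W \<omega> = w) * \<phi> v
        = (if v = g w then ev_prob M (\<lambda>\<omega>. W \<omega> = w) * \<phi> v else 0)"
    proof (cases "v = g w")
      case True
      then have "ev_prob M (\<lambda>\<omega>. V \<omega> = v \<and> W \<omega> = w) = ev_prob M (\<lambda>\<omega>. W \<omega> = w)"
        using g by (intro ev_prob_cong) auto
      then show ?thesis using True by simp
    next
      case False
      then have "ev_prob M (\<lambda>\<omega>. V \<omega> = v \<and> W \<omega> = w) = ev_prob M (\<lambda>\<omega>. False)"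
        using g by (intro ev_prob_cong) auto
      then show ?thesis using False by (simp add: ev_prob_def)
    qed
  qed
  also have "\<dots> = (\<Sum>w\<in>W ` space M. ev_prob M (\<lambda>\<omega>. W \<omega> = w) * \<phi> (g w))"
    using fin g by (intro sum.cong refl) (auto simp: sum.delta')
  finally show ?thesis .
qed

text \<open>Entropies of different marginals of \<open>W\<close> become averages over the same
  values, so they can be combined term by term.\<close>

lemma ent_compose:
  assumes "simple_function M V" "simple_function M W"
    and "\<And>\<omega>. \<omega> \<in> space M \<Longrightarrow> V \<omega> = g (W \<omega>)"
  shows "ent M V = - (\<Sum>w\<in>W ` space M. ev_prob M (\<lambda>\<omega>. W \<omega> = w) * log 2 (ev_prob M (\<lambda>\<omega>. V \<omega> = g w)))"
  using sum_image_compose[OF assms, of "\<lambda>v. log 2 (ev_prob M (\<lambda>\<omega>. V \<omega> = v))"]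
  by (simp add: ent_def eta_def sum_negf)

text \<open>The left side is the conditional mutual information of \<open>A\<close> and
  \<open>C\<close> given \<open>B\<close>; each summand is a probability times the logarithm of the
  ratio of the true law to the one with \<open>A\<close> and \<open>C\<close> independent given
  \<open>B\<close>.\<close>

lemma cond_mutual_information_sum:
  fixes A :: "'a \<Rightarrow> 'x" and B :: "'a \<Rightarrow> 'y" and C :: "'a \<Rightarrow> 'z"
  assumes A: "simple_function M A" and B: "simple_function M B" and C: "simple_function M C"
  defines "W \<equiv> \<lambda>\<omega>. (A \<omega>, B \<omega>, C \<omega>)"
  defines "T \<equiv> \<lambda>w. case w of (a, b, c) \<Rightarrow> ev_prob M (\<lambda>\<omega>. W \<omega> = (a, b, c)) *
      (log 2 (ev_prob M (\<lambda>\<omega>. W \<omega> = (a, b, c))) + log 2 (ev_prob M (\<lambda>\<omega>. B \<omega> = b))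
        - log 2 (ev_prob M (\<lambda>\<omega>. (A \<omega>, B \<omega>) = (a, b))) - log 2 (ev_prob M (\<lambda>\<omega>. (B \<omega>, C \<omega>) = (b, c))))"
  shows "ent M (\<lambda>\<omega>. (A \<omega>, B \<omega>)) + ent M (\<lambda>\<omega>. (B \<omega>, C \<omega>)) - ent M W - ent M B
    = (\<Sum>w\<in>W ` space M. T w)"
proof -
  have W: "simple_function M W" unfolding W_def using A B C by auto
  have 1: "ent M W = - (\<Sum>w\<in>W ` space M. ev_prob M (\<lambda>\<omega>. W \<omega> = w) * log 2 (ev_prob M (\<lambda>\<omega>. W \<omega> = w)))"
    by (rule ent_compose[OF W W, of id, simplified])
  have 2: "ent M B = - (\<Sum>w\<in>W ` space M. ev_prob M (\<lambda>\<omega>. W \<omega> = w) * log 2 (ev_prob M (\<lambda>\<omega>. B \<omega>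
      = fst (snd w))))"
    by (rule ent_compose[OF B W]) (simp add: W_def)
  have 3: "ent M (\<lambda>\<omega>. (A \<omega>, B \<omega>)) = - (\<Sum>w\<in>W ` space M. ev_prob M (\<lambda>\<omega>. W \<omega> = w) *
      log 2 (ev_prob M (\<lambda>\<omega>. (A \<omega>, B \<omega>) = (fst w, fst (snd w)))))"
    by (rule ent_compose[OF _ W]) (use A B in \<open>auto simp: W_def\<close>)
  have 4: "ent M (\<lambda>\<omega>. (B \<omega>, C \<omega>)) = - (\<Sum>w\<in>W ` space M. ev_prob M (\<lambda>\<omega>. W \<omega> = w) *
      log 2 (ev_prob M (\<lambda>\<omega>. (B \<omega>, C \<omega>) = snd w)))"
    by (rule ent_compose[OF _ W]) (use B C in \<open>auto simp: W_def\<close>)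
  show ?thesis
    unfolding 1 2 3 4 T_def
    by (simp add: split_def prod_eq_iff distrib_left right_diff_distrib sum.distrib sum_subtractf)
qed

text \<open>Nonnegativity of conditional mutual information, by
  \<open>ln x \<le> x - 1\<close>.\<close>

lemma ent_submodular:
  assumes A: "simple_function M A" and B: "simple_function M B" and C: "simple_function M C"
  shows "ent M (\<lambda>\<omega>. (A \<omega>, B \<omega>, C \<omega>)) + ent M B \<le> ent M (\<lambda>\<omega>. (A \<omega>, B \<omega>)) + ent M (\<lambda>\<omega>. (B \<omega>, C \<omega>))"
proof -
  let ?W = "\<lambda>\<omega>. (A \<omega>, B \<omega>, C \<omega>)"
  let ?DA = "A ` space M" and ?DB = "B ` space M" and ?DC = "C ` space M"
  let ?T = "\<lambda>w. case w of (a, b, c) \<Rightarrow> ev_prob M (\<lambda>\<omega>. ?W \<omega> = (a, b, c)) *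
      (log 2 (ev_prob M (\<lambda>\<omega>. ?W \<omega> = (a, b, c))) + log 2 (ev_prob M (\<lambda>\<omega>. B \<omega> = b))
        - log 2 (ev_prob M (\<lambda>\<omega>. (A \<omega>, B \<omega>) = (a, b))) - log 2 (ev_prob M (\<lambda>\<omega>. (B \<omega>, C \<omega>) = (b, c))))"
  \<comment> \<open>\<open>?R\<close> is the law with the same pair marginals that makes
    \<open>A\<close> and \<open>C\<close> independent given \<open>B\<close>; its total mass is
    \<open>1\<close>, hence at most \<open>1\<close> on the attained triples.\<close>
  let ?R = "\<lambda>a b c. ev_prob M (\<lambda>\<omega>. (A \<omega>, B \<omega>) = (a, b)) * ev_prob M (\<lambda>\<omega>. (B \<omega>, C \<omega>) = (b, c)) /
    ev_prob M (\<lambda>\<omega>. B \<omega> = b)"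
  have AB: "simple_function M (\<lambda>\<omega>. (A \<omega>, B \<omega>))" and BC: "simple_function M (\<lambda>\<omega>. (B \<omega>, C \<omega>))"
    and W: "simple_function M ?W" using A B C by auto
  have fin: "finite ?DA" "finite ?DB" "finite ?DC" "finite (?W ` space M)"
    using A B C W by (auto simp: simple_function_def)
  have tm: "ev_prob M (\<lambda>\<omega>. ?W \<omega> = (a, b, c)) - ?R a b c \<le> ?T (a, b, c) * ln 2" for a b c
  proof (cases "ev_prob M (\<lambda>\<omega>. ?W \<omega> = (a, b, c)) = 0")
    case True
    then show ?thesis by simp
  next
    case False
    let ?p = "ev_prob M (\<lambda>\<omega>. ?W \<omega> = (a, b, c))"
    let ?ab = "ev_prob M (\<lambda>\<omega>. (A \<omega>, B \<omega>) = (a, b))" and ?bc = "ev_prob M (\<lambda>\<omega>. (B \<omega>, C \<omega>) = (b, c))"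
      and ?b = "ev_prob M (\<lambda>\<omega>. B \<omega> = b)"
    have p: "?p > 0" using False ev_prob_nonneg[of M "\<lambda>\<omega>. ?W \<omega> = (a, b, c)"] by linarith
    have "?p \<le> ?ab" "?p \<le> ?bc" "?p \<le> ?b"
      using ev_prob_mono[OF AB, of "\<lambda>\<omega>. ?W \<omega> = (a, b, c)" "\<lambda>x. x = (a, b)"]
        ev_prob_mono[OF BC, of "\<lambda>\<omega>. ?W \<omega> = (a, b, c)" "\<lambda>x. x = (b, c)"]
        ev_prob_mono[OF B, of "\<lambda>\<omega>. ?W \<omega> = (a, b, c)" "\<lambda>x. x = b"] by auto
    then have pos: "?ab > 0" "?bc > 0" "?b > 0" using p by linarith+
    have "?T (a, b, c) * ln 2 = ?p * (ln ?p + ln ?b - ln ?ab - ln ?bc)"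
      by (simp add: log_def field_simps)
    also have "\<dots> = - (?p * ln (?ab * ?bc / (?b * ?p)))"
      using pos p by (simp add: ln_div ln_mult algebra_simps)
    also have "\<dots> \<ge> - (?p * (?ab * ?bc / (?b * ?p) - 1))"
      using ln_le_minus_one[of "?ab * ?bc / (?b * ?p)"] pos p by simp
    also have "- (?p * (?ab * ?bc / (?b * ?p) - 1)) = ?p - ?R a b c"
      using pos p by (simp add: field_simps)
    finally show ?thesis by simp
  qed
  have "(\<Sum>(a, b, c)\<in>?W ` space M. ?R a b c) \<le> (\<Sum>(a, b, c)\<in>?DA \<times> ?DB \<times> ?DC. ?R a b c)"
    using fin by (intro sum_mono2) auto
  also have "\<dots> = (\<Sum>b\<in>?DB. \<Sum>a\<in>?DA. \<Sum>c\<in>?DC. ?R a b c)"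
    unfolding sum.cartesian_product[symmetric] by (rule sum.swap)
  also have "\<dots> = (\<Sum>b\<in>?DB. (\<Sum>a\<in>?DA. ev_prob M (\<lambda>\<omega>. (A \<omega>, B \<omega>) = (a, b))) *
      (\<Sum>c\<in>?DC. ev_prob M (\<lambda>\<omega>. (B \<omega>, C \<omega>) = (b, c))) / ev_prob M (\<lambda>\<omega>. B \<omega> = b))"
    by (simp add: sum_product sum_divide_distrib)
  also have "\<dots> = (\<Sum>b\<in>?DB. ev_prob M (\<lambda>\<omega>. B \<omega> = b))"
  proof (intro sum.cong refl)
    fix b
    have "(\<Sum>a\<in>?DA. ev_prob M (\<lambda>\<omega>. (A \<omega>, B \<omega>) = (a, b))) = ev_prob M (\<lambda>\<omega>. B \<omega> = b)"
      using ev_prob_sum[OF B A fin(1) subset_refl, of "\<lambda>x. x = b"] by (simp add: conj_commute)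
    moreover have "(\<Sum>c\<in>?DC. ev_prob M (\<lambda>\<omega>. (B \<omega>, C \<omega>) = (b, c))) = ev_prob M (\<lambda>\<omega>. B \<omega> = b)"
      using ev_prob_sum[OF B C fin(3) subset_refl, of "\<lambda>x. x = b"] by simp
    ultimately show "(\<Sum>a\<in>?DA. ev_prob M (\<lambda>\<omega>. (A \<omega>, B \<omega>) = (a, b))) *
      (\<Sum>c\<in>?DC. ev_prob M (\<lambda>\<omega>. (B \<omega>, C \<omega>) = (b, c))) / ev_prob M (\<lambda>\<omega>. B \<omega> = b)
      = ev_prob M (\<lambda>\<omega>. B \<omega> = b)" by simp
  qed
  also have "\<dots> = 1" by (rule ev_prob_total[OF B fin(2) subset_refl])
  finally have "0 \<le> (\<Sum>w\<in>?W ` space M. ev_prob M (\<lambda>\<omega>. ?W \<omega> = w)) - (\<Sum>(a, b, c)\<in>?W ` space M. ?R a b c)"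
    using ev_prob_total[OF W fin(4) subset_refl] by linarith
  also have "\<dots> = (\<Sum>(a, b, c)\<in>?W ` space M. ev_prob M (\<lambda>\<omega>. ?W \<omega> = (a, b, c)) - ?R a b c)"
    by (simp add: sum_subtractf split_def prod_eq_iff)
  also have "\<dots> \<le> (\<Sum>w\<in>?W ` space M. ?T w * ln 2)"
    using tm by (intro sum_mono) (auto simp del: prod.inject)
  also have "\<dots> = (\<Sum>w\<in>?W ` space M. ?T w) * ln 2" by (simp add: sum_distrib_right)
  finally have "0 \<le> (\<Sum>w\<in>?W ` space M. ?T w)" by (simp add: zero_le_mult_iff)
  then show ?thesis using cond_mutual_information_sum[OF A B C] by linarith
qed

lemma ent_cond_indep:
  assumes A: "simple_function M A" and B: "simple_function M B" and C: "simple_function M C"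
    and ind: "\<And>a b c. ev_prob M (\<lambda>\<omega>. A \<omega> = a \<and> B \<omega> = b \<and> C \<omega> = c) * ev_prob M (\<lambda>\<omega>. B \<omega> = b)
      = ev_prob M (\<lambda>\<omega>. A \<omega> = a \<and> B \<omega> = b) * ev_prob M (\<lambda>\<omega>. B \<omega> = b \<and> C \<omega> = c)"
  shows "ent M (\<lambda>\<omega>. (A \<omega>, B \<omega>, C \<omega>)) + ent M B = ent M (\<lambda>\<omega>. (A \<omega>, B \<omega>)) + ent M (\<lambda>\<omega>. (B \<omega>, C \<omega>))"
proof -
  let ?W = "\<lambda>\<omega>. (A \<omega>, B \<omega>, C \<omega>)"
  let ?T = "\<lambda>w. case w of (a, b, c) \<Rightarrow> ev_prob M (\<lambda>\<omega>. ?W \<omega> = (a, b, c)) *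
      (log 2 (ev_prob M (\<lambda>\<omega>. ?W \<omega> = (a, b, c))) + log 2 (ev_prob M (\<lambda>\<omega>. B \<omega> = b))
        - log 2 (ev_prob M (\<lambda>\<omega>. (A \<omega>, B \<omega>) = (a, b))) - log 2 (ev_prob M (\<lambda>\<omega>. (B \<omega>, C \<omega>) = (b, c))))"
  have tm: "?T (a, b, c) = 0" for a b c
  proof (cases "ev_prob M (\<lambda>\<omega>. ?W \<omega> = (a, b, c)) = 0")
    case False
    let ?p = "ev_prob M (\<lambda>\<omega>. ?W \<omega> = (a, b, c))"
    let ?ab = "ev_prob M (\<lambda>\<omega>. (A \<omega>, B \<omega>) = (a, b))" and ?bc = "ev_prob M (\<lambda>\<omega>. (B \<omega>, C \<omega>) = (b, c))"
      and ?b = "ev_prob M (\<lambda>\<omega>. B \<omega> = b)"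
    have p: "?p > 0" using False ev_prob_nonneg[of M "\<lambda>\<omega>. ?W \<omega> = (a, b, c)"] by linarith
    have "?p \<le> ?b" using ev_prob_mono[OF B, of "\<lambda>\<omega>. ?W \<omega> = (a, b, c)" "\<lambda>x. x = b"] by auto
    then have b: "?b > 0" using p by linarith
    have eq: "?p * ?b = ?ab * ?bc" using ind[of a b c] by simp
    then have "?ab * ?bc \<noteq> 0" using mult_pos_pos[OF p b] by linarith
    then have "?ab \<noteq> 0" "?bc \<noteq> 0" unfolding mult_eq_0_iff de_Morgan_disj
        by (rule conjunct1, rule conjunct2)
    then have "?ab > 0" "?bc > 0" using order_le_neq_trans[OF ev_prob_nonneg] by metis+
    then have "log 2 ?p + log 2 ?b - log 2 ?ab - log 2 ?bc = 0"
      using arg_cong[OF eq, of "log 2"] p b by (simp add: log_mult)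
    then show ?thesis by simp
  qed simp
  have "(\<Sum>w\<in>?W ` space M. ?T w) = 0"
    using tm by (intro sum.neutral) (auto simp del: prod.inject)
  then show ?thesis using cond_mutual_information_sum[OF A B C] by linarith
qed

text \<open>Submodularity with \<open>C = A\<close>, where all three joint entropies
  coincide.\<close>

lemma ent_mono:
  assumes A: "simple_function M A" and B: "simple_function M B"
  shows "ent M B \<le> ent M (\<lambda>\<omega>. (A \<omega>, B \<omega>))"
proof -
  have "ent M (\<lambda>\<omega>. (A \<omega>, B \<omega>, A \<omega>)) = ent M (\<lambda>\<omega>. (A \<omega>, B \<omega>))"
    and "ent M (\<lambda>\<omega>. (B \<omega>, A \<omega>)) = ent M (\<lambda>\<omega>. (A \<omega>, B \<omega>))"
    by (auto intro!: ent_same_partition simp: same_partition_def)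
  then show ?thesis using ent_submodular[OF A B A] by linarith
qed

text \<open>Chain rule. It links the pointwise estimates of \<open>hent\<close> to submodularity of
  \<open>ent\<close>.\<close>

lemma obs_sum_hent:
  assumes U: "simple_function M U" and Q: "simple_function M Q"
  shows "obs_sum M hent U Q = ent M (\<lambda>\<omega>. (U \<omega>, Q \<omega>)) - ent M Q"
proof -
  have fin: "finite (Q ` space M)" using Q by (auto simp: simple_function_def)
  have m: "ev_prob M (\<lambda>\<omega>. Q \<omega> = q)
      = ev_prob M (\<lambda>\<omega>. \<not> U \<omega> \<and> Q \<omega> = q) + ev_prob M (\<lambda>\<omega>. U \<omega> \<and> Q \<omega> = q)" for q
    using ev_prob_sum[OF Q U finite_class.finite_UNIV subset_UNIV, of "\<lambda>x. x
        = q"] by (simp add: UNIV_bool conj_commute)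
  have "ent M (\<lambda>\<omega>. (U \<omega>, Q \<omega>))
      = (\<Sum>x\<in>UNIV \<times> Q ` space M. eta (ev_prob M (\<lambda>\<omega>. (U \<omega>, Q \<omega>) = x)))"
    unfolding ent_def
  proof (intro sum.mono_neutral_left)
    show "\<forall>i\<in>UNIV \<times> Q ` space M - (\<lambda>\<omega>. (U \<omega>, Q \<omega>)) ` space M. eta (ev_prob M (\<lambda>\<omega>. (U \<omega>, Q \<omega>) = i)) = 0"
    proof
      fix i assume i: "i \<in> UNIV \<times> Q ` space M - (\<lambda>\<omega>. (U \<omega>, Q \<omega>)) ` space M"
      then show "eta (ev_prob M (\<lambda>\<omega>. (U \<omega>, Q \<omega>) = i)) = 0"
        using ev_prob_image[of i "\<lambda>\<omega>. (U \<omega>, Q \<omega>)" "\<lambda>_. True"] by simp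
    qed
  qed (use fin in auto)
  also have "\<dots> = (\<Sum>u\<in>UNIV. \<Sum>q\<in>Q ` space M. eta (ev_prob M (\<lambda>\<omega>. U \<omega> = u \<and> Q \<omega> = q)))"
    by (simp add: sum.cartesian_product split_def prod_eq_iff)
  finally show ?thesis
    unfolding obs_sum_def hent_def m[symmetric]
    by (simp add: sum.distrib sum_subtractf UNIV_bool ent_def)
qed

lemma cond_entropy_ent:
  assumes A: "simple_function M A" and B: "simple_function M B"
  shows "cond_entropy M A B = ent M (\<lambda>\<omega>. (A \<omega>, B \<omega>)) - ent M B"
proof -
  let ?W = "\<lambda>\<omega>. (A \<omega>, B \<omega>)"
  have W: "simple_function M ?W" using A B by auto
  have 1: "ent M ?W = - (\<Sum>w\<in>?W ` space M. ev_prob M (\<lambda>\<omega>. ?W \<omega> = w) * log 2 (ev_prob M (\<lambda>\<omega>. ?W \<omega> = w)))"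
    by (rule ent_compose[OF W W, of id, simplified])
  have 2: "ent M B = - (\<Sum>w\<in>?W ` space M. ev_prob M (\<lambda>\<omega>. ?W \<omega> = w) * log 2 (ev_prob M (\<lambda>\<omega>. B \<omega> = snd w)))"
    by (rule ent_compose[OF B W]) simp
  have tm: "ev_prob M (\<lambda>\<omega>. A \<omega> = a \<and> B \<omega> = b) * log 2 (ev_prob M (\<lambda>\<omega>. A \<omega> = a \<and> B \<omega>
      = b) / ev_prob M (\<lambda>\<omega>. B \<omega> = b))
     = ev_prob M (\<lambda>\<omega>. A \<omega> = a \<and> B \<omega> = b) * log 2 (ev_prob M (\<lambda>\<omega>. A \<omega> = a \<and> B \<omega> = b))
       - ev_prob M (\<lambda>\<omega>. A \<omega> = a \<and> B \<omega> = b) * log 2 (ev_prob M (\<lambda>\<omega>. B \<omega> = b))" for a b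
  proof (cases "ev_prob M (\<lambda>\<omega>. A \<omega> = a \<and> B \<omega> = b) = 0")
    case False
    then have p: "ev_prob M (\<lambda>\<omega>. A \<omega> = a \<and> B \<omega> = b) > 0" by (simp add: order_less_le)
    moreover have "ev_prob M (\<lambda>\<omega>. A \<omega> = a \<and> B \<omega> = b) \<le> ev_prob M (\<lambda>\<omega>. B \<omega> = b)"
      by (rule ev_prob_mono[OF B]) auto
    ultimately have "ev_prob M (\<lambda>\<omega>. B \<omega> = b) > 0" by linarith
    then show ?thesis using p by (simp add: log_divide algebra_simps)
  qed simp
  show ?thesis unfolding cond_entropy_def 1 2 tm
    by (simp add: split_def sum_subtractf prod_eq_iff)
qed

lemma Cauchy_Schwarz_sqrt_sum:
  fixes x y :: "'i \<Rightarrow> real"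
  assumes "\<And>i. i \<in> I \<Longrightarrow> 0 \<le> x i" "\<And>i. i \<in> I \<Longrightarrow> 0 \<le> y i"
  shows "(\<Sum>i\<in>I. sqrt (x i) * sqrt (y i)) \<le> sqrt (\<Sum>i\<in>I. x i) * sqrt (\<Sum>i\<in>I. y i)"
proof -
  have "(\<Sum>i\<in>I. sqrt (x i) * sqrt (y i)) \<le> (\<Sum>i\<in>I. \<bar>sqrt (x i)\<bar> * \<bar>sqrt (y i)\<bar>)"
    by (intro sum_mono) (simp add: abs_mult[symmetric])
  also have "\<dots> \<le> L2_set (\<lambda>i. sqrt (x i)) I * L2_set (\<lambda>i. sqrt (y i)) I"
    by (rule L2_set_mult_ineq)
  also have "\<dots> = sqrt (\<Sum>i\<in>I. x i) * sqrt (\<Sum>i\<in>I. y i)"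
    unfolding L2_set_def using assms by simp
  finally show ?thesis .
qed

text \<open>Pointwise bounds with the root of the mass \<open>a + b\<close> average to bounds with a
  single root, since the total mass is \<open>1\<close>.\<close>

lemma obs_sum_Cauchy_Schwarz:
  assumes U: "simple_function M U" and Q: "simple_function M Q"
    and fg: "\<And>a b. \<lbrakk>0 \<le> a; 0 \<le> b\<rbrakk> \<Longrightarrow> f a b \<le> sqrt (g a b) * sqrt (a + b)"
    and g: "\<And>a b. \<lbrakk>0 \<le> a; 0 \<le> b\<rbrakk> \<Longrightarrow> 0 \<le> g a b"
  shows "obs_sum M f U Q \<le> sqrt (obs_sum M g U Q)"
proof -
  let ?a = "\<lambda>q. ev_prob M (\<lambda>\<omega>. \<not> U \<omega> \<and> Q \<omega> = q)" and ?b = "\<lambda>q. ev_prob M (\<lambda>\<omega>. U \<omega> \<and> Q \<omega> = q)"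
  have "obs_sum M f U Q \<le> (\<Sum>q\<in>Q ` space M. sqrt (g (?a q) (?b q)) * sqrt (?a q + ?b q))"
    unfolding obs_sum_def by (intro sum_mono fg) auto
  also have "\<dots> \<le> sqrt (\<Sum>q\<in>Q ` space M. g (?a q) (?b q)) * sqrt (\<Sum>q\<in>Q ` space M. ?a q + ?b q)"
    by (intro Cauchy_Schwarz_sqrt_sum g) auto
  also have "\<dots> = sqrt (obs_sum M g U Q)"
    using obs_sum_mass[OF U Q] by (simp add: obs_sum_def)
  finally show ?thesis .
qed

end

section \<open>Comparisons between \<open>H\<close>, \<open>K\<close> and \<open>Z\<close>\<close>

abbreviation "Hpar M \<equiv> obs_sum M hent"
abbreviation "Kpar M \<equiv> obs_sum M (\<lambda>a b. \<bar>a - b\<bar>)"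
abbreviation "Zpar M \<equiv> obs_sum M (\<lambda>a b. 2 * sqrt (a * b))"

lemma bhattacharyya_eq_Zpar: "bhattacharyya M U Q = Zpar M U Q"
  by (simp add: bhattacharyya_def obs_sum_def sum_distrib_left)

lemma obs_sum_mono:
  assumes "\<And>a b. \<lbrakk>0 \<le> a; 0 \<le> b\<rbrakk> \<Longrightarrow> f a b \<le> g a b"
  shows "obs_sum M f U Q \<le> obs_sum M g U Q"
  unfolding obs_sum_def using assms by (intro sum_mono) auto

lemma obs_sum_linear:
  "obs_sum M (\<lambda>a b. c * f a b + d * g a b) U Q = c * obs_sum M f U Q + d * obs_sum M g U Q"
  by (simp add: obs_sum_def sum.distrib sum_distrib_left)

context prob_space
begin

context
  fixes U :: "'a \<Rightarrow> bool" and Q :: "'a \<Rightarrow> 'q"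
  assumes U: "simple_function M U" and Q: "simple_function M Q"
begin

lemma Hpar_bounds: "0 \<le> Hpar M U Q" "Hpar M U Q \<le> 1"
  using obs_sum_mono[of hent "(+)" M U Q] hent_le obs_sum_mass[OF U Q]
  by (auto simp: obs_sum_def hent_nonneg intro: sum_nonneg)

lemma Kpar_bounds: "0 \<le> Kpar M U Q" "Kpar M U Q \<le> 1"
  using obs_sum_mono[of "\<lambda>a b. \<bar>a - b\<bar>" "(+)" M U Q] obs_sum_mass[OF U Q]
  by (auto simp: obs_sum_def intro: sum_nonneg)

lemma Zpar_bounds: "0 \<le> Zpar M U Q" "Zpar M U Q \<le> 1"
proof -
  have "Zpar M U Q \<le> obs_sum M (+) U Q"
    by (rule obs_sum_mono) (use arith_geo_mean_sqrt in \<open>fastforce simp: field_simps\<close>)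
  then show "Zpar M U Q \<le> 1" using obs_sum_mass[OF U Q] by simp
qed (auto simp: obs_sum_def intro!: sum_nonneg)

text \<open>\<open>a + b - \<bar>a - b\<bar>\<close> is twice the minimum, and the minimum is at
  most the geometric mean.\<close>

lemma Zpar_ge_Kpar: "1 - Kpar M U Q \<le> Zpar M U Q"
proof -
  have *: "a + b - \<bar>a - b\<bar> \<le> 2 * sqrt (a * b)" if "0 \<le> a" "0 \<le> b" for a b :: real
  proof -
    have "(min a b)\<^sup>2 \<le> a * b" using that by (auto simp: min_def power2_eq_square mult_mono)
    then have "min a b \<le> sqrt (a * b)" by (rule real_le_rsqrt)
    then show ?thesis by (auto simp: min_def abs_if split: if_splits)
  qed
  have "obs_sum M (\<lambda>a b. 1 * (a + b) + (-1) * \<bar>a - b\<bar>) U Q \<le> Zpar M U Q"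
    by (rule obs_sum_mono) (use * in auto)
  then show ?thesis using obs_sum_mass[OF U Q] by (simp only: obs_sum_linear)
qed

lemma Zpar_le_Hpar: "Zpar M U Q \<le> sqrt (2 * Hpar M U Q)"
proof -
  \<comment> \<open>The summand \<open>0 * a\<close> brings the integrand into the two-term shape of
    \<open>obs_sum_linear\<close>.\<close>
  have "Zpar M U Q \<le> sqrt (obs_sum M (\<lambda>a b. 2 * hent a b + 0 * a) U Q)"
  proof (rule obs_sum_Cauchy_Schwarz[OF U Q])
    fix a b :: real assume ab: "0 \<le> a" "0 \<le> b"
    have "2 * sqrt (a * b) = sqrt (4 * (a * b))" by (simp add: real_sqrt_mult)
    also have "\<dots> \<le> sqrt (2 * (hent a b * (a + b)))"
      using hent_ge[OF ab] by (intro real_sqrt_le_mono) linarith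
    finally show "2 * sqrt (a * b) \<le> sqrt (2 * hent a b + 0 * a) * sqrt (a + b)"
      by (simp add: real_sqrt_mult)
  qed (use hent_nonneg in auto)
  then show ?thesis by (simp only: obs_sum_linear) simp
qed

lemma Kpar_le_Hpar: "Kpar M U Q \<le> sqrt (4 * (1 - Hpar M U Q))"
proof -
  have "Kpar M U Q \<le> sqrt (obs_sum M (\<lambda>a b. 4 * (a + b) + (-4) * hent a b) U Q)"
  proof (rule obs_sum_Cauchy_Schwarz[OF U Q])
    fix a b :: real assume ab: "0 \<le> a" "0 \<le> b"
    have "\<bar>a - b\<bar> = sqrt ((a - b)\<^sup>2)" by simp
    also have "\<dots> \<le> sqrt ((4 * (a + b) + (-4) * hent a b) * (a + b))"
      using hent_pinsker[OF ab] by (intro real_sqrt_le_mono) (simp add: algebra_simps)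
    finally show "\<bar>a - b\<bar> \<le> sqrt (4 * (a + b) + (-4) * hent a b) * sqrt (a + b)"
      by (simp add: real_sqrt_mult)
    show "0 \<le> 4 * (a + b) + (-4) * hent a b" using hent_le[OF ab] by simp
  qed
  then show ?thesis using obs_sum_mass[OF U Q] by (simp only: obs_sum_linear) simp
qed

text \<open>Read as a lower bound, \<open>1 - K\<close> is at least a multiple of the square of
  \<open>H\<close>; this expresses the gain of the minus-minus step through the entropy
  alone.\<close>

lemma Hpar_le_Kpar: "Hpar M U Q \<le> 3 / ln 2 * sqrt (1 - Kpar M U Q)"
proof -
  have "Hpar M U Q \<le> sqrt (obs_sum M (\<lambda>a b. (3 / ln 2)\<^sup>2 * (a + b) + (- ((3 / ln 2)\<^sup>2)) * \<bar>a - b\<bar>) U Q)"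
  proof (rule obs_sum_Cauchy_Schwarz[OF U Q])
    fix a b :: real assume ab: "0 \<le> a" "0 \<le> b"
    have m: "a + b - \<bar>a - b\<bar> = 2 * min a b" by (auto simp: min_def)
    have "sqrt (min a b) \<le> sqrt (a + b - \<bar>a - b\<bar>)"
      unfolding m using ab by (intro real_sqrt_le_mono) (auto simp: min_def)
    then have "3 / ln 2 * (sqrt (min a b) * sqrt (a + b))
        \<le> 3 / ln 2 * (sqrt (a + b - \<bar>a - b\<bar>) * sqrt (a + b))"
      using ab by (intro mult_left_mono mult_right_mono) auto
    also have "\<dots> = sqrt ((3 / ln 2)\<^sup>2 * (a + b - \<bar>a - b\<bar>)) * sqrt (a + b)"
      by (simp add: real_sqrt_mult)
    finally show "hent a b \<le> sqrt ((3 / ln 2)\<^sup>2 * (a + b) + (- ((3 / ln 2)\<^sup>2)) * \<bar>a - b\<bar>) * sqrt (a + b)"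
      using hent_le_sqrt[OF ab] by (simp add: algebra_simps)
    show "0 \<le> (3 / ln 2)\<^sup>2 * (a + b) + (- ((3 / ln 2)\<^sup>2)) * \<bar>a - b\<bar>"
      using mult_left_mono[of "\<bar>a - b\<bar>" "a + b" "(3 / ln 2)\<^sup>2"] ab by simp
  qed
  also have "\<dots> = sqrt ((3 / ln 2)\<^sup>2 * (1 - Kpar M U Q))"
    using obs_sum_mass[OF U Q] by (simp only: obs_sum_linear) (simp add: algebra_simps)
  also have "\<dots> = 3 / ln 2 * sqrt (1 - Kpar M U Q)" by (simp add: real_sqrt_mult)
  finally show ?thesis .
qed

end

end

section \<open>Markov structure of FAIM processes\<close>

text \<open>Numerical semigroups with greatest common divisor \<open>1\<close> contain all large
  numbers; meant for the return times of the state chain.\<close>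

lemma additive_closed_Gcd_1:
  fixes A :: "nat set"
  assumes add: "\<And>x y. x \<in> A \<Longrightarrow> y \<in> A \<Longrightarrow> x + y \<in> A" and gcd: "Gcd A = 1"
  shows "\<exists>N. \<forall>n\<ge>N. n \<in> A"
proof -
  define B where "B = insert 0 A"
  have Badd: "x \<in> B \<Longrightarrow> y \<in> B \<Longrightarrow> x + y \<in> B" for x y using add by (auto simp: B_def)
  have Bmult: "x \<in> B \<Longrightarrow> k * x \<in> B" for x k
    by (induction k) (auto simp: Badd, simp add: B_def)
  obtain x where x: "x \<in> A" "x > 0"
    using gcd by (metis Gcd_0_iff gr0I singletonI subsetI one_neq_zero)
  \<comment> \<open>\<open>P\<close> describes the positive differences of elements of
    \<open>B\<close>. The least one divides every element, because a remainder is again such a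
    difference.\<close>
  define P where "P = (\<lambda>d. d > 0 \<and> (\<exists>b\<in>B. b + d \<in> B))"
  have "P x" using x by (auto simp: P_def B_def)
  define d where "d = (LEAST d. P d)"
  have "P d" unfolding d_def by (rule LeastI[of P, OF \<open>P x\<close>])
  then obtain b where b: "d > 0" "b \<in> B" "b + d \<in> B" by (auto simp: P_def)
  have "d dvd y" if "y \<in> A" for y
  proof (rule ccontr)
    assume "\<not> d dvd y"
    then have r: "y mod d > 0" by (simp add: mod_greater_zero_iff_not_dvd)
    let ?q = "y div d"
    have "?q * (b + d) + y mod d = y + ?q * b"
      using div_mult_mod_eq[of y d] by (simp add: algebra_simps)
    moreover have "y + ?q * b \<in> B" using that b by (intro Badd Bmult) (auto simp: B_def)
    ultimately have "P (y mod d)" using r Bmult[OF b(3)] unfolding P_def by metis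
    then have "d \<le> y mod d" unfolding d_def by (rule Least_le)
    then show False using b(1) mod_less_divisor[of d y] by linarith
  qed
  then have "d dvd Gcd A" by (rule Gcd_greatest)
  then have d: "d = 1" using gcd by simp
  \<comment> \<open>With \<open>b\<close> and \<open>b + 1\<close> in \<open>B\<close>, any
    \<open>n\<close> whose quotient by \<open>b\<close> is at least its remainder is a combination
    of the two. The extra \<open>1\<close> keeps \<open>n\<close> away from the adjoined
    \<open>0\<close>.\<close>
  have "n \<in> A" if "n \<ge> b * b + 1" for n
  proof -
    have "n \<in> B"
    proof (cases "b = 0")
      case True
      then show ?thesis using Bmult[of 1 n] b d by simp
    next
      case False
      let ?q = "n div b" and ?r = "n mod b"
      have "b \<le> ?q" using that False by (metis add_leD1 div_le_mono nonzero_mult_div_cancel_left)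
      moreover have "?r < b" using False by simp
      ultimately have "(?q - ?r) * b + ?r * (b + 1) = ?q * b + ?r"
        by (simp add: algebra_simps diff_mult_distrib)
      then have "n = (?q - ?r) * b + ?r * (b + 1)" by simp
      then show ?thesis using Badd[OF Bmult Bmult, of b "b + 1"] b d by metis
    qed
    then show ?thesis using that by (auto simp: B_def)
  qed
  then show ?thesis by blast
qed

lemma simple_function_map:
  assumes "\<And>k. simple_function M (f k)"
  shows "simple_function M (\<lambda>\<omega>. map (\<lambda>k. f k \<omega>) [0..<m])"
proof (induction m)
  case (Suc m)
  show ?case
    using simple_function_compose2[OF Suc assms[of m], of "\<lambda>x y. x @ [y]"] by simp
qed auto

locale faim =
  fixes M :: "'w measure"
    and X :: "int \<Rightarrow> 'w \<Rightarrow> bool"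
    and Y :: "int \<Rightarrow> 'w \<Rightarrow> 'y::finite"
    and S :: "int \<Rightarrow> 'w \<Rightarrow> 's::finite"
  assumes faim: "faim_process M X Y S"
begin

sublocale prob_space M
  using faim by (simp add: faim_process_def)

lemma XYS_simple [simp]:
  "simple_function M (X j)" "simple_function M (Y j)" "simple_function M (S j)"
  using faim by (auto simp: faim_process_def intro!: simple_functionI_finite)

abbreviation window :: "nat \<Rightarrow> int \<Rightarrow> 'w \<Rightarrow> (bool \<times> 'y \<times> 's) list" where
  "window m t \<omega> \<equiv> map (\<lambda>k. triple X Y S (t + int k) \<omega>) [0..<m]"

text \<open>Read backwards from \<open>b\<close>, with each state one step before its input and
  output, as in \<open>markov_property\<close>; the word stops short of \<open>S b\<close>.\<close>

abbreviation past :: "nat \<Rightarrow> int \<Rightarrow> 'w \<Rightarrow> (bool \<times> 'y \<times> 's) list" where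
  "past m b \<omega> \<equiv> map (\<lambda>k. (X (b - int k) \<omega>, Y (b - int k) \<omega>, S (b - 1 - int k) \<omega>)) [0..<m]"

lemma triple_simple: "simple_function M (triple X Y S j)"
  unfolding triple_def by auto

lemma window_simple: "simple_function M (window m t)"
  by (rule simple_function_map) (rule triple_simple)

lemma past_simple: "simple_function M (past m b)"
  by (rule simple_function_map) auto

lemma stationary_window:
  "ev_prob M (\<lambda>\<omega>. P (window m t \<omega>)) = ev_prob M (\<lambda>\<omega>. P (window m 0 \<omega>))"
proof -
  let ?D = "{c :: (bool \<times> 'y \<times> 's) list. length c = m}"
  have D: "finite ?D" using finite_lists_length_eq[of "UNIV :: (bool \<times> 'y \<times> 's) set" m] by simp
  have c: "ev_prob M (\<lambda>\<omega>. window m t \<omega> = c) = ev_prob M (\<lambda>\<omega>. window m 0 \<omega> = c)" if "c \<in> ?D" for c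
  proof -
    have "ev_prob M (\<lambda>\<omega>. window m a \<omega> = c) = ev_prob M (\<lambda>\<omega>. \<forall>k<m. triple X Y S (a + int k) \<omega>
        = c ! k)" for a
      using that by (intro ev_prob_cong) (auto simp: list_eq_iff_nth_eq)
    moreover have "ev_prob M (\<lambda>\<omega>. \<forall>k<m. triple X Y S (a + int k) \<omega> = c ! k)
        = ev_prob M (\<lambda>\<omega>. \<forall>k<m. triple X Y S (int k) \<omega> = c ! k)" for a
      using faim unfolding faim_process_def strictly_stationary_def by blast
    ultimately show ?thesis by (simp only:)
  qed
  have "ev_prob M (\<lambda>\<omega>. P (window m a \<omega>)) = (\<Sum>c\<in>?D. if P c then ev_prob M (\<lambda>\<omega>. window m a \<omega>
      = c) else 0)" for a
  proof -
    have "ev_prob M (\<lambda>\<omega>. P (window m a \<omega>)) = (\<Sum>c\<in>?D. ev_prob M (\<lambda>\<omega>. P (window m a \<omega>) \<and> window m a \<omega>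
        = c))"
      by (rule ev_prob_sum[OF window_simple window_simple D]) auto
    also have "\<dots> = (\<Sum>c\<in>?D. if P c then ev_prob M (\<lambda>\<omega>. window m a \<omega> = c) else 0)"
    proof (intro sum.cong refl)
      fix c
      show "ev_prob M (\<lambda>\<omega>. P (window m a \<omega>) \<and> window m a \<omega> = c)
          = (if P c then ev_prob M (\<lambda>\<omega>. window m a \<omega> = c) else 0)"
        by (cases "P c") (auto intro!: ev_prob_cong ev_prob_impossible)
    qed
    finally show ?thesis .
  qed
  note E = this
  show ?thesis unfolding E[of t] E[of 0] by (intro sum.cong refl if_cong c)
qed

text \<open>The Markov property for single words extends to arbitrary events of past and future by
  summing over the finitely many words.\<close>

lemma markov_windows:
  "ev_prob M (\<lambda>\<omega>. A (past m b \<omega>) \<and> B (window m' (b + 1) \<omega>) \<and> S b \<omega> = s) * ev_prob M (\<lambda>\<omega>. S b \<omega> = s)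
   = ev_prob M (\<lambda>\<omega>. A (past m b \<omega>) \<and> S b \<omega> = s) * ev_prob M (\<lambda>\<omega>. B (window m' (b + 1) \<omega>) \<and> S b \<omega> = s)"
proof -
  let ?D = "\<lambda>m. {c :: (bool \<times> 'y \<times> 's) list. length c = m}"
  have D: "finite (?D m)" for m using finite_lists_length_eq[of "UNIV :: (bool \<times> 'y \<times> 's) set" m] by simp
  let ?P = "past m b" and ?F = "window m' (b + 1)"
  have base: "ev_prob M (\<lambda>\<omega>. ?P \<omega> = c \<and> ?F \<omega> = d \<and> S b \<omega> = s) * ev_prob M (\<lambda>\<omega>. S b \<omega> = s)
     = ev_prob M (\<lambda>\<omega>. ?P \<omega> = c \<and> S b \<omega> = s) * ev_prob M (\<lambda>\<omega>. ?F \<omega> = d \<and> S b \<omega> = s)"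
    if "c \<in> ?D m" "d \<in> ?D m'" for c d
  proof -
    have F: "(\<forall>k<m'. triple X Y S (b + 1 + int k) \<omega> = d ! k) \<longleftrightarrow> ?F \<omega> = d" for \<omega>
      using that by (auto simp: list_eq_iff_nth_eq)
    have P: "(\<forall>k<m. (X (b + 1 - 1 - int k) \<omega>, Y (b + 1 - 1 - int k) \<omega>, S (b + 1 - 2 - int k) \<omega>) = c ! k)
        \<longleftrightarrow> ?P \<omega> = c" for \<omega>
    proof -
      have "b + 1 - 2 - int k = b - 1 - int k" for k by simp
      then show ?thesis using that by (simp add: list_eq_iff_nth_eq)
    qed
    have b: "b + 1 - 1 = b" by simp
    have "markov_property M X Y S" using faim by (simp add: faim_process_def)
    \<comment> \<open>Instance with \<open>j = b + 1\<close>, whose conditioning state is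
      \<open>S b\<close>.\<close>
    from this[unfolded markov_property_def Let_def, rule_format, of m' "b
        + 1" "\<lambda>k. d ! k" m "\<lambda>k. c ! k" s]
    show ?thesis unfolding F P unfolding b by (simp add: conj_ac mult_ac)
  qed
  have PF: "simple_function M (\<lambda>\<omega>. (?P \<omega>, ?F \<omega>, S b \<omega>))"
    and P: "simple_function M (\<lambda>\<omega>. (?P \<omega>, S b \<omega>))" and F: "simple_function M (\<lambda>\<omega>. (?F \<omega>, S b \<omega>))"
    using past_simple window_simple by auto
  have PF': "simple_function M (\<lambda>\<omega>. (?P \<omega>, ?F \<omega>))" using past_simple window_simple by auto
  have 1: "ev_prob M (\<lambda>\<omega>. A (?P \<omega>) \<and> B (?F \<omega>) \<and> S b \<omega> = s)
      = (\<Sum>c\<in>?D m. \<Sum>d\<in>?D m'. of_bool (A c) * of_bool (B d) * ev_prob M (\<lambda>\<omega>. ?P \<omega> = c \<and> ?F \<omega>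
          = d \<and> S b \<omega> = s))"
  proof -
    have "ev_prob M (\<lambda>\<omega>. A (?P \<omega>) \<and> B (?F \<omega>) \<and> S b \<omega> = s)
      = (\<Sum>x\<in>?D m \<times> ?D m'. ev_prob M (\<lambda>\<omega>. (A (?P \<omega>) \<and> B (?F \<omega>) \<and> S b \<omega> = s) \<and> (?P \<omega>, ?F \<omega>) = x))"
      using ev_prob_sum[OF PF PF', of "?D m \<times> ?D m'" "\<lambda>(p, f, u). A p \<and> B f \<and> u = s"] D[of m] D[of m']
      by (simp add: conj_assoc image_subset_iff)
    also have "\<dots> = (\<Sum>(c, d)\<in>?D m \<times> ?D m'. of_bool (A c) * of_bool (B d) * ev_prob M (\<lambda>\<omega>. ?P \<omega>
        = c \<and> ?F \<omega> = d \<and> S b \<omega> = s))"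
      by (intro sum.cong refl) (auto intro!: ev_prob_cong ev_prob_impossible simp: of_bool_def)
    finally show ?thesis by (simp add: sum.cartesian_product)
  qed
  have 2: "ev_prob M (\<lambda>\<omega>. A (?P \<omega>) \<and> S b \<omega> = s)
      = (\<Sum>c\<in>?D m. of_bool (A c) * ev_prob M (\<lambda>\<omega>. ?P \<omega> = c \<and> S b \<omega> = s))"
  proof -
    have "ev_prob M (\<lambda>\<omega>. A (?P \<omega>) \<and> S b \<omega> = s)
      = (\<Sum>x\<in>?D m. ev_prob M (\<lambda>\<omega>. (A (?P \<omega>) \<and> S b \<omega> = s) \<and> ?P \<omega> = x))"
      using ev_prob_sum[OF P past_simple[of b m], of "?D m" "\<lambda>(p, u). A p \<and> u = s"] D[of m]
      by (simp add: conj_assoc image_subset_iff)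
    also have "\<dots> = (\<Sum>c\<in>?D m. of_bool (A c) * ev_prob M (\<lambda>\<omega>. ?P \<omega> = c \<and> S b \<omega> = s))"
      by (intro sum.cong refl) (auto intro!: ev_prob_cong ev_prob_impossible simp: of_bool_def)
    finally show ?thesis .
  qed
  have 3: "ev_prob M (\<lambda>\<omega>. B (?F \<omega>) \<and> S b \<omega> = s)
      = (\<Sum>d\<in>?D m'. of_bool (B d) * ev_prob M (\<lambda>\<omega>. ?F \<omega> = d \<and> S b \<omega> = s))"
  proof -
    have "ev_prob M (\<lambda>\<omega>. B (?F \<omega>) \<and> S b \<omega> = s)
      = (\<Sum>x\<in>?D m'. ev_prob M (\<lambda>\<omega>. (B (?F \<omega>) \<and> S b \<omega> = s) \<and> ?F \<omega> = x))"
      using ev_prob_sum[OF F window_simple[of "b + 1" m'], of "?D m'" "\<lambda>(p, u). B p \<and> u = s"] D[of m']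
      by (simp add: conj_assoc image_subset_iff)
    also have "\<dots> = (\<Sum>d\<in>?D m'. of_bool (B d) * ev_prob M (\<lambda>\<omega>. ?F \<omega> = d \<and> S b \<omega> = s))"
      by (intro sum.cong refl) (auto intro!: ev_prob_cong ev_prob_impossible simp: of_bool_def)
    finally show ?thesis .
  qed
  show ?thesis unfolding 1 2 3 unfolding sum_product unfolding sum_distrib_right
  proof (intro sum.cong refl)
    fix c d assume "c \<in> ?D m" "d \<in> ?D m'"
    from base[OF this]
    show "of_bool (A c) * of_bool (B d) * ev_prob M (\<lambda>\<omega>. ?P \<omega> = c \<and> ?F \<omega> = d \<and> S b \<omega>
        = s) * ev_prob M (\<lambda>\<omega>. S b \<omega> = s)
       = of_bool (A c) * ev_prob M (\<lambda>\<omega>. ?P \<omega> = c \<and> S b \<omega> = s) * (of_bool (B d) * ev_prob M (\<lambda>\<omega>. ?F \<omega>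
           = d \<and> S b \<omega> = s))"
      by (cases "A c"; cases "B d") auto
  qed
qed

section \<open>Shift-covariant functions of a block of the process\<close>

text \<open>The window contains the states at both ends but not the input and output at time \<open>t\<close>, so that
  adjacent blocks share exactly one state and nothing else.\<close>

definition block_fun :: "nat \<Rightarrow> (int \<Rightarrow> 'w \<Rightarrow> 'a) \<Rightarrow> bool" where
  "block_fun m V \<longleftrightarrow> (\<forall>t t' \<omega> \<omega>'.
     (\<forall>k\<in>{1..m}. X (t + int k) \<omega> = X (t' + int k) \<omega>' \<and> Y (t + int k) \<omega> = Y (t' + int k) \<omega>') \<longrightarrow>
     (\<forall>k\<in>{0..m}. S (t + int k) \<omega> = S (t' + int k) \<omega>') \<longrightarrow> V t \<omega> = V t' \<omega>')"

lemma block_funD: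
  assumes "block_fun m V"
    and "\<And>k. k \<in> {1..m} \<Longrightarrow> X (t + int k) \<omega> = X (t' + int k) \<omega>'"
    and "\<And>k. k \<in> {1..m} \<Longrightarrow> Y (t + int k) \<omega> = Y (t' + int k) \<omega>'"
    and "\<And>k. k \<in> {0..m} \<Longrightarrow> S (t + int k) \<omega> = S (t' + int k) \<omega>'"
  shows "V t \<omega> = V t' \<omega>'"
  using assms unfolding block_fun_def by blast

text \<open>Agreement is required across positions and outcomes at once, so a single
  \<open>g\<close> serves for every \<open>t\<close>; this is how stationarity reaches
  \<open>V\<close>.\<close>

lemma block_fun_window:
  assumes "block_fun m V"
  obtains g where "\<And>t \<omega>. V t \<omega> = g (window (m + 1) t \<omega>)"
proof -
  have eq: "V t \<omega> = V t' \<omega>'" if w: "window (m + 1) t \<omega> = window (m + 1) t' \<omega>'" for t \<omega> t' \<omega>'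
  proof (rule block_funD[OF assms])
    have "triple X Y S (t + int k) \<omega> = triple X Y S (t' + int k) \<omega>'" if "k \<le> m" for k
      using arg_cong[OF w, of "\<lambda>x. x ! k"] that by (simp del: upt_Suc)
    then have *: "X (t + int k) \<omega> = X (t' + int k) \<omega>' \<and> Y (t + int k) \<omega> = Y (t' + int k) \<omega>'
        \<and> S (t + int k) \<omega> = S (t' + int k) \<omega>'" if "k \<le> m" for k
      using that by (auto simp: triple_def)
    show "X (t + int k) \<omega> = X (t' + int k) \<omega>'" "Y (t + int k) \<omega>
        = Y (t' + int k) \<omega>'" if "k \<in> {1..m}" for k
      using *[of k] that by auto
    show "S (t + int k) \<omega> = S (t' + int k) \<omega>'" if "k \<in> {0..m}" for k
      using *[of k] that by auto
  qed
  \<comment> \<open>Any position and outcome showing the word \<open>c\<close> may be chosen, by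
    \<open>eq\<close>; words that never occur get an arbitrary value.\<close>
  define g where "g c = (case (SOME x. window (m + 1) (fst x) (snd x) = c) of (t, \<omega>) \<Rightarrow> V t \<omega>)" for c
  have "V t \<omega> = g (window (m + 1) t \<omega>)" for t \<omega>
  proof -
    let ?x = "SOME x. window (m + 1) (fst x) (snd x) = window (m + 1) t \<omega>"
    have "window (m + 1) (fst ?x) (snd ?x) = window (m + 1) t \<omega>"
      by (rule someI[of _ "(t, \<omega>)"]) simp
    then show ?thesis unfolding g_def split_def by (rule eq[symmetric])
  qed
  then show ?thesis using that by blast
qed

lemma block_fun_simple [simp]:
  assumes "block_fun m V"
  shows "simple_function M (V t)"
proof -
  obtain g where g: "\<And>t \<omega>. V t \<omega> = g (window (m + 1) t \<omega>)" using block_fun_window[OF assms] by blast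
  show ?thesis
    using simple_function_compose1[OF window_simple, of g t "m + 1"] unfolding g[symmetric] .
qed

lemma block_fun_shift:
  assumes "block_fun m V"
  shows "ev_prob M (\<lambda>\<omega>. P (V t \<omega>)) = ev_prob M (\<lambda>\<omega>. P (V 0 \<omega>))"
proof -
  obtain g where g: "\<And>t \<omega>. V t \<omega> = g (window (m + 1) t \<omega>)" using block_fun_window[OF assms] by blast
  show ?thesis using stationary_window[of "\<lambda>x. P (g x)" t "m + 1"] unfolding g[symmetric] .
qed

text \<open>Given \<open>S b\<close>, the left block is a function of the past word and the right
  block one of the future word.\<close>

lemma block_fun_markov:
  assumes V: "block_fun m V" and W: "block_fun m' W" and b: "b = t + int m"
  shows "ev_prob M (\<lambda>\<omega>. A (V t \<omega>) \<and> B (W b \<omega>) \<and> S b \<omega> = s) * ev_prob M (\<lambda>\<omega>. S b \<omega> = s)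
   = ev_prob M (\<lambda>\<omega>. A (V t \<omega>) \<and> S b \<omega> = s) * ev_prob M (\<lambda>\<omega>. B (W b \<omega>) \<and> S b \<omega> = s)"
proof -
  have eqV: "V t \<omega> = V t \<omega>'" if p: "past m b \<omega> = past m b \<omega>'" and s: "S b \<omega> = S b \<omega>'" for \<omega> \<omega>'
  proof (rule block_funD[OF V])
    have n: "X (b - int k) \<omega> = X (b - int k) \<omega>' \<and> Y (b - int k) \<omega> = Y (b - int k) \<omega>'
        \<and> S (b - 1 - int k) \<omega> = S (b - 1 - int k) \<omega>'" if "k < m" for k
      using arg_cong[OF p, of "\<lambda>x. x ! k"] that by simp
    show "X (t + int k) \<omega> = X (t + int k) \<omega>'" "Y (t + int k) \<omega> = Y (t + int k) \<omega>'" if "k \<in> {1..m}" for k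
      using n[of "m - k"] that b by (auto simp: of_nat_diff)
    show "S (t + int k) \<omega> = S (t + int k) \<omega>'" if "k \<in> {0..m}" for k
    \<comment> \<open>The state at the end of the block is absent from the past word and comes from
      \<open>s\<close>.\<close>
    proof (cases "k = m")
      case False
      have "b - 1 - int (m - 1 - k) = t + int k" using b that False by (auto simp: of_nat_diff)
      then show ?thesis using n[of "m - 1 - k"] that False by auto
    qed (use s b in auto)
  qed
  have eqW: "W b \<omega> = W b \<omega>'" if p: "window m' (b + 1) \<omega> = window m' (b + 1) \<omega>'" and s: "S b \<omega>
      = S b \<omega>'" for \<omega> \<omega>'
  proof (rule block_funD[OF W])
    have n: "triple X Y S (b + 1 + int k) \<omega> = triple X Y S (b + 1 + int k) \<omega>'" if "k < m'" for k
      using arg_cong[OF p, of "\<lambda>x. x ! k"] that by simp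
    have *: "triple X Y S (b + int k) \<omega> = triple X Y S (b + int k) \<omega>'" if "k \<in> {1..m'}" for k
    proof -
      have "b + 1 + int (k - 1) = b + int k" using that by (auto simp: of_nat_diff)
      then show ?thesis using n[of "k - 1"] that by auto
    qed
    then show "X (b + int k) \<omega> = X (b + int k) \<omega>'" "Y (b + int k) \<omega>
        = Y (b + int k) \<omega>'" if "k \<in> {1..m'}" for k
      using that by (auto simp: triple_def)
    show "S (b + int k) \<omega> = S (b + int k) \<omega>'" if "k \<in> {0..m'}" for k
      using *[of k] that s by (cases "k = 0") (auto simp: triple_def)
  qed
  \<comment> \<open>The words omit \<open>S b\<close>, so events are transported to words with
    \<open>S b = s\<close> fixed inside the existential.\<close>
  define A' where "A' c \<longleftrightarrow> (\<exists>\<omega>. past m b \<omega> = c \<and> S b \<omega> = s \<and> A (V t \<omega>))" for c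
  define B' where "B' c \<longleftrightarrow> (\<exists>\<omega>. window m' (b + 1) \<omega> = c \<and> S b \<omega> = s \<and> B (W b \<omega>))" for c
  have A': "A' (past m b \<omega>) \<and> S b \<omega> = s \<longleftrightarrow> A (V t \<omega>) \<and> S b \<omega> = s" for \<omega>
  proof
    assume *: "A' (past m b \<omega>) \<and> S b \<omega> = s"
    then obtain \<omega>' where "past m b \<omega>' = past m b \<omega>" "S b \<omega>' = s" "A (V t \<omega>')"
      unfolding A'_def by blast
    then show "A (V t \<omega>) \<and> S b \<omega> = s" using eqV[of \<omega>' \<omega>] * by metis
  qed (auto simp: A'_def)
  have B': "B' (window m' (b + 1) \<omega>) \<and> S b \<omega> = s \<longleftrightarrow> B (W b \<omega>) \<and> S b \<omega> = s" for \<omega>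
  proof
    assume *: "B' (window m' (b + 1) \<omega>) \<and> S b \<omega> = s"
    then obtain \<omega>' where "window m' (b + 1) \<omega>' = window m' (b + 1) \<omega>" "S b \<omega>' = s" "B (W b \<omega>')"
      unfolding B'_def by blast
    then show "B (W b \<omega>) \<and> S b \<omega> = s" using eqW[of \<omega>' \<omega>] * by metis
  qed (auto simp: B'_def)
  have AB': "A' (past m b \<omega>) \<and> B' (window m' (b + 1) \<omega>) \<and> S b \<omega> = s
      \<longleftrightarrow> A (V t \<omega>) \<and> B (W b \<omega>) \<and> S b \<omega> = s" for \<omega>
    using A'[of \<omega>] B'[of \<omega>] by blast
  show ?thesis using markov_windows[of A' b m B' m' s] unfolding AB' unfolding A' B' .
qed

lemma ent_shift:
  assumes V: "block_fun m V"
  shows "ent M (V t) = ent M (V 0)"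
proof -
  let ?D = "V t ` space M \<union> V 0 ` space M"
  have fin: "finite ?D" using block_fun_simple[OF V] by (auto simp: simple_function_def)
  have "ent M (V a) = (\<Sum>v\<in>?D. eta (ev_prob M (\<lambda>\<omega>. V a \<omega> = v)))" if "a \<in> {t, 0}" for a
    unfolding ent_def
  proof (rule sum.mono_neutral_left[OF fin])
    show "\<forall>v\<in>?D - V a ` space M. eta (ev_prob M (\<lambda>\<omega>. V a \<omega> = v)) = 0"
      using ev_prob_image[of _ "V a" "\<lambda>_. True"] by simp
  qed (use that in auto)
  then show ?thesis using block_fun_shift[OF V, of "\<lambda>x. x = _" t] by simp
qed

lemma block_fun_Pair:
  assumes "block_fun m V" "block_fun m W"
  shows "block_fun m (\<lambda>t \<omega>. (V t \<omega>, W t \<omega>))"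
  using assms unfolding block_fun_def by blast

lemma obs_sum_shift:
  assumes U: "block_fun m U" and Q: "block_fun m Q" and f: "f 0 0 = 0"
  shows "obs_sum M f (U t) (Q t) = obs_sum M f (U 0) (Q 0)"
proof -
  let ?D = "Q t ` space M \<union> Q 0 ` space M"
  have fin: "finite ?D" using block_fun_simple[OF Q] by (auto simp: simple_function_def)
  then have finQ: "finite (Q t ` space M)" "finite (Q 0 ` space M)" by auto
  note sh = block_fun_shift[OF block_fun_Pair[OF U Q], of _ t]
  show ?thesis
    using sh[of "\<lambda>x. \<not> fst x \<and> snd x = _"] sh[of "\<lambda>x. fst x \<and> snd x = _"]
    by (subst (1 2) obs_sum_superset[where D = "?D" and f = f]) (auto simp: finQ f)
qed

lemma block_fun_S: "n \<le> m \<Longrightarrow> block_fun m (\<lambda>t. S (t + int n))"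
  by (auto simp: block_fun_def)

lemma block_fun_S0: "block_fun m S"
  using block_fun_S[of 0 m] by simp

section \<open>Stationary law and mixing of the state chain\<close>

definition \<pi> :: "'s \<Rightarrow> real" where "\<pi> s = ev_prob M (\<lambda>\<omega>. S 0 \<omega> = s)"

lemma ev_prob_S: "ev_prob M (\<lambda>\<omega>. S t \<omega> = s) = \<pi> s"
  unfolding \<pi>_def using block_fun_shift[OF block_fun_S0, of "\<lambda>x. x = s" t] by simp

lemma \<pi>_pos: "\<pi> s > 0"
proof -
  obtain n where "ev_prob M (\<lambda>\<omega>. S 0 \<omega> = s \<and> S (int n) \<omega> = s) > 0"
    using faim unfolding faim_process_def state_chain_irreducible_def by blast
  moreover have "ev_prob M (\<lambda>\<omega>. S 0 \<omega> = s \<and> S (int n) \<omega> = s) \<le> \<pi> s"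
    unfolding \<pi>_def by (rule ev_prob_mono[of "S 0" _ "\<lambda>x. x = s"]) auto
  ultimately show ?thesis by linarith
qed

lemma \<pi>_sum: "(\<Sum>s\<in>UNIV. \<pi> s) = 1"
  unfolding \<pi>_def by (rule ev_prob_total) auto

lemma \<pi>_le_1: "\<pi> s \<le> 1"
  unfolding \<pi>_def ev_prob_def by simp

lemma ev_prob_markov:
  assumes "block_fun m V" "block_fun m' W" "b = t + int m"
  shows "ev_prob M (\<lambda>\<omega>. A (V t \<omega>) \<and> B (W b \<omega>) \<and> S b \<omega> = s)
   = ev_prob M (\<lambda>\<omega>. A (V t \<omega>) \<and> S b \<omega> = s) * ev_prob M (\<lambda>\<omega>. B (W b \<omega>) \<and> S b \<omega> = s) / \<pi> s"
  using block_fun_markov[OF assms, of A B s] \<pi>_pos[of s] unfolding ev_prob_S by (simp add: field_simps)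

text \<open>\<open>\<pi> s\<close> times the \<open>k\<close>-step transition probability, whence
  the division by \<open>\<pi> r\<close> in the Chapman-Kolmogorov equation.\<close>

definition trans_joint :: "nat \<Rightarrow> 's \<Rightarrow> 's \<Rightarrow> real" where
  "trans_joint k s s' = ev_prob M (\<lambda>\<omega>. S 0 \<omega> = s \<and> S (int k) \<omega> = s')"

lemma trans_joint_shift: "ev_prob M (\<lambda>\<omega>. S t \<omega> = s \<and> S (t + int k) \<omega> = s') = trans_joint k s s'"
  using block_fun_shift[OF block_fun_Pair[OF block_fun_S0 block_fun_S[of k k]], of "\<lambda>x. x = (s, s')" t]
  by (simp add: trans_joint_def)

lemma trans_joint_nonneg: "0 \<le> trans_joint k s s'"
  by (simp add: trans_joint_def)

lemma Chapman_Kolmogorov: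
  "trans_joint (k + l) s s' = (\<Sum>r\<in>UNIV. trans_joint k s r * trans_joint l r s' / \<pi> r)"
proof -
  have "trans_joint (k + l) s s'
      = (\<Sum>r\<in>UNIV. ev_prob M (\<lambda>\<omega>. S 0 \<omega> = s \<and> S (int k + int l) \<omega> = s' \<and> S (int k) \<omega> = r))"
    unfolding trans_joint_def
    using ev_prob_sum[of "\<lambda>\<omega>. (S 0 \<omega>, S (int (k + l)) \<omega>)" "S (int k)" UNIV "\<lambda>x. x = (s, s')"]
    by (simp add: conj_assoc)
  also have "\<dots> = (\<Sum>r\<in>UNIV. trans_joint k s r * trans_joint l r s' / \<pi> r)"
  proof (intro sum.cong refl)
    fix r
    have "ev_prob M (\<lambda>\<omega>. S 0 \<omega> = s \<and> S (int k + int l) \<omega> = s' \<and> S (int k) \<omega> = r)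
      = ev_prob M (\<lambda>\<omega>. S 0 \<omega> = s \<and> S (int k) \<omega> = r) * ev_prob M (\<lambda>\<omega>. S (int k + int l) \<omega>
          = s' \<and> S (int k) \<omega> = r) / \<pi> r"
      using ev_prob_markov[OF block_fun_S0 block_fun_S[of l l], of "int k" 0 k "\<lambda>x. x = s" "\<lambda>x. x
          = s'" r] by simp
    then show "ev_prob M (\<lambda>\<omega>. S 0 \<omega> = s \<and> S (int k + int l) \<omega> = s' \<and> S (int k) \<omega> = r)
      = trans_joint k s r * trans_joint l r s' / \<pi> r"
      using trans_joint_shift[of 0 s k r] trans_joint_shift[of "int k" r l s']
          by (simp add: conj_commute)
  qed
  finally show ?thesis .
qed

lemma trans_joint_add_pos:
  assumes "trans_joint k s r > 0" "trans_joint l r s' > 0"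
  shows "trans_joint (k + l) s s' > 0"
proof -
  have "0 < trans_joint k s r * trans_joint l r s' / \<pi> r"
    using assms \<pi>_pos[of r] by simp
  also have "\<dots> \<le> trans_joint (k + l) s s'"
    unfolding Chapman_Kolmogorov
    by (rule member_le_sum[of r UNIV "\<lambda>r. trans_joint k s r * trans_joint l r s' / \<pi> r"])
      (auto simp: trans_joint_nonneg \<pi>_pos less_imp_le)
  finally show ?thesis .
qed

text \<open>Return times to \<open>s\<close> form an additive set with greatest common divisor
  \<open>1\<close>, so all large times occur; a path from \<open>s\<close> to \<open>s'\<close> is
  appended, and finiteness makes the threshold uniform.\<close>

lemma trans_joint_eventually_pos: "\<exists>N. \<forall>n\<ge>N. \<forall>s s'. trans_joint n s s' > 0"
proof -
  have "\<exists>N. \<forall>n\<ge>N. trans_joint n s s' > 0" for s s'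
  proof -
    let ?A = "{n. n > 0 \<and> trans_joint n s s > 0}"
    have "Gcd ?A = 1" using faim
      by (simp add: faim_process_def state_chain_aperiodic_def trans_joint_def)
    then obtain N where N: "\<forall>n\<ge>N. n \<in> ?A"
      using additive_closed_Gcd_1[of ?A] trans_joint_add_pos[of _ s s _ s] by auto
    obtain l where l: "trans_joint l s s' > 0"
      using faim unfolding faim_process_def state_chain_irreducible_def trans_joint_def by blast
    have "trans_joint n s s' > 0" if "n \<ge> N + l" for n
      using trans_joint_add_pos[of "n - l" s s l s'] N l that by auto
    then show ?thesis by blast
  qed
  then obtain N where N: "\<And>s s' n. n \<ge> N s s' \<Longrightarrow> trans_joint n s s' > 0" by metis
  have "trans_joint n s s' > 0" if "n \<ge> Max (range (case_prod N))" for n s s'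
  proof (rule N)
    have "N s s' \<le> Max (range (case_prod N))" by (rule Max_ge) (auto intro: rev_image_eqI[of "(s, s')"])
    then show "N s s' \<le> n" using that by linarith
  qed
  then show ?thesis by blast
qed

text \<open>Doeblin minorisation: \<open>c\<close> is the least joint probability over
  \<open>N\<close> steps, and for longer times it survives averaging over the state \<open>N\<close>
  steps before the end.\<close>

lemma trans_joint_mixing: "\<exists>c>0. c \<le> 1 \<and> (\<exists>N. \<forall>n\<ge>N. \<forall>s s'. trans_joint n s s' \<ge> c * \<pi> s * \<pi> s')"
proof -
  obtain N where N: "\<And>s s'. trans_joint N s s' > 0" using trans_joint_eventually_pos by blast
  define c where "c = Min (range (case_prod (trans_joint N)))"
  have c: "c > 0" unfolding c_def using N by (subst Min_gr_iff) auto
  have cle: "c \<le> trans_joint N s s'" for s s'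
    unfolding c_def by (rule Min_le) (auto intro: rev_image_eqI[of "(s, s')"])
  have "c \<le> 1" using cle[of undefined undefined] unfolding trans_joint_def ev_prob_def
    by (meson order_trans prob_le_1)
  have "trans_joint n s s' \<ge> c * \<pi> s * \<pi> s'" if "n \<ge> N" for n s s'
  proof -
    have "c * \<pi> s * \<pi> s' \<le> c * \<pi> s" using c \<pi>_pos[of s] \<pi>_le_1[of s'] by simp
    also have "c * \<pi> s = c * (\<Sum>r\<in>UNIV. trans_joint (n - N) s r)"
      unfolding \<pi>_def trans_joint_def
      by (rule arg_cong[where f = "\<lambda>z. c * z"], rule ev_prob_sum[of "S 0" _ _ "\<lambda>x. x = s"]) auto
    also have "\<dots> \<le> (\<Sum>r\<in>UNIV. trans_joint (n - N) s r * trans_joint N r s' / \<pi> r)"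
      unfolding sum_distrib_left
    proof (rule sum_mono)
      fix r
      have "c * trans_joint (n - N) s r \<le> trans_joint (n - N) s r * trans_joint N r s'"
        using mult_right_mono[OF cle[of r s'] trans_joint_nonneg[of "n - N" s r]]
            by (simp add: mult.commute)
      also have "\<dots> \<le> trans_joint (n - N) s r * trans_joint N r s' / \<pi> r"
        using \<pi>_pos[of r] \<pi>_le_1[of r] trans_joint_nonneg
        by (simp add: pos_le_divide_eq mult_left_le)
      finally show "c * trans_joint (n - N) s r \<le> trans_joint (n - N) s r * trans_joint N r s' / \<pi> r" .
    qed
    also have "\<dots> = trans_joint n s s'"
      using Chapman_Kolmogorov[of "n - N" N s s'] that by simp
    finally show ?thesis .
  qed
  then show ?thesis using c \<open>c \<le> 1\<close> by blast
qed

end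

section \<open>Adjacent blocks\<close>

lemma sum_cartesian_swap:
  "(\<Sum>((x, y), s)\<in>(A \<times> B) \<times> C. g x y s) = (\<Sum>s\<in>C. \<Sum>x\<in>A. \<Sum>y\<in>B. g x y s)"
proof -
  have "(\<Sum>((x, y), s)\<in>(A \<times> B) \<times> C. g x y s) = (\<Sum>z\<in>A \<times> B. \<Sum>s\<in>C. g (fst z) (snd z) s)"
    by (simp add: sum.cartesian_product' split_def)
  also have "\<dots> = (\<Sum>s\<in>C. \<Sum>x\<in>A. \<Sum>y\<in>B. g x y s)"
    by (subst sum.swap) (simp add: sum.cartesian_product')
  finally show ?thesis .
qed

context prob_space
begin

lemma obs_sum_Pair:
  fixes B :: "'a \<Rightarrow> 'c::finite"
  assumes A: "simple_function M A" and f: "f 0 0 = 0"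
  shows "obs_sum M f U (\<lambda>\<omega>. (A \<omega>, B \<omega>)) = (\<Sum>s\<in>UNIV. \<Sum>x\<in>A ` space M.
    f (ev_prob M (\<lambda>\<omega>. \<not> U \<omega> \<and> A \<omega> = x \<and> B \<omega> = s)) (ev_prob M (\<lambda>\<omega>. U \<omega> \<and> A \<omega> = x \<and> B \<omega> = s)))"
proof -
  have fin: "finite (A ` space M)" using A by (auto simp: simple_function_def)
  have "obs_sum M f U (\<lambda>\<omega>. (A \<omega>, B \<omega>)) = (\<Sum>(x, s)\<in>A ` space M \<times> UNIV.
    f (ev_prob M (\<lambda>\<omega>. \<not> U \<omega> \<and> A \<omega> = x \<and> B \<omega> = s)) (ev_prob M (\<lambda>\<omega>. U \<omega> \<and> A \<omega> = x \<and> B \<omega> = s)))"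
    using fin f by (subst obs_sum_superset[where D = "A ` space M \<times> UNIV" and f
        = f]) (auto simp: split_def prod_eq_iff)
  also have "\<dots> = (\<Sum>s\<in>UNIV. \<Sum>x\<in>A ` space M.
    f (ev_prob M (\<lambda>\<omega>. \<not> U \<omega> \<and> A \<omega> = x \<and> B \<omega> = s)) (ev_prob M (\<lambda>\<omega>. U \<omega> \<and> A \<omega> = x \<and> B \<omega> = s)))"
    unfolding sum.cartesian_product[symmetric] by (rule sum.swap)
  finally show ?thesis .
qed

lemma ev_prob_bool_split:
  assumes "simple_function M V" "simple_function M U"
  shows "ev_prob M (\<lambda>\<omega>. P (V \<omega>)) = ev_prob M (\<lambda>\<omega>. \<not> U \<omega> \<and> P (V \<omega>)) + ev_prob M (\<lambda>\<omega>. U \<omega> \<and> P (V \<omega>))"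
  using ev_prob_sum[OF assms finite_class.finite_UNIV subset_UNIV, of P]
      by (simp add: UNIV_bool conj_commute)

lemma Kpar_refine:
  assumes "simple_function M U" "simple_function M Q" "simple_function M R"
  shows "Kpar M U Q \<le> Kpar M U (\<lambda>\<omega>. (Q \<omega>, R \<omega>))"
proof -
  have "obs_sum M (\<lambda>a b. - \<bar>a - b\<bar>) U (\<lambda>\<omega>. (Q \<omega>, R \<omega>)) \<le> obs_sum M (\<lambda>a b. - \<bar>a - b\<bar>) U Q"
    by (rule obs_sum_refine[OF _ _ assms]) auto
  then show ?thesis by (simp add: obs_sum_def sum_negf)
qed

lemma Hpar_refine:
  assumes "simple_function M U" "simple_function M Q" "simple_function M R"
  shows "Hpar M U (\<lambda>\<omega>. (Q \<omega>, R \<omega>)) \<le> Hpar M U Q"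
  by (rule obs_sum_refine[OF _ _ assms]) (auto intro: hent_superadditive)

end

context faim
begin

section \<open>Two adjacent blocks sharing one state\<close>

text \<open>The largest \<open>1 / \<pi> s\<close>, which is the price of dropping the state shared
  by two blocks.\<close>

definition \<kappa> :: real where "\<kappa> = 1 / Min (range \<pi>)"

lemma Min_\<pi>: "0 < Min (range \<pi>)" "Min (range \<pi>) \<le> \<pi> s"
  using \<pi>_pos by (auto simp: Min_gr_iff intro: Min_le)

lemma inverse_\<pi>_le: "1 / \<pi> s \<le> \<kappa>"
  unfolding \<kappa>_def using Min_\<pi>(1) Min_\<pi>(2)[of s] by (simp add: frac_le)

lemma \<kappa>_ge_1: "1 \<le> \<kappa>"
proof -
  have "1 \<le> 1 / \<pi> undefined" using \<pi>_le_1 \<pi>_pos by simp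
  then show ?thesis using inverse_\<pi>_le order_trans by blast
qed

lemma ent_markov:
  assumes "block_fun m V" "block_fun m' W" "b = t + int m"
  shows "ent M (\<lambda>\<omega>. (V t \<omega>, S b \<omega>, W b \<omega>)) + ent M (S b)
    = ent M (\<lambda>\<omega>. (V t \<omega>, S b \<omega>)) + ent M (\<lambda>\<omega>. (S b \<omega>, W b \<omega>))"
proof (rule ent_cond_indep)
  fix v s w
  have 1: "ev_prob M (\<lambda>\<omega>. V t \<omega> = v \<and> S b \<omega> = s \<and> W b \<omega> = w)
      = ev_prob M (\<lambda>\<omega>. V t \<omega> = v \<and> W b \<omega> = w \<and> S b \<omega> = s)"
    and 2: "ev_prob M (\<lambda>\<omega>. S b \<omega> = s \<and> W b \<omega> = w) = ev_prob M (\<lambda>\<omega>. W b \<omega> = w \<and> S b \<omega> = s)"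
    by (auto intro!: ev_prob_cong)
  show "ev_prob M (\<lambda>\<omega>. V t \<omega> = v \<and> S b \<omega> = s \<and> W b \<omega> = w) * ev_prob M (\<lambda>\<omega>. S b \<omega> = s)
      = ev_prob M (\<lambda>\<omega>. V t \<omega> = v \<and> S b \<omega> = s) * ev_prob M (\<lambda>\<omega>. S b \<omega> = s \<and> W b \<omega> = w)"
    unfolding 1 2 by (rule block_fun_markov[OF assms])
qed (use assms in auto)

text \<open>Given the shared state, the law is a product divided by \<open>\<pi> s\<close>; one
  factor then forgets the state, and the sum over \<open>s\<close> removes it from the
  other.\<close>

lemma ev_prob_domination:
  assumes V: "block_fun m V" and W: "block_fun m' W" and b: "b = t + int m"
  shows "ev_prob M (\<lambda>\<omega>. A (V t \<omega>) \<and> B (W b \<omega>))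
    \<le> \<kappa> * (ev_prob M (\<lambda>\<omega>. A (V t \<omega>)) * ev_prob M (\<lambda>\<omega>. B (W b \<omega>)))"
proof -
  have sf: "simple_function M (\<lambda>\<omega>. (V t \<omega>, W b \<omega>))" using V W by auto
  have "ev_prob M (\<lambda>\<omega>. A (V t \<omega>) \<and> B (W b \<omega>))
      = (\<Sum>s\<in>UNIV. ev_prob M (\<lambda>\<omega>. A (V t \<omega>) \<and> B (W b \<omega>) \<and> S b \<omega> = s))"
    using ev_prob_sum[OF sf XYS_simple(3)[of b] finite_class.finite_UNIV subset_UNIV, of "\<lambda>x. A (fst
        x) \<and> B (snd x)"]
    by (simp add: conj_assoc)
  also have "\<dots> \<le> (\<Sum>s\<in>UNIV. \<kappa> * (ev_prob M (\<lambda>\<omega>. A (V t \<omega>) \<and> S b \<omega> = s) * ev_prob M (\<lambda>\<omega>. B (W b \<omega>))))"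
  proof (rule sum_mono)
    fix s
    let ?a = "ev_prob M (\<lambda>\<omega>. A (V t \<omega>) \<and> S b \<omega> = s)" and ?b = "ev_prob M (\<lambda>\<omega>. B (W b \<omega>) \<and> S b \<omega> = s)"
    have "ev_prob M (\<lambda>\<omega>. A (V t \<omega>) \<and> B (W b \<omega>) \<and> S b \<omega> = s) = 1 / \<pi> s * (?a * ?b)"
      unfolding ev_prob_markov[OF assms] by simp
    also have "\<dots> \<le> \<kappa> * (?a * ?b)"
      by (intro mult_right_mono inverse_\<pi>_le) simp
    also have "\<dots> \<le> \<kappa> * (?a * ev_prob M (\<lambda>\<omega>. B (W b \<omega>)))"
      using \<kappa>_ge_1 by (intro mult_left_mono ev_prob_mono[OF block_fun_simple[OF W]]) auto
    finally show "ev_prob M (\<lambda>\<omega>. A (V t \<omega>) \<and> B (W b \<omega>) \<and> S b \<omega> = s)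
      \<le> \<kappa> * (?a * ev_prob M (\<lambda>\<omega>. B (W b \<omega>)))" .
  qed
  also have "\<dots> = \<kappa> * (ev_prob M (\<lambda>\<omega>. A (V t \<omega>)) * ev_prob M (\<lambda>\<omega>. B (W b \<omega>)))"
    using ev_prob_sum[OF block_fun_simple[OF V, of t] XYS_simple(3)[of b] finite_class.finite_UNIV
        subset_UNIV, of A]
    by (simp add: sum_distrib_left sum_distrib_right)
  finally show ?thesis .
qed

definition left_law ::
  "int \<Rightarrow> int \<Rightarrow> (int \<Rightarrow> 'w \<Rightarrow> bool) \<Rightarrow> (int \<Rightarrow> 'w \<Rightarrow> 'l) \<Rightarrow> bool \<Rightarrow> 'l \<Rightarrow> 's \<Rightarrow> real" where
  "left_law t b U L u x s = ev_prob M (\<lambda>\<omega>. (U t \<omega> \<longleftrightarrow> u) \<and> L t \<omega> = x \<and> S b \<omega> = s)"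

definition right_law ::
  "int \<Rightarrow> (int \<Rightarrow> 'w \<Rightarrow> bool) \<Rightarrow> (int \<Rightarrow> 'w \<Rightarrow> 'r) \<Rightarrow> bool \<Rightarrow> 'r \<Rightarrow> 's \<Rightarrow> real" where
  "right_law b U R v y s = ev_prob M (\<lambda>\<omega>. (U b \<omega> \<longleftrightarrow> v) \<and> R b \<omega> = y \<and> S b \<omega> = s)"

lemma laws_nonneg [simp]: "0 \<le> left_law t b U L u x s" "0 \<le> right_law b U' R v y s"
  by (auto simp: left_law_def right_law_def)

context
  fixes m m' :: nat and t b :: int
    and U :: "int \<Rightarrow> 'w \<Rightarrow> bool" and L :: "int \<Rightarrow> 'w \<Rightarrow> 'l"
    and U' :: "int \<Rightarrow> 'w \<Rightarrow> bool" and R :: "int \<Rightarrow> 'w \<Rightarrow> 'r"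
  assumes U: "block_fun m U" and L: "block_fun m L"
    and U': "block_fun m' U'" and R: "block_fun m' R" and b: "b = t + int m"
begin

lemma two_block_simple [simp]:
  "simple_function M (U t)" "simple_function M (L t)" "simple_function M (U' b)" "simple_function M
      (R b)"
  using U L U' R by auto

lemma two_block_finite: "finite (L t ` space M)" "finite (R b ` space M)"
  using two_block_simple unfolding simple_function_def by blast+

lemma two_block_domination:
  "ev_prob M (\<lambda>\<omega>. (U t \<omega> \<longleftrightarrow> u) \<and> (U' b \<omega> \<longleftrightarrow> v) \<and> L t \<omega> = x \<and> R b \<omega> = y)
    \<le> \<kappa> * (ev_prob M (\<lambda>\<omega>. (U t \<omega> \<longleftrightarrow> u) \<and> L t \<omega> = x) * ev_prob M (\<lambda>\<omega>. (U' b \<omega> \<longleftrightarrow> v) \<and> R b \<omega> = y))"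
  using ev_prob_domination[OF block_fun_Pair[OF U L] block_fun_Pair[OF U' R] b,
      of "\<lambda>z. (fst z \<longleftrightarrow> u) \<and> snd z = x" "\<lambda>z. (fst z \<longleftrightarrow> v) \<and> snd z = y"]
  by (simp add: conj_ac)

lemma two_block_xor:
  assumes "simple_function M V"
  shows "ev_prob M (\<lambda>\<omega>. \<not> (U t \<omega> \<noteq> U' b \<omega>) \<and> P (V \<omega>))
    = ev_prob M (\<lambda>\<omega>. \<not> U t \<omega> \<and> \<not> U' b \<omega> \<and> P (V \<omega>)) + ev_prob M (\<lambda>\<omega>. U t \<omega> \<and> U' b \<omega> \<and> P (V \<omega>))"
    and "ev_prob M (\<lambda>\<omega>. (U t \<omega> \<noteq> U' b \<omega>) \<and> P (V \<omega>))
    = ev_prob M (\<lambda>\<omega>. \<not> U t \<omega> \<and> U' b \<omega> \<and> P (V \<omega>)) + ev_prob M (\<lambda>\<omega>. U t \<omega> \<and> \<not> U' b \<omega> \<and> P (V \<omega>))"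
proof -
  have sf: "simple_function M (\<lambda>\<omega>. (U t \<omega>, U' b \<omega>, V \<omega>))" using assms by auto
  have e: "ev_prob M (\<lambda>\<omega>. \<not> U t \<omega> \<and> \<not> (U t \<omega> \<noteq> U' b \<omega>) \<and> P (V \<omega>))
      = ev_prob M (\<lambda>\<omega>. \<not> U t \<omega> \<and> \<not> U' b \<omega> \<and> P (V \<omega>))"
    "ev_prob M (\<lambda>\<omega>. U t \<omega> \<and> \<not> (U t \<omega> \<noteq> U' b \<omega>) \<and> P (V \<omega>)) = ev_prob M (\<lambda>\<omega>. U t \<omega> \<and> U' b \<omega> \<and> P (V \<omega>))"
    "ev_prob M (\<lambda>\<omega>. \<not> U t \<omega> \<and> (U t \<omega> \<noteq> U' b \<omega>) \<and> P (V \<omega>)) = ev_prob M (\<lambda>\<omega>. \<not> U t \<omega> \<and> U' b \<omega> \<and> P (V \<omega>))"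
    "ev_prob M (\<lambda>\<omega>. U t \<omega> \<and> (U t \<omega> \<noteq> U' b \<omega>) \<and> P (V \<omega>)) = ev_prob M (\<lambda>\<omega>. U t \<omega> \<and> \<not> U' b \<omega> \<and> P (V \<omega>))"
    by (auto intro!: ev_prob_cong)
  show "ev_prob M (\<lambda>\<omega>. \<not> (U t \<omega> \<noteq> U' b \<omega>) \<and> P (V \<omega>))
    = ev_prob M (\<lambda>\<omega>. \<not> U t \<omega> \<and> \<not> U' b \<omega> \<and> P (V \<omega>)) + ev_prob M (\<lambda>\<omega>. U t \<omega> \<and> U' b \<omega> \<and> P (V \<omega>))"
    using ev_prob_bool_split[OF sf two_block_simple(1), of "\<lambda>(x, y, z). \<not> (x \<noteq> y) \<and> P z"]
    unfolding split_conv e .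
  show "ev_prob M (\<lambda>\<omega>. (U t \<omega> \<noteq> U' b \<omega>) \<and> P (V \<omega>))
    = ev_prob M (\<lambda>\<omega>. \<not> U t \<omega> \<and> U' b \<omega> \<and> P (V \<omega>)) + ev_prob M (\<lambda>\<omega>. U t \<omega> \<and> \<not> U' b \<omega> \<and> P (V \<omega>))"
    using ev_prob_bool_split[OF sf two_block_simple(1), of "\<lambda>(x, y, z). (x \<noteq> y) \<and> P z"]
    unfolding split_conv e .
qed

text \<open>\<open>Z\<close> increases with the joint weights, so domination reduces it to
  independent blocks; the two factors \<open>\<kappa>\<close> under the root leave one
  outside.\<close>

lemma Zpar_minus_le:
  "Zpar M (\<lambda>\<omega>. U t \<omega> \<noteq> U' b \<omega>) (\<lambda>\<omega>. (L t \<omega>, R b \<omega>)) \<le> \<kappa> * (Zpar M (U t) (L t) + Zpar M (U' b) (R b))"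
proof -
  let ?DL = "L t ` space M" and ?DR = "R b ` space M"
  let ?p = "\<lambda>u v x y. ev_prob M (\<lambda>\<omega>. (U t \<omega> \<longleftrightarrow> u) \<and> (U' b \<omega> \<longleftrightarrow> v) \<and> L t \<omega> = x \<and> R b \<omega> = y)"
  let ?\<alpha> = "\<lambda>u x. ev_prob M (\<lambda>\<omega>. (U t \<omega> \<longleftrightarrow> u) \<and> L t \<omega> = x)"
  let ?\<beta> = "\<lambda>v y. ev_prob M (\<lambda>\<omega>. (U' b \<omega> \<longleftrightarrow> v) \<and> R b \<omega> = y)"
  let ?p0 = "\<lambda>x y. ?p False False x y + ?p True True x y" and ?p1
      = "\<lambda>x y. ?p False True x y + ?p True False x y"
  let ?c0 = "\<lambda>x y. ?\<alpha> False x * ?\<beta> False y + ?\<alpha> True x * ?\<beta> True y"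
    and ?c1 = "\<lambda>x y. ?\<alpha> False x * ?\<beta> True y + ?\<alpha> True x * ?\<beta> False y"
  have LR: "simple_function M (\<lambda>\<omega>. (L t \<omega>, R b \<omega>))" by auto
  have "Zpar M (\<lambda>\<omega>. U t \<omega> \<noteq> U' b \<omega>) (\<lambda>\<omega>. (L t \<omega>, R b \<omega>))
      = (\<Sum>(x, y)\<in>?DL \<times> ?DR. 2 * sqrt (?p0 x y * ?p1 x y))"
    using two_block_finite two_block_xor[OF LR, of "\<lambda>z. z = _"]
    by (subst obs_sum_superset[where D = "?DL \<times> ?DR"]) (auto simp: split_def prod_eq_iff)
  also have "\<dots> \<le> (\<Sum>(x, y)\<in>?DL \<times> ?DR. \<kappa> * (2 * sqrt (?\<alpha> False x * ?\<alpha> True x) * (?\<beta> False y + ?\<beta> True y)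
      + (?\<alpha> False x + ?\<alpha> True x) * (2 * sqrt (?\<beta> False y * ?\<beta> True y))))"
  proof (intro sum_mono, clarify)
    fix x y
    have "?p0 x y * ?p1 x y
      \<le> (\<kappa> * ?c0 x y) * (\<kappa> * ?c1 x y)"
      unfolding distrib_left using \<kappa>_ge_1
      by (intro mult_mono add_mono two_block_domination add_nonneg_nonneg mult_nonneg_nonneg) auto
    also have "\<dots> = \<kappa>\<^sup>2 * (?c0 x y * ?c1 x y)"
      by (simp add: power2_eq_square)
    finally have "sqrt (?p0 x y * ?p1 x y)
      \<le> sqrt (\<kappa>\<^sup>2 * (?c0 x y * ?c1 x y))"
      by (rule real_sqrt_le_mono)
    also have "\<dots> = \<kappa> * sqrt (?c0 x y * ?c1 x y)"
      using \<kappa>_ge_1 real_sqrt_mult[of "\<kappa>\<^sup>2"] by simp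
    also have "\<dots> \<le> \<kappa> * (sqrt (?\<alpha> False x * ?\<alpha> True x) * (?\<beta> False y + ?\<beta> True y)
        + sqrt (?\<beta> False y * ?\<beta> True y) * (?\<alpha> False x + ?\<alpha> True x))"
      using \<kappa>_ge_1 by (intro mult_left_mono bhatt_convolution) auto
    finally show "2 * sqrt (?p0 x y * ?p1 x y)
      \<le> \<kappa> * (2 * sqrt (?\<alpha> False x * ?\<alpha> True x) * (?\<beta> False y + ?\<beta> True y)
      + (?\<alpha> False x + ?\<alpha> True x) * (2 * sqrt (?\<beta> False y * ?\<beta> True y)))"
      by (simp add: algebra_simps)
  qed
  also have "\<dots> = \<kappa> * ((\<Sum>x\<in>?DL. 2 * sqrt (?\<alpha> False x * ?\<alpha> True x)) * (\<Sum>y\<in>?DR. ?\<beta> False y + ?\<beta> True y)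
      + (\<Sum>x\<in>?DL. ?\<alpha> False x + ?\<alpha> True x) * (\<Sum>y\<in>?DR. 2 * sqrt (?\<beta> False y * ?\<beta> True y)))"
    unfolding sum_product sum.cartesian_product by (simp add: sum_distrib_left sum.distrib split_def
        distrib_left)
  also have "\<dots> = \<kappa> * (Zpar M (U t) (L t) * obs_sum M (+) (U' b) (R b) + obs_sum M (+) (U t) (L t)
      * Zpar M (U' b) (R b))"
    by (simp add: obs_sum_def)
  finally show ?thesis by (simp add: obs_sum_mass)
qed

text \<open>Once the sum is known, the second bit determines the first. For product weights both
  values of the sum give the same root, and together they supply the second factor
  \<open>2\<close>.\<close>

lemma Zpar_plus_le:
  "Zpar M (U' b) (\<lambda>\<omega>. ((L t \<omega>, R b \<omega>), U t \<omega> \<noteq> U' b \<omega>)) \<le> \<kappa> * (Zpar M (U t) (L t) * Zpar M (U' b) (R b))"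
proof -
  let ?DL = "L t ` space M" and ?DR = "R b ` space M"
  let ?p = "\<lambda>u v x y. ev_prob M (\<lambda>\<omega>. (U t \<omega> \<longleftrightarrow> u) \<and> (U' b \<omega> \<longleftrightarrow> v) \<and> L t \<omega> = x \<and> R b \<omega> = y)"
  let ?\<alpha> = "\<lambda>u x. ev_prob M (\<lambda>\<omega>. (U t \<omega> \<longleftrightarrow> u) \<and> L t \<omega> = x)"
  let ?\<beta> = "\<lambda>v y. ev_prob M (\<lambda>\<omega>. (U' b \<omega> \<longleftrightarrow> v) \<and> R b \<omega> = y)"
  have "Zpar M (U' b) (\<lambda>\<omega>. ((L t \<omega>, R b \<omega>), U t \<omega> \<noteq> U' b \<omega>))
      = (\<Sum>z\<in>(?DL \<times> ?DR) \<times> (UNIV :: bool set).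
        2 * sqrt (ev_prob M (\<lambda>\<omega>. \<not> U' b \<omega> \<and> ((L t \<omega>, R b \<omega>), U t \<omega> \<noteq> U' b \<omega>) = z) *
           ev_prob M (\<lambda>\<omega>. U' b \<omega> \<and> ((L t \<omega>, R b \<omega>), U t \<omega> \<noteq> U' b \<omega>) = z)))"
    using two_block_finite by (intro obs_sum_superset) auto
  also have "\<dots> = (\<Sum>(x, y)\<in>?DL \<times> ?DR. 2 * sqrt (?p False False x y * ?p True True x y) + 2
      * sqrt (?p True False x y * ?p False True x y))"
  proof -
    have e: "ev_prob M (\<lambda>\<omega>. \<not> U' b \<omega> \<and> L t \<omega> = x \<and> R b \<omega> = y \<and> U t \<omega> = U' b \<omega>) = ?p False False x y"
      "ev_prob M (\<lambda>\<omega>. U' b \<omega> \<and> L t \<omega> = x \<and> R b \<omega> = y \<and> U t \<omega> = U' b \<omega>) = ?p True True x y"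
      "ev_prob M (\<lambda>\<omega>. \<not> U' b \<omega> \<and> L t \<omega> = x \<and> R b \<omega> = y \<and> U t \<omega> = (\<not> U' b \<omega>)) = ?p True False x y"
      "ev_prob M (\<lambda>\<omega>. U' b \<omega> \<and> L t \<omega> = x \<and> R b \<omega> = y \<and> U t \<omega> = (\<not> U' b \<omega>)) = ?p False True x y" for x y
      by (auto intro!: ev_prob_cong)
    show ?thesis by (simp add: sum.cartesian_product' UNIV_bool e conj_assoc)
  qed
  also have "\<dots> \<le> (\<Sum>(x, y)\<in>?DL \<times> ?DR. \<kappa> * ((2 * sqrt (?\<alpha> False x * ?\<alpha> True x)) * (2
      * sqrt (?\<beta> False y * ?\<beta> True y))))"
  proof (intro sum_mono, clarify)
    fix x y
    have *: "2 * sqrt (?p u v x y * ?p (\<not> u) (\<not> v) x y)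
        \<le> \<kappa> * (sqrt (?\<alpha> False x * ?\<alpha> True x) * (2 * sqrt (?\<beta> False y * ?\<beta> True y)))" for u v
    proof -
      have "?p u v x y * ?p (\<not> u) (\<not> v) x y
          \<le> (\<kappa> * (?\<alpha> u x * ?\<beta> v y)) * (\<kappa> * (?\<alpha> (\<not> u) x * ?\<beta> (\<not> v) y))"
        using \<kappa>_ge_1 by (intro mult_mono two_block_domination mult_nonneg_nonneg) auto
      also have "\<dots> = \<kappa>\<^sup>2 * ((?\<alpha> False x * ?\<alpha> True x) * (?\<beta> False y * ?\<beta> True y))"
        by (cases u; cases v) (simp_all add: power2_eq_square)
      finally have "sqrt (?p u v x y * ?p (\<not> u) (\<not> v) x y)
          \<le> sqrt (\<kappa>\<^sup>2 * ((?\<alpha> False x * ?\<alpha> True x) * (?\<beta> False y * ?\<beta> True y)))"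
        by (rule real_sqrt_le_mono)
      also have "\<dots> = \<kappa> * (sqrt (?\<alpha> False x * ?\<alpha> True x) * sqrt (?\<beta> False y * ?\<beta> True y))"
        using \<kappa>_ge_1 by (simp only: real_sqrt_mult real_sqrt_abs)
      finally show ?thesis by simp
    qed
    show "2 * sqrt (?p False False x y * ?p True True x y) + 2 * sqrt (?p True False x y
        * ?p False True x y)
        \<le> \<kappa> * ((2 * sqrt (?\<alpha> False x * ?\<alpha> True x)) * (2 * sqrt (?\<beta> False y * ?\<beta> True y)))"
      using *[of False False] *[of True False] by simp
  qed
  also have "\<dots> = \<kappa> * (Zpar M (U t) (L t) * Zpar M (U' b) (R b))"
    unfolding obs_sum_def sum_product sum.cartesian_product by (simp add: sum_distrib_left split_def)
  finally show ?thesis .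
qed

abbreviation "ll \<equiv> left_law t b U L"

abbreviation "rl \<equiv> right_law b U' R"

lemma two_block_law:
  "ev_prob M (\<lambda>\<omega>. (U t \<omega> \<longleftrightarrow> u) \<and> (U' b \<omega> \<longleftrightarrow> v) \<and> L t \<omega> = x \<and> R b \<omega> = y \<and> S b \<omega> = s)
    = ll u x s * rl v y s / \<pi> s"
  using ev_prob_markov[OF block_fun_Pair[OF U L] block_fun_Pair[OF U' R] b,
      of "\<lambda>z. (fst z \<longleftrightarrow> u) \<and> snd z = x" "\<lambda>z. (fst z \<longleftrightarrow> v) \<and> snd z = y" s]
  by (simp add: left_law_def right_law_def conj_ac)

lemma obs_sum_left:
  assumes "f 0 0 = 0"
  shows "obs_sum M f (U t) (\<lambda>\<omega>. (L t \<omega>, S b \<omega>))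
    = (\<Sum>s\<in>UNIV. \<Sum>x\<in>L t ` space M. f (ll False x s) (ll True x s))"
  using obs_sum_Pair[OF two_block_simple(2), of f "U t" "S b"] assms by (simp add: left_law_def)

lemma obs_sum_right:
  assumes "f 0 0 = 0"
  shows "obs_sum M f (U' b) (\<lambda>\<omega>. (R b \<omega>, S b \<omega>))
    = (\<Sum>s\<in>UNIV. \<Sum>y\<in>R b ` space M. f (rl False y s) (rl True y s))"
  using obs_sum_Pair[OF two_block_simple(4), of f "U' b" "S b"] assms by (simp add: right_law_def)

lemma left_law_sum: "(\<Sum>x\<in>L t ` space M. ll False x s + ll True x s) = \<pi> s"
proof -
  have "\<pi> s = (\<Sum>x\<in>L t ` space M. ev_prob M (\<lambda>\<omega>. S b \<omega> = s \<and> L t \<omega> = x))"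
    unfolding ev_prob_S[of b, symmetric]
    by (rule ev_prob_sum[OF XYS_simple(3) two_block_simple(2) two_block_finite(1) subset_refl])
  also have "\<dots> = (\<Sum>x\<in>L t ` space M. ll False x s + ll True x s)"
    using ev_prob_bool_split[of "\<lambda>\<omega>. (S b \<omega>, L t \<omega>)" "U t" "\<lambda>z. fst z = s \<and> snd z = _"]
    by (simp add: left_law_def conj_ac)
  finally show ?thesis by simp
qed

lemma right_law_sum: "(\<Sum>y\<in>R b ` space M. rl False y s + rl True y s) = \<pi> s"
proof -
  have "\<pi> s = (\<Sum>y\<in>R b ` space M. ev_prob M (\<lambda>\<omega>. S b \<omega> = s \<and> R b \<omega> = y))"
    unfolding ev_prob_S[of b, symmetric]
    by (rule ev_prob_sum[OF XYS_simple(3) two_block_simple(4) two_block_finite(2) subset_refl])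
  also have "\<dots> = (\<Sum>y\<in>R b ` space M. rl False y s + rl True y s)"
    using ev_prob_bool_split[of "\<lambda>\<omega>. (S b \<omega>, R b \<omega>)" "U' b" "\<lambda>z. fst z = s \<and> snd z = _"]
    by (simp add: right_law_def conj_ac)
  finally show ?thesis by simp
qed

text \<open>Given the shared state, the difference of the weights of the sum is exactly the product
  of the two differences. The single sum over states is then enlarged to a product of two
  sums.\<close>

lemma Kpar_minus_le:
  "Kpar M (\<lambda>\<omega>. U t \<omega> \<noteq> U' b \<omega>) (\<lambda>\<omega>. ((L t \<omega>, R b \<omega>), S b \<omega>))
    \<le> \<kappa> * (Kpar M (U t) (\<lambda>\<omega>. (L t \<omega>, S b \<omega>)) * Kpar M (U' b) (\<lambda>\<omega>. (R b \<omega>, S b \<omega>)))"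
proof -
  let ?V = "\<lambda>\<omega>. ((L t \<omega>, R b \<omega>), S b \<omega>)" and ?X = "\<lambda>\<omega>. U t \<omega> \<noteq> U' b \<omega>"
    and ?d = "\<lambda>x y s. \<bar>ll False x s - ll True x s\<bar> * \<bar>rl False y s - rl True y s\<bar> / \<pi> s"
  let ?DL = "L t ` space M" and ?DR = "R b ` space M"
  let ?A = "\<lambda>s. \<Sum>x\<in>?DL. \<bar>ll False x s - ll True x s\<bar>"
  let ?B = "\<lambda>s. \<Sum>y\<in>?DR. \<bar>rl False y s - rl True y s\<bar>"
  have LRS: "simple_function M ?V" by auto
  have law: "ev_prob M (\<lambda>\<omega>. \<not> ?X \<omega> \<and> ?V \<omega> = ((x, y), s))
      = (ll False x s * rl False y s + ll True x s * rl True y s) / \<pi> s"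
    "ev_prob M (\<lambda>\<omega>. ?X \<omega> \<and> ?V \<omega> = ((x, y), s))
      = (ll False x s * rl True y s + ll True x s * rl False y s) / \<pi> s" for x y s
    unfolding two_block_xor[OF LRS, of "\<lambda>z. z = ((x, y), s)"]
    using two_block_law[of False False x y s] two_block_law[of True True x y s]
      two_block_law[of False True x y s] two_block_law[of True False x y s]
    by (simp_all add: conj_assoc add_divide_distrib)
  have "Kpar M ?X ?V
    = (\<Sum>((x, y), s)\<in>(?DL \<times> ?DR) \<times> UNIV. ?d x y s)"
  proof (subst obs_sum_superset[where D = "(?DL \<times> ?DR) \<times> UNIV"])
    show "(\<Sum>q\<in>(?DL \<times> ?DR) \<times> UNIV. \<bar>ev_prob M (\<lambda>\<omega>. \<not> ?X \<omega> \<and> ?V \<omega> = q) -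
        ev_prob M (\<lambda>\<omega>. ?X \<omega> \<and> ?V \<omega> = q)\<bar>) =
      (\<Sum>((x, y), s)\<in>(?DL \<times> ?DR) \<times> UNIV. ?d x y s)"
    proof (intro sum.cong refl, clarify)
      fix x y s
      have "ll False x s * rl False y s + ll True x s * rl True y s
        - (ll False x s * rl True y s + ll True x s * rl False y s)
        = (ll False x s - ll True x s) * (rl False y s - rl True y s)"
        by (simp add: algebra_simps)
      then show "\<bar>ev_prob M (\<lambda>\<omega>. \<not> ?X \<omega> \<and> ?V \<omega> = ((x, y), s)) -
        ev_prob M (\<lambda>\<omega>. ?X \<omega> \<and> ?V \<omega> = ((x, y), s))\<bar>
        = ?d x y s"
        unfolding law diff_divide_distrib[symmetric] using \<pi>_pos[of s] by (simp add: abs_mult)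
    qed
  qed (use two_block_finite in auto)
  also have "\<dots> = (\<Sum>s\<in>UNIV. (1 / \<pi> s) * (?A s * ?B s))"
    unfolding sum_cartesian_swap sum_product by (simp add: sum_distrib_left)
  also have "\<dots> \<le> (\<Sum>s\<in>UNIV. \<kappa> * (?A s * (\<Sum>s\<in>UNIV. ?B s)))"
  proof (rule sum_mono)
    fix s
    have "?B s \<le> (\<Sum>s\<in>UNIV. ?B s)" by (rule member_le_sum) (auto intro: sum_nonneg)
    then show "(1 / \<pi> s) * (?A s * ?B s) \<le> \<kappa> * (?A s * (\<Sum>s\<in>UNIV. ?B s))"
      using \<kappa>_ge_1 by (intro mult_mono inverse_\<pi>_le mult_nonneg_nonneg sum_nonneg) auto
  qed
  also have "\<dots> = \<kappa> * ((\<Sum>s\<in>UNIV. ?A s) * (\<Sum>s\<in>UNIV. ?B s))"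
    by (simp only: sum_distrib_left[symmetric] sum_distrib_right[symmetric])
  also have "\<dots> = \<kappa> * (Kpar M (U t) (\<lambda>\<omega>. (L t \<omega>, S b \<omega>)) * Kpar M (U' b) (\<lambda>\<omega>. (R b \<omega>, S b \<omega>)))"
    by (simp add: obs_sum_left obs_sum_right)
  finally show ?thesis .
qed

text \<open>No factor \<open>\<kappa>\<close> arises: the mass of the other block at state
  \<open>s\<close> is \<open>\<pi> s\<close> and cancels the division.\<close>

lemma Kpar_plus_le:
  "Kpar M (U' b) (\<lambda>\<omega>. (((L t \<omega>, R b \<omega>), S b \<omega>), U t \<omega> \<noteq> U' b \<omega>))
    \<le> Kpar M (U t) (\<lambda>\<omega>. (L t \<omega>, S b \<omega>)) + Kpar M (U' b) (\<lambda>\<omega>. (R b \<omega>, S b \<omega>))"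
proof -
  let ?DL = "L t ` space M" and ?DR = "R b ` space M"
  let ?A = "\<lambda>s. \<Sum>x\<in>?DL. \<bar>ll False x s - ll True x s\<bar>"
  let ?B = "\<lambda>s. \<Sum>y\<in>?DR. \<bar>rl False y s - rl True y s\<bar>"
  let ?p = "\<lambda>u v x y s. ev_prob M (\<lambda>\<omega>. (U t \<omega> \<longleftrightarrow> u) \<and> (U' b \<omega> \<longleftrightarrow> v) \<and> L t \<omega> = x \<and> R b \<omega> = y \<and> S b \<omega> = s)"
  let ?V = "\<lambda>\<omega>. (((L t \<omega>, R b \<omega>), S b \<omega>), U t \<omega> \<noteq> U' b \<omega>)"
    and ?d = "\<lambda>x y s. \<bar>?p False False x y s - ?p True True x y s\<bar>
        + \<bar>?p True False x y s - ?p False True x y s\<bar>"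
    and ?e = "\<lambda>x y s. \<bar>ll False x s - ll True x s\<bar> * (rl False y s + rl True y s)
      + (ll False x s + ll True x s) * \<bar>rl False y s - rl True y s\<bar>"
  have "Kpar M (U' b) ?V
      = (\<Sum>z\<in>((?DL \<times> ?DR) \<times> UNIV) \<times> (UNIV :: bool set).
        \<bar>ev_prob M (\<lambda>\<omega>. \<not> U' b \<omega> \<and> ?V \<omega> = z) -
           ev_prob M (\<lambda>\<omega>. U' b \<omega> \<and> ?V \<omega> = z)\<bar>)"
    using two_block_finite by (intro obs_sum_superset) auto
  also have "\<dots> = (\<Sum>((x, y), s)\<in>(?DL \<times> ?DR) \<times> UNIV.
      ?d x y s)"
  proof -
    have e: "ev_prob M (\<lambda>\<omega>. \<not> U' b \<omega> \<and> L t \<omega> = x \<and> R b \<omega> = y \<and> S b \<omega> = s \<and> U t \<omega> = U' b \<omega>)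
        = ?p False False x y s"
      "ev_prob M (\<lambda>\<omega>. U' b \<omega> \<and> L t \<omega> = x \<and> R b \<omega> = y \<and> S b \<omega> = s \<and> U t \<omega> = U' b \<omega>) = ?p True True x y s"
      "ev_prob M (\<lambda>\<omega>. \<not> U' b \<omega> \<and> L t \<omega> = x \<and> R b \<omega> = y \<and> S b \<omega> = s \<and> U t \<omega> = (\<not> U' b \<omega>))
          = ?p True False x y s"
      "ev_prob M (\<lambda>\<omega>. U' b \<omega> \<and> L t \<omega> = x \<and> R b \<omega> = y \<and> S b \<omega> = s \<and> U t \<omega> = (\<not> U' b \<omega>))
          = ?p False True x y s" for x y s
      by (auto intro!: ev_prob_cong)
    show ?thesis by (simp add: sum.cartesian_product' UNIV_bool e conj_assoc)
  qed
  also have "\<dots> \<le> (\<Sum>((x, y), s)\<in>(?DL \<times> ?DR) \<times> UNIV. (1 / \<pi> s) *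
      ?e x y s)"
  proof (intro sum_mono, clarify)
    fix x y s
    have "?d x y s
      = (1 / \<pi> s) * (\<bar>ll False x s * rl False y s - ll True x s * rl True y s\<bar>
        + \<bar>ll True x s * rl False y s - ll False x s * rl True y s\<bar>)"
      unfolding two_block_law diff_divide_distrib[symmetric] using \<pi>_pos[of s]
          by (simp add: add_divide_distrib)
    also have "\<dots> \<le> (1 / \<pi> s) *
      ?e x y s"
      using \<pi>_pos[of s] by (intro mult_left_mono abs_convolution_plus) auto
    finally show "?d x y s
      \<le> (1 / \<pi> s) *
      ?e x y s" .
  qed
  also have "\<dots> = (\<Sum>s\<in>UNIV. (1 / \<pi> s) * (?A s * (\<Sum>y\<in>?DR. rl False y s + rl True y s)
      + (\<Sum>x\<in>?DL. ll False x s + ll True x s) * ?B s))"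
    unfolding sum_cartesian_swap sum_product sum.distrib[symmetric] by (simp add: sum_distrib_left)
  also have "\<dots> = (\<Sum>s\<in>UNIV. ?A s + ?B s)"
  proof (intro sum.cong refl)
    fix s
    show "(1 / \<pi> s) * (?A s * (\<Sum>y\<in>?DR. rl False y s + rl True y s)
      + (\<Sum>x\<in>?DL. ll False x s + ll True x s) * ?B s) = ?A s + ?B s"
      unfolding left_law_sum right_law_sum using \<pi>_pos[of s] by (simp add: field_simps)
  qed
  also have "\<dots> = Kpar M (U t) (\<lambda>\<omega>. (L t \<omega>, S b \<omega>)) + Kpar M (U' b) (\<lambda>\<omega>. (R b \<omega>, S b \<omega>))"
    by (simp add: obs_sum_left obs_sum_right sum.distrib)
  finally show ?thesis .
qed

end

section \<open>Three blocks with a mixing middle\<close>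

lemma block_fun_const: "block_fun m (\<lambda>_ _. a)"
  by (simp add: block_fun_def)

lemma block_fun_mono: "block_fun m V \<Longrightarrow> m \<le> k \<Longrightarrow> block_fun k V"
  unfolding block_fun_def by auto

lemma block_fun_delay:
  assumes "block_fun m V"
  shows "block_fun (l + m) (\<lambda>t. V (t + int l))"
  unfolding block_fun_def
proof (intro allI impI)
  fix t t' \<omega> \<omega>'
  assume 1: "\<forall>k\<in>{1..l + m}. X (t + int k) \<omega> = X (t' + int k) \<omega>' \<and> Y (t + int k) \<omega> = Y (t' + int k) \<omega>'"
    and 2: "\<forall>k\<in>{0..l + m}. S (t + int k) \<omega> = S (t' + int k) \<omega>'"
  have eq: "a + int l + int k = a + int (l + k)" for a k by simp
  show "V (t + int l) \<omega> = V (t' + int l) \<omega>'"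
  proof (rule block_funD[OF assms])
    show "X (t + int l + int k) \<omega> = X (t' + int l + int k) \<omega>'"
      "Y (t + int l + int k) \<omega> = Y (t' + int l + int k) \<omega>'" if "k \<in> {1..m}" for k
      using 1[rule_format, of "l + k"] that unfolding eq by auto
    show "S (t + int l + int k) \<omega> = S (t' + int l + int k) \<omega>'" if "k \<in> {0..m}" for k
      using 2[rule_format, of "l + k"] that unfolding eq by auto
  qed
qed

text \<open>The Markov property twice: at \<open>b\<close> with the middle and right blocks taken as
  one, then at \<open>b'\<close>.\<close>

lemma three_block_law:
  assumes U: "block_fun m U" and L: "block_fun m L" and W: "block_fun m' W"
    and U': "block_fun m'' U'" and R: "block_fun m'' R"
    and b: "b = t + int m" and b': "b' = b + int m'"
  shows "ev_prob M (\<lambda>\<omega>. (U t \<omega> \<longleftrightarrow> u) \<and> (U' b' \<omega> \<longleftrightarrow> v) \<and> L t \<omega> = x \<and> R b' \<omega> = y \<and> W b \<omega> = w \<and> S b \<omega>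
      = s \<and> S b' \<omega> = s')
    = left_law t b U L u x s * right_law b' U' R v y s' * (ev_prob M (\<lambda>\<omega>. W b \<omega> = w \<and> S b \<omega>
        = s \<and> S b' \<omega> = s') / (\<pi> s * \<pi> s'))"
proof -
  let ?W = "\<lambda>b \<omega>. ((W b \<omega>, S (b + int m') \<omega>), (U' (b + int m') \<omega>, R (b + int m') \<omega>))"
  have W': "block_fun (m' + m'') ?W"
    by (intro block_fun_Pair block_fun_mono[OF W] block_fun_S block_fun_delay U' R) auto
  have 1: "ev_prob M (\<lambda>\<omega>. (U t \<omega> \<longleftrightarrow> u) \<and> (U' b' \<omega> \<longleftrightarrow> v) \<and> L t \<omega> = x \<and> R b' \<omega> = y \<and> W b \<omega> = w \<and> S b \<omega>
      = s \<and> S b' \<omega> = s')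
    = left_law t b U L u x s * ev_prob M (\<lambda>\<omega>. W b \<omega> = w \<and> S b' \<omega> = s' \<and> (U' b' \<omega> \<longleftrightarrow> v) \<and> R b' \<omega>
        = y \<and> S b \<omega> = s) / \<pi> s"
    using ev_prob_markov[OF block_fun_Pair[OF U L] W' b, of "\<lambda>z. (fst z \<longleftrightarrow> u) \<and> snd z = x"
      "\<lambda>z. fst (fst z) = w \<and> snd (fst z) = s' \<and> (fst (snd z) \<longleftrightarrow> v) \<and> snd (snd z) = y" s]
    unfolding left_law_def b' by (simp add: conj_ac)
  have 2: "ev_prob M (\<lambda>\<omega>. W b \<omega> = w \<and> S b' \<omega> = s' \<and> (U' b' \<omega> \<longleftrightarrow> v) \<and> R b' \<omega> = y \<and> S b \<omega> = s)
    = ev_prob M (\<lambda>\<omega>. W b \<omega> = w \<and> S b \<omega> = s \<and> S b' \<omega> = s') * right_law b' U' R v y s' / \<pi> s'"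
    using ev_prob_markov[OF block_fun_Pair[OF W block_fun_S0] block_fun_Pair[OF U' R] b',
      of "\<lambda>z. fst z = w \<and> snd z = s" "\<lambda>z. (fst z \<longleftrightarrow> v) \<and> snd z = y" s']
    unfolding right_law_def by (simp add: conj_ac)
  show ?thesis unfolding 1 2 by (simp add: mult_ac)
qed

text \<open>Mixing enters through \<open>c\<close>: given all states, the outer blocks are independent, and up to the
  factor \<open>c\<close> their inner boundary states are independent as well.\<close>

lemma Hpar_convolution_ge:
  assumes U: "block_fun m U" and L: "block_fun m L" and W: "block_fun m' W"
    and U': "block_fun m'' U'" and R: "block_fun m'' R"
    and b: "b = t + int m" and b': "b' = b + int m'"
    and c: "0 \<le> c" "\<And>s s'. c * \<pi> s * \<pi> s' \<le> trans_joint m' s s'"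
  defines "h \<equiv> Hpar M (U t) (\<lambda>\<omega>. (L t \<omega>, S b \<omega>))"
  shows "h + c * (1 - Kpar M (U' b') (\<lambda>\<omega>. (R b' \<omega>, S b' \<omega>))) * (1 - h)
    \<le> Hpar M (\<lambda>\<omega>. U t \<omega> \<noteq> U' b' \<omega>) (\<lambda>\<omega>. ((L t \<omega>, R b' \<omega>), (W b \<omega>, (S b \<omega>, S b' \<omega>))))"
proof -
  let ?V = "\<lambda>\<omega>. ((L t \<omega>, R b' \<omega>), (W b \<omega>, (S b \<omega>, S b' \<omega>)))" and ?X = "\<lambda>\<omega>. U t \<omega> \<noteq> U' b' \<omega>"
  let ?DL = "L t ` space M" and ?DR = "R b' ` space M" and ?DW = "W b ` space M"
  have sf: "simple_function M (U t)" "simple_function M (L t)" "simple_function M (W b)"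
    "simple_function M (U' b')" "simple_function M (R b')" using assms by auto
  have fin: "finite ?DL" "finite ?DR" "finite ?DW" using sf(2,3,5) unfolding simple_function_def
      by blast+
  define \<alpha> where "\<alpha> = left_law t b U L"
  define \<beta> where "\<beta> = right_law b' U' R"
  define \<mu> where "\<mu> w s s' = ev_prob M (\<lambda>\<omega>. W b \<omega> = w \<and> S b \<omega> = s \<and> S b' \<omega> = s')" for w s s'
  have nn: "0 \<le> \<alpha> u x s" "0 \<le> \<beta> v y s'" "0 \<le> \<mu> w s s'" for u x s v y s' w
    by (auto simp: \<alpha>_def \<beta>_def \<mu>_def left_law_def right_law_def)
  \<comment> \<open>\<open>hs s\<close> and \<open>ks s\<close> are the parts of \<open>h\<close>
    and of the right-hand \<open>K\<close> carried by one inner boundary state.\<close>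
  define hs where "hs s = (\<Sum>x\<in>?DL. hent (\<alpha> False x s) (\<alpha> True x s))" for s
  define ks where "ks s = (\<Sum>y\<in>?DR. \<bar>\<beta> False y s - \<beta> True y s\<bar>)" for s
  let ?c0 = "\<lambda>x y s s'. \<alpha> False x s * \<beta> False y s' + \<alpha> True x s * \<beta> True y s'"
    and ?c1 = "\<lambda>x y s s'. \<alpha> False x s * \<beta> True y s' + \<alpha> True x s * \<beta> False y s'"
    and ?g = "\<lambda>s s'. hs s * \<pi> s' + (\<pi> s' - ks s') * (\<pi> s - hs s)"
  have sum\<alpha>: "(\<Sum>x\<in>?DL. \<alpha> False x s + \<alpha> True x s) = \<pi> s" for s
    unfolding \<alpha>_def by (rule left_law_sum[OF U L U' R b])
  \<comment> \<open>A constant block of length \<open>m'\<close> ending at \<open>b'\<close> stands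
    in for the left neighbour.\<close>
  have sum\<beta>: "(\<Sum>y\<in>?DR. \<beta> False y s + \<beta> True y s) = \<pi> s" for s
    unfolding \<beta>_def by (rule right_law_sum[OF block_fun_const[of m' False] block_fun_const[of m'
        False] U' R b'])
  have sum\<mu>: "(\<Sum>w\<in>?DW. \<mu> w s s') = trans_joint m' s s'" for s s'
  proof -
    have "trans_joint m' s s' = ev_prob M (\<lambda>\<omega>. (S b \<omega>, S b' \<omega>) = (s, s'))"
      using trans_joint_shift[of b s m' s'] by (simp add: b')
    also have "\<dots> = (\<Sum>w\<in>?DW. ev_prob M (\<lambda>\<omega>. (S b \<omega>, S b' \<omega>) = (s, s') \<and> W b \<omega> = w))"
      by (rule ev_prob_sum[OF _ sf(3) fin(3) subset_refl]) auto
    also have "\<dots> = (\<Sum>w\<in>?DW. \<mu> w s s')"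
      unfolding \<mu>_def by (intro sum.cong refl ev_prob_cong) auto
    finally show ?thesis by simp
  qed
  have hs_sum: "(\<Sum>s\<in>UNIV. hs s) = h"
    unfolding hs_def h_def \<alpha>_def by (rule obs_sum_left[OF U L U' R b, symmetric]) simp
  have ks_sum: "(\<Sum>s\<in>UNIV. ks s) = Kpar M (U' b') (\<lambda>\<omega>. (R b' \<omega>, S b' \<omega>))"
    unfolding ks_def \<beta>_def
    by (rule obs_sum_right[OF block_fun_const[of m' False] block_fun_const[of m' False] U' R b',
        symmetric]) simp
  have hs_le: "hs s \<le> \<pi> s" for s
    unfolding hs_def sum\<alpha>[of s, symmetric] by (intro sum_mono hent_le nn)
  have ks_le: "ks s \<le> \<pi> s" for s
    unfolding ks_def sum\<beta>[of s, symmetric] by (intro sum_mono) (use nn in \<open>auto simp: abs_le_iff\<close>)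
  have law: "ev_prob M (\<lambda>\<omega>. \<not> ?X \<omega> \<and> ?V \<omega> = ((x, y), (w, (s, s'))))
      = \<mu> w s s' / (\<pi> s * \<pi> s') * (?c0 x y s s')"
    "ev_prob M (\<lambda>\<omega>. ?X \<omega> \<and> ?V \<omega> = ((x, y), (w, (s, s'))))
      = \<mu> w s s' / (\<pi> s * \<pi> s') * (?c1 x y s s')" for x y w s s'
  proof -
    note tl = three_block_law[OF U L W U' R b b', of _ _ x y w s s', folded \<mu>_def \<alpha>_def \<beta>_def]
    have split: "ev_prob M (\<lambda>\<omega>. (if d then ?X \<omega> else \<not> ?X \<omega>) \<and> ?V \<omega> = ((x, y), (w, (s, s'))))
      = ev_prob M (\<lambda>\<omega>. (U t \<omega> \<longleftrightarrow> False) \<and> (U' b' \<omega> \<longleftrightarrow> d) \<and> L t \<omega> = x \<and> R b' \<omega> = y \<and> W b \<omega> = w \<and> S b \<omega>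
          = s \<and> S b' \<omega> = s')
      + ev_prob M (\<lambda>\<omega>. (U t \<omega> \<longleftrightarrow> True) \<and> (U' b' \<omega> \<longleftrightarrow> \<not> d) \<and> L t \<omega> = x \<and> R b' \<omega> = y \<and> W b \<omega> = w \<and> S b \<omega>
          = s \<and> S b' \<omega> = s')" for d
    proof -
      let ?A = "\<lambda>\<omega>. (U t \<omega>, U' b' \<omega>, ?V \<omega>)"
      have "simple_function M ?A" using sf by auto
      from ev_prob_bool_split[OF this sf(1), of "\<lambda>(a, b, z). (if d then a \<noteq> b else \<not> (a \<noteq> b)) \<and> z
          = ((x, y), (w, (s, s')))"]
      have "ev_prob M (\<lambda>\<omega>. (if d then ?X \<omega> else \<not> ?X \<omega>) \<and> ?V \<omega> = ((x, y), (w, (s, s'))))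
        = ev_prob M (\<lambda>\<omega>. \<not> U t \<omega> \<and> (if d then ?X \<omega> else \<not> ?X \<omega>) \<and> ?V \<omega> = ((x, y), (w, (s, s'))))
        + ev_prob M (\<lambda>\<omega>. U t \<omega> \<and> (if d then ?X \<omega> else \<not> ?X \<omega>) \<and> ?V \<omega> = ((x, y), (w, (s, s'))))"
        unfolding split_conv .
      then show ?thesis
        by (rule trans) (intro arg_cong2[where f = "(+)"] ev_prob_cong; auto)
    qed
    show "ev_prob M (\<lambda>\<omega>. \<not> ?X \<omega> \<and> ?V \<omega> = ((x, y), (w, (s, s'))))
      = \<mu> w s s' / (\<pi> s * \<pi> s') * (?c0 x y s s')"
      using split[of False] unfolding tl if_False not_False_eq_True
          by (simp only: distrib_left mult.commute)
    show "ev_prob M (\<lambda>\<omega>. ?X \<omega> \<and> ?V \<omega> = ((x, y), (w, (s, s'))))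
      = \<mu> w s s' / (\<pi> s * \<pi> s') * (?c1 x y s s')"
      using split[of True] unfolding tl if_True not_True_eq_False
          by (simp only: distrib_left mult.commute)
  qed
  have "Hpar M ?X ?V
    = (\<Sum>((x, y), (w, (s, s')))\<in>(?DL \<times> ?DR) \<times> (?DW \<times> UNIV \<times> UNIV). \<mu> w s s' / (\<pi> s * \<pi> s') *
        hent (?c0 x y s s') (?c1 x y s s'))"
  proof (subst obs_sum_superset[where D = "(?DL \<times> ?DR) \<times> (?DW \<times> UNIV \<times> UNIV)"])
    show "(\<Sum>q\<in>(?DL \<times> ?DR) \<times> (?DW \<times> UNIV \<times> UNIV).
        hent (ev_prob M (\<lambda>\<omega>. \<not> ?X \<omega> \<and> ?V \<omega> = q))
         (ev_prob M (\<lambda>\<omega>. ?X \<omega> \<and> ?V \<omega> = q)))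
      = (\<Sum>((x, y), (w, (s, s')))\<in>(?DL \<times> ?DR) \<times> (?DW \<times> UNIV \<times> UNIV). \<mu> w s s' / (\<pi> s * \<pi> s') *
        hent (?c0 x y s s') (?c1 x y s s'))"
    proof (intro sum.cong refl, clarify)
      fix x y w s s'
      show "hent (ev_prob M (\<lambda>\<omega>. \<not> ?X \<omega> \<and> ?V \<omega> = ((x, y), w, s, s')))
         (ev_prob M (\<lambda>\<omega>. ?X \<omega> \<and> ?V \<omega> = ((x, y), w, s, s')))
        = \<mu> w s s' / (\<pi> s * \<pi> s') *
        hent (?c0 x y s s') (?c1 x y s s')"
        unfolding law using nn \<pi>_pos[of s] \<pi>_pos[of s']
        by (intro hent_scale add_nonneg_nonneg mult_nonneg_nonneg divide_nonneg_nonneg) auto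
    qed
  qed (use fin in auto)
  also have "\<dots> = (\<Sum>(w, s, s')\<in>?DW \<times> UNIV \<times> UNIV. \<mu> w s s' / (\<pi> s * \<pi> s') * (\<Sum>x\<in>?DL. \<Sum>y\<in>?DR.
        hent (?c0 x y s s') (?c1 x y s s')))"
    using sum_cartesian_swap[where A = ?DL and B = ?DR and C = "?DW \<times> UNIV \<times> UNIV" and g
        = "\<lambda>x y (w, s, s'). \<mu> w s s' / (\<pi> s * \<pi> s') *
        hent (?c0 x y s s') (?c1 x y s s')"]
    by (simp add: split_def sum_distrib_left)
  also have "\<dots> \<ge> (\<Sum>(w, s, s')\<in>?DW \<times> UNIV \<times> UNIV. \<mu> w s s' / (\<pi> s * \<pi> s') * ?g s s')"
  proof (intro sum_mono, clarify, intro mult_left_mono)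
    fix w s s'
    have "hs s * \<pi> s' + (\<pi> s' - ks s') * (\<pi> s - hs s)
        = (\<Sum>x\<in>?DL. \<Sum>y\<in>?DR. hent (\<alpha> False x s) (\<alpha> True x s) * (\<beta> False y s' + \<beta> True y s')
      + (\<beta> False y s' + \<beta> True y s' - \<bar>\<beta> False y s' - \<beta> True y s'\<bar>) * (\<alpha> False x s
          + \<alpha> True x s - hent (\<alpha> False x s) (\<alpha> True x s)))"
    proof -
      have 1: "hs s * \<pi> s' = (\<Sum>x\<in>?DL. \<Sum>y\<in>?DR. hent (\<alpha> False x s) (\<alpha> True x s) * (\<beta> False y s'
          + \<beta> True y s'))"
        unfolding hs_def sum\<beta>[of s', symmetric] by (rule sum_product)
      have 2: "(\<pi> s' - ks s') * (\<pi> s - hs s) = (\<Sum>x\<in>?DL. \<Sum>y\<in>?DR. (\<beta> False y s'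
          + \<beta> True y s' - \<bar>\<beta> False y s' - \<beta> True y s'\<bar>) * (\<alpha> False x s
          + \<alpha> True x s - hent (\<alpha> False x s) (\<alpha> True x s)))"
        unfolding hs_def ks_def sum\<beta>[of s', symmetric] sum\<alpha>[of s, symmetric]
            sum_subtractf[symmetric] sum_product
        by (rule sum.swap)
      show ?thesis unfolding 1 2 by (simp only: sum.distrib)
    qed
    also have "\<dots> \<le> (\<Sum>x\<in>?DL. \<Sum>y\<in>?DR.
        hent (?c0 x y s s') (?c1 x y s s'))"
      by (intro sum_mono hent_convolution nn)
    finally show "hs s * \<pi> s' + (\<pi> s' - ks s') * (\<pi> s - hs s) \<le> (\<Sum>x\<in>?DL. \<Sum>y\<in>?DR.
        hent (?c0 x y s s') (?c1 x y s s'))" .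
    show "0 \<le> \<mu> w s s' / (\<pi> s * \<pi> s')" using nn \<pi>_pos by (simp add: less_imp_le)
  qed
  also have "(\<Sum>(w, s, s')\<in>?DW \<times> UNIV \<times> UNIV. \<mu> w s s' / (\<pi> s * \<pi> s') * ?g s s')
     = (\<Sum>s\<in>UNIV. \<Sum>s'\<in>UNIV. trans_joint m' s s' / (\<pi> s * \<pi> s') * ?g s s')"
  proof -
    let ?F = "\<lambda>w s s'. \<mu> w s s' / (\<pi> s * \<pi> s') * ?g s s'"
    have "(\<Sum>(w, s, s')\<in>?DW \<times> UNIV \<times> UNIV. ?F w s s') = (\<Sum>w\<in>?DW. \<Sum>s\<in>UNIV. \<Sum>s'\<in>UNIV. ?F w s s')"
      by (simp only: sum.cartesian_product' split_conv)
    also have "\<dots> = (\<Sum>s\<in>UNIV. \<Sum>s'\<in>UNIV. \<Sum>w\<in>?DW. ?F w s s')"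
      by (subst sum.swap, intro sum.cong refl sum.swap)
    also have "\<dots> = (\<Sum>s\<in>UNIV. \<Sum>s'\<in>UNIV. trans_joint m' s s' / (\<pi> s * \<pi> s') * ?g s s')"
      by (simp only: sum\<mu>[symmetric] sum_distrib_right[symmetric] sum_divide_distrib[symmetric])
    finally show ?thesis .
  qed
  \<comment> \<open>The first term keeps the exact transition weights, whose sum over
    \<open>s'\<close> returns \<open>hs s\<close>; the second is nonnegative by \<open>hs_le\<close>
    and \<open>ks_le\<close> and is bounded below by mixing.\<close>
  also have "\<dots> \<ge> (\<Sum>s\<in>UNIV. \<Sum>s'\<in>UNIV. trans_joint m' s s' * (hs s / \<pi> s) + c * ((\<pi> s' - ks s')
      * (\<pi> s - hs s)))"
  proof (intro sum_mono)
    fix s s'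
    have p: "\<pi> s > 0" "\<pi> s' > 0" by (rule \<pi>_pos)+
    have "c \<le> trans_joint m' s s' / (\<pi> s * \<pi> s')" using c(2)[of s s'] p
        by (simp add: pos_le_divide_eq mult.assoc)
    then have "c * ((\<pi> s' - ks s') * (\<pi> s - hs s))
        \<le> trans_joint m' s s' / (\<pi> s * \<pi> s') * ((\<pi> s' - ks s') * (\<pi> s - hs s))"
      using hs_le ks_le by (intro mult_right_mono mult_nonneg_nonneg) auto
    moreover have "trans_joint m' s s' * (hs s / \<pi> s)
        = trans_joint m' s s' / (\<pi> s * \<pi> s') * (hs s * \<pi> s')"
      using p by simp
    ultimately show "trans_joint m' s s' * (hs s / \<pi> s) + c * ((\<pi> s' - ks s') * (\<pi> s - hs s))
      \<le> trans_joint m' s s' / (\<pi> s * \<pi> s') * ?g s s'"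
      by (simp only: distrib_left)
  qed
  also have "(\<Sum>s\<in>UNIV. \<Sum>s'\<in>UNIV. trans_joint m' s s' * (hs s / \<pi> s) + c * ((\<pi> s' - ks s')
      * (\<pi> s - hs s)))
    = h + c * (1 - Kpar M (U' b') (\<lambda>\<omega>. (R b' \<omega>, S b' \<omega>))) * (1 - h)"
  proof -
    have tsum: "(\<Sum>s'\<in>UNIV. trans_joint m' s s') = \<pi> s" for s
      unfolding \<pi>_def trans_joint_def by (rule ev_prob_sum[of "S 0" _ _ "\<lambda>x. x = s", symmetric]) auto
    have "(\<Sum>s\<in>UNIV. \<Sum>s'\<in>UNIV. trans_joint m' s s' * (hs s / \<pi> s)) = h"
      unfolding sum_distrib_right[symmetric] tsum hs_sum[symmetric]
      using \<pi>_pos by (intro sum.cong refl) (simp add: less_imp_neq[symmetric])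
    moreover have "(\<Sum>s\<in>UNIV. \<Sum>s'\<in>UNIV. c * ((\<pi> s' - ks s') * (\<pi> s - hs s)))
      = c * ((\<Sum>s'\<in>UNIV. \<pi> s' - ks s') * (\<Sum>s\<in>UNIV. \<pi> s - hs s))"
      unfolding sum_product unfolding sum_distrib_left by (rule sum.swap)
    ultimately show ?thesis
      by (simp add: sum.distrib sum_subtractf \<pi>_sum hs_sum ks_sum)
  qed
  finally show ?thesis .
qed

end

section \<open>Polar transform\<close>

definition cond_ent :: "'w measure \<Rightarrow> ('w \<Rightarrow> 'a) \<Rightarrow> ('w \<Rightarrow> 'b) \<Rightarrow> real" where
  "cond_ent M A B = ent M (\<lambda>\<omega>. (A \<omega>, B \<omega>)) - ent M B"

lemma cond_ent_same_partition:
  assumes "same_partition M B B'" "same_partition M (\<lambda>\<omega>. (A \<omega>, B \<omega>)) (\<lambda>\<omega>. (A' \<omega>, B' \<omega>))"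
  shows "cond_ent M A B = cond_ent M A' B'"
  unfolding cond_ent_def using assms[THEN ent_same_partition] by simp

context prob_space
begin

lemma cond_ent_refine:
  assumes "simple_function M A" "simple_function M B" "simple_function M C"
  shows "cond_ent M A (\<lambda>\<omega>. (B \<omega>, C \<omega>)) \<le> cond_ent M A B"
  using ent_submodular[OF assms] by (simp add: cond_ent_def)

lemma ent_Pair_le:
  assumes B: "simple_function M B" and C: "simple_function M C"
  shows "ent M (\<lambda>\<omega>. (B \<omega>, C \<omega>)) \<le> ent M B + ent M C"
proof -
  have "ent M (\<lambda>\<omega>. ()) = 0" using prob_space not_empty by (simp add: ent_def ev_prob_def eta_def)
  moreover have "ent M (\<lambda>\<omega>. (B \<omega>, (), C \<omega>)) = ent M (\<lambda>\<omega>. (B \<omega>, C \<omega>))"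
    "ent M (\<lambda>\<omega>. (B \<omega>, ())) = ent M B" "ent M (\<lambda>\<omega>. ((), C \<omega>)) = ent M C"
    by (auto intro!: ent_same_partition simp: same_partition_def)
  ultimately show ?thesis using ent_submodular[OF B _ C, of "\<lambda>_. ()"] by simp
qed

text \<open>Forgetting \<open>C\<close> costs at most its entropy; for a boundary state this cost
  does not grow with the block.\<close>

lemma cond_ent_le_cent_cond:
  assumes A: "simple_function M A" and B: "simple_function M B" and C: "simple_function M C"
  shows "cond_ent M A B \<le> cond_ent M A (\<lambda>\<omega>. (B \<omega>, C \<omega>)) + ent M C"
proof -
  have "ent M (\<lambda>\<omega>. (A \<omega>, B \<omega>)) \<le> ent M (\<lambda>\<omega>. (C \<omega>, A \<omega>, B \<omega>))"
    using assms by (intro ent_mono) auto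
  also have "\<dots> = ent M (\<lambda>\<omega>. (A \<omega>, B \<omega>, C \<omega>))"
    by (auto intro!: ent_same_partition simp: same_partition_def)
  finally show ?thesis using ent_Pair_le[OF B C] by (simp add: cond_ent_def)
qed

lemma cond_ent_Pair_le:
  assumes A: "simple_function M A" and B: "simple_function M B"
    and A': "simple_function M A'" and B': "simple_function M B'"
  shows "cond_ent M (\<lambda>\<omega>. (A \<omega>, A' \<omega>)) (\<lambda>\<omega>. (B \<omega>, B' \<omega>)) \<le> cond_ent M A B + cond_ent M A' B'"
proof -
  have "ent M (\<lambda>\<omega>. ((A \<omega>, A' \<omega>), (B \<omega>, B' \<omega>))) = ent M (\<lambda>\<omega>. (A \<omega>, B \<omega>, (A' \<omega>, B' \<omega>)))"
    and "ent M (\<lambda>\<omega>. (A' \<omega>, B' \<omega>, B \<omega>)) = ent M (\<lambda>\<omega>. (B \<omega>, (A' \<omega>, B' \<omega>)))"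
    and "ent M (\<lambda>\<omega>. (B' \<omega>, B \<omega>)) = ent M (\<lambda>\<omega>. (B \<omega>, B' \<omega>))"
    by (auto intro!: ent_same_partition simp: same_partition_def)
  moreover have "ent M (\<lambda>\<omega>. (A \<omega>, B \<omega>, (A' \<omega>, B' \<omega>))) + ent M B
      \<le> ent M (\<lambda>\<omega>. (A \<omega>, B \<omega>)) + ent M (\<lambda>\<omega>. (B \<omega>, (A' \<omega>, B' \<omega>)))"
    using assms by (intro ent_submodular) auto
  moreover have "ent M (\<lambda>\<omega>. (A' \<omega>, B' \<omega>, B \<omega>)) + ent M B'
      \<le> ent M (\<lambda>\<omega>. (A' \<omega>, B' \<omega>)) + ent M (\<lambda>\<omega>. (B' \<omega>, B \<omega>))"
    using assms by (intro ent_submodular) auto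
  ultimately show ?thesis by (simp add: cond_ent_def)
qed

end

context faim
begin

text \<open>Given the shared state, the conditional entropies of the two blocks add without
  loss.\<close>

lemma cond_ent_markov:
  assumes A: "block_fun m A" and B: "block_fun m B" and A': "block_fun m' A'" and B': "block_fun m' B'"
    and b: "b = t + int m"
  shows "cond_ent M (\<lambda>\<omega>. (A t \<omega>, A' b \<omega>)) (\<lambda>\<omega>. ((B t \<omega>, B' b \<omega>), S b \<omega>))
    = cond_ent M (A t) (\<lambda>\<omega>. (B t \<omega>, S b \<omega>)) + cond_ent M (A' b) (\<lambda>\<omega>. (B' b \<omega>, S b \<omega>))"
proof -
  have "ent M (\<lambda>\<omega>. ((A t \<omega>, A' b \<omega>), ((B t \<omega>, B' b \<omega>), S b \<omega>)))
      = ent M (\<lambda>\<omega>. ((A t \<omega>, B t \<omega>), S b \<omega>, (A' b \<omega>, B' b \<omega>)))"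
    and "ent M (\<lambda>\<omega>. ((B t \<omega>, B' b \<omega>), S b \<omega>)) = ent M (\<lambda>\<omega>. (B t \<omega>, S b \<omega>, B' b \<omega>))"
    and "ent M (\<lambda>\<omega>. ((A t \<omega>, B t \<omega>), S b \<omega>)) = ent M (\<lambda>\<omega>. (A t \<omega>, B t \<omega>, S b \<omega>))"
    and "ent M (\<lambda>\<omega>. (S b \<omega>, (A' b \<omega>, B' b \<omega>))) = ent M (\<lambda>\<omega>. (A' b \<omega>, B' b \<omega>, S b \<omega>))"
    and "ent M (\<lambda>\<omega>. (S b \<omega>, B' b \<omega>)) = ent M (\<lambda>\<omega>. (B' b \<omega>, S b \<omega>))"
    by (auto intro!: ent_same_partition simp: same_partition_def)
  then show ?thesis
    using ent_markov[OF block_fun_Pair[OF A B] block_fun_Pair[OF A' B'] b] ent_markov[OF B B' b]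
    by (simp add: cond_ent_def)
qed

lemma block_fun_comp2:
  assumes "block_fun m V" "block_fun m W"
  shows "block_fun m (\<lambda>t \<omega>. g (V t \<omega>) (W t \<omega>))"
  unfolding block_fun_def
proof (intro allI impI)
  fix t t' \<omega> \<omega>'
  assume "\<forall>k\<in>{1..m}. X (t + int k) \<omega> = X (t' + int k) \<omega>' \<and> Y (t + int k) \<omega> = Y (t' + int k) \<omega>'"
    "\<forall>k\<in>{0..m}. S (t + int k) \<omega> = S (t' + int k) \<omega>'"
  then have "V t \<omega> = V t' \<omega>'" "W t \<omega> = W t' \<omega>'"
    using assms unfolding block_fun_def by blast+
  then show "g (V t \<omega>) (W t \<omega>) = g (V t' \<omega>') (W t' \<omega>')" by simp
qed

lemma block_fun_map:
  assumes "\<And>k. k \<in> set ks \<Longrightarrow> block_fun m (V k)"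
  shows "block_fun m (\<lambda>t \<omega>. map (\<lambda>k. V k t \<omega>) ks)"
  unfolding block_fun_def
proof (intro allI impI map_cong refl)
  fix t t' \<omega> \<omega>' k
  assume "\<forall>k\<in>{1..m}. X (t + int k) \<omega> = X (t' + int k) \<omega>' \<and> Y (t + int k) \<omega> = Y (t' + int k) \<omega>'"
    "\<forall>k\<in>{0..m}. S (t + int k) \<omega> = S (t' + int k) \<omega>'" "k \<in> set ks"
  then show "V k t \<omega> = V k t' \<omega>'"
    using assms[of k] unfolding block_fun_def by blast
qed

section \<open>The polar transform as a recursion\<close>

text \<open>Recursion over the two halves of a block; the lowest bit of the index selects the last
  transform, even for minus and odd for plus. \<open>polar_U_eq\<close> identifies it with the
  matrix form.\<close>

fun pU :: "nat \<Rightarrow> nat \<Rightarrow> int \<Rightarrow> 'w \<Rightarrow> bool" where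
  "pU 0 i t \<omega> = X (t + 1) \<omega>"
| "pU (Suc n) i t \<omega> = (if odd i then pU n (i div 2) (t + 2 ^ n) \<omega>
     else pU n (i div 2) t \<omega> \<noteq> pU n (i div 2) (t + 2 ^ n) \<omega>)"

definition XB :: "nat \<Rightarrow> int \<Rightarrow> 'w \<Rightarrow> bool list" where
  "XB N t \<omega> = map (\<lambda>k. X (t + 1 + int k) \<omega>) [0..<N]"

definition YB :: "nat \<Rightarrow> int \<Rightarrow> 'w \<Rightarrow> 'y list" where
  "YB N t \<omega> = map (\<lambda>k. Y (t + 1 + int k) \<omega>) [0..<N]"

definition pQ :: "nat \<Rightarrow> nat \<Rightarrow> int \<Rightarrow> 'w \<Rightarrow> bool list \<times> 'y list" where
  "pQ n i t \<omega> = (map (\<lambda>k. pU n k t \<omega>) [0..<i], YB (2 ^ n) t \<omega>)"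

definition pQs :: "nat \<Rightarrow> nat \<Rightarrow> int \<Rightarrow> 'w \<Rightarrow> (bool list \<times> 'y list) \<times> 's \<times> 's" where
  "pQs n i t \<omega> = (pQ n i t \<omega>, S t \<omega>, S (t + 2 ^ n) \<omega>)"

lemma block_fun_X: "k \<in> {1..m} \<Longrightarrow> block_fun m (\<lambda>t. X (t + int k))"
  unfolding block_fun_def by blast

lemma block_fun_Y: "k \<in> {1..m} \<Longrightarrow> block_fun m (\<lambda>t. Y (t + int k))"
  unfolding block_fun_def by blast

lemma block_fun_XB: "block_fun m (XB m)"
proof -
  have "block_fun m (\<lambda>t. X (t + 1 + int k))" if "k < m" for k
    using block_fun_X[of "Suc k" m] that by (simp add: add.assoc)
  then show ?thesis unfolding XB_def[abs_def] by (intro block_fun_map) auto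
qed

lemma block_fun_YB: "block_fun m (YB m)"
proof -
  have "block_fun m (\<lambda>t. Y (t + 1 + int k))" if "k < m" for k
    using block_fun_Y[of "Suc k" m] that by (simp add: add.assoc)
  then show ?thesis unfolding YB_def[abs_def] by (intro block_fun_map) auto
qed

lemma block_fun_pU: "block_fun (2 ^ n) (pU n i)"
proof (induction n arbitrary: i)
  case 0
  have "pU 0 i = (\<lambda>t. X (t + int 1))" by (auto simp: fun_eq_iff)
  then show ?case using block_fun_X[of 1 1] by simp
next
  case (Suc n)
  have 1: "block_fun (2 ^ Suc n) (pU n (i div 2))" by (rule block_fun_mono[OF Suc]) simp
  have 2: "block_fun (2 ^ Suc n) (\<lambda>t. pU n (i div 2) (t + 2 ^ n))"
    using block_fun_delay[OF Suc, of "2 ^ n" "i div 2"] by (simp add: mult_2)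
  have "pU (Suc n) i = (\<lambda>t \<omega>. (\<lambda>x y. if odd i then y else x \<noteq> y) (pU n (i div 2) t \<omega>) (pU n (i div
      2) (t + 2 ^ n) \<omega>))"
    by (auto simp: fun_eq_iff)
  then show ?case using block_fun_comp2[OF 1 2, of "\<lambda>x y. if odd i then y else x \<noteq> y"] by simp
qed

lemma block_fun_pQ: "block_fun (2 ^ n) (pQ n i)"
  unfolding pQ_def[abs_def] by (intro block_fun_Pair block_fun_map block_fun_pU block_fun_YB)

lemma block_fun_pQs: "block_fun (2 ^ n) (pQs n i)"
  using block_fun_Pair[OF block_fun_pQ block_fun_Pair[OF block_fun_S0 block_fun_S[of "2 ^ n" "2 ^ n"]]]
  unfolding pQs_def[abs_def] by simp

lemma polar_simple [simp]:
  "simple_function M (pU n i t)" "simple_function M (pQ n i t)" "simple_function M (pQs n i t)"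
  "simple_function M (XB m t)" "simple_function M (YB m t)"
  by (rule block_fun_simple, rule block_fun_pU block_fun_pQ block_fun_pQs block_fun_XB block_fun_YB)+

lemma two_power_add: "2 ^ n + 2 ^ n = (2 ^ Suc n :: int)"
  by simp

lemma all_less_double: "(\<forall>k<2 * m. P k) \<longleftrightarrow> (\<forall>k<m. P (2 * k) \<and> P (Suc (2 * k)))" for m :: nat
proof safe
  fix k assume *: "\<forall>k<m. P (2 * k) \<and> P (Suc (2 * k))" "k < 2 * m"
  then show "P k" by (cases "even k") (auto elim!: evenE oddE)
qed auto

lemma all_less_add: "(\<forall>k<m + n. P k) \<longleftrightarrow> (\<forall>k<m. P k) \<and> (\<forall>k<n. P (m + k))" for m n :: nat
proof safe
  fix k assume *: "\<forall>k<m. P k" "\<forall>k<n. P (m + k)" "k < m + n"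
  then show "P k" by (cases "k < m") (auto dest!: spec[of _ "k - m"])
qed auto

lemma XB_eq_iff: "XB m t \<omega> = XB m t \<omega>' \<longleftrightarrow> (\<forall>k<m. X (t + 1 + int k) \<omega> = X (t + 1 + int k) \<omega>')"
  by (auto simp: XB_def)

lemma YB_eq_iff: "YB m t \<omega> = YB m t \<omega>' \<longleftrightarrow> (\<forall>k<m. Y (t + 1 + int k) \<omega> = Y (t + 1 + int k) \<omega>')"
  by (auto simp: YB_def)

lemma XB_add: "XB (m + n) t \<omega> = XB (m + n) t \<omega>' \<longleftrightarrow>
    XB m t \<omega> = XB m t \<omega>' \<and> XB n (t + int m) \<omega> = XB n (t + int m) \<omega>'"
  unfolding XB_eq_iff all_less_add by (simp add: algebra_simps)

lemma YB_add: "YB (m + n) t \<omega> = YB (m + n) t \<omega>' \<longleftrightarrow>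
    YB m t \<omega> = YB m t \<omega>' \<and> YB n (t + int m) \<omega> = YB n (t + int m) \<omega>'"
  unfolding YB_eq_iff all_less_add by (simp add: algebra_simps)

lemma pQ_eq_iff: "pQ n i t \<omega> = pQ n i t \<omega>' \<longleftrightarrow>
    (\<forall>k<i. pU n k t \<omega> = pU n k t \<omega>') \<and> YB (2 ^ n) t \<omega> = YB (2 ^ n) t \<omega>'"
  by (auto simp: pQ_def)

lemma pQ_Suc: "pQ n (Suc i) t \<omega> = pQ n (Suc i) t \<omega>' \<longleftrightarrow>
    pU n i t \<omega> = pU n i t \<omega>' \<and> pQ n i t \<omega> = pQ n i t \<omega>'"
  unfolding pQ_eq_iff by (auto simp: less_Suc_eq)

lemma pU_double: "(\<forall>k<2 * i. pU (Suc n) k t \<omega> = pU (Suc n) k t \<omega>') \<longleftrightarrow>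
    (\<forall>k<i. pU n k t \<omega> = pU n k t \<omega>') \<and> (\<forall>k<i. pU n k (t + 2 ^ n) \<omega> = pU n k (t + 2 ^ n) \<omega>')"
  unfolding all_less_double by auto

text \<open>The outputs with indices \<open>2 * k\<close> and \<open>2 * k + 1\<close> are an
  invertible function of the two outputs with index \<open>k\<close> of the halves.\<close>

lemma pQ_double: "pQ (Suc n) (2 * i) t \<omega> = pQ (Suc n) (2 * i) t \<omega>' \<longleftrightarrow>
    pQ n i t \<omega> = pQ n i t \<omega>' \<and> pQ n i (t + 2 ^ n) \<omega> = pQ n i (t + 2 ^ n) \<omega>'"
  using YB_add[of "2 ^ n" "2 ^ n" t \<omega> \<omega>'] unfolding pQ_eq_iff pU_double by (auto simp: mult_2)

text \<open>Invertibility of the polar transform, expressed by equality of the induced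
  partitions.\<close>

lemma pU_all: "(\<forall>k<2 ^ n. pU n k t \<omega> = pU n k t \<omega>') \<longleftrightarrow> XB (2 ^ n) t \<omega> = XB (2 ^ n) t \<omega>'"
proof (induction n arbitrary: t)
  case (Suc n)
  have "(\<forall>k<2 ^ Suc n. pU (Suc n) k t \<omega> = pU (Suc n) k t \<omega>') \<longleftrightarrow>
      XB (2 ^ n) t \<omega> = XB (2 ^ n) t \<omega>' \<and> XB (2 ^ n) (t + 2 ^ n) \<omega> = XB (2 ^ n) (t + 2 ^ n) \<omega>'"
    unfolding power_Suc pU_double Suc ..
  then show ?case using XB_add[of "2 ^ n" "2 ^ n" t \<omega> \<omega>'] by (simp add: mult_2)
qed (simp add: XB_def)

text \<open>In the notation of the introduction, \<open>Hs\<close> and \<open>Ks\<close> are \<open>H'\<close> and \<open>K'\<close>; indices start at \<open>0\<close>.\<close>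

definition Hn :: "nat \<Rightarrow> nat \<Rightarrow> real" where "Hn n i = Hpar M (pU n i 0) (pQ n i 0)"
definition Hs :: "nat \<Rightarrow> nat \<Rightarrow> real" where "Hs n i = Hpar M (pU n i 0) (pQs n i 0)"
definition Ks :: "nat \<Rightarrow> nat \<Rightarrow> real" where "Ks n i = Kpar M (pU n i 0) (pQs n i 0)"
definition Zn :: "nat \<Rightarrow> nat \<Rightarrow> real" where "Zn n i = Zpar M (pU n i 0) (pQ n i 0)"

lemma shift_polar:
  "Hpar M (pU n i t) (pQ n i t) = Hn n i" "Hpar M (pU n i t) (pQs n i t) = Hs n i"
  "Kpar M (pU n i t) (pQs n i t) = Ks n i" "Zpar M (pU n i t) (pQ n i t) = Zn n i"
  unfolding Hn_def Hs_def Ks_def Zn_def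
  by (rule obs_sum_shift[OF block_fun_pU block_fun_pQ] obs_sum_shift[OF block_fun_pU block_fun_pQs],
      simp)+

lemma polar_bounds:
  "0 \<le> Hn n i" "Hn n i \<le> 1" "0 \<le> Hs n i" "Hs n i \<le> 1" "0 \<le> Ks n i" "Ks n i \<le> 1" "0 \<le> Zn n i" "Zn n i \<le> 1"
  unfolding Hn_def Hs_def Ks_def Zn_def
  by (rule Hpar_bounds Kpar_bounds Zpar_bounds; simp)+

lemma Hs_le_Hn: "Hs n i \<le> Hn n i"
  unfolding Hs_def Hn_def pQs_def[abs_def] by (rule Hpar_refine) auto

text \<open>Adding the states only raises \<open>K\<close>, so small \<open>Ks\<close> is enough for
  \<open>Zn\<close> near \<open>1\<close>.\<close>

lemma Zn_ge: "1 - Ks n i \<le> Zn n i"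
proof -
  have "Kpar M (pU n i 0) (pQ n i 0) \<le> Ks n i"
    unfolding Ks_def pQs_def[abs_def] by (rule Kpar_refine) auto
  then show ?thesis using Zpar_ge_Kpar[of "pU n i 0" "pQ n i 0"] by (simp add: Zn_def)
qed

lemma Zn_le: "Zn n i \<le> sqrt (2 * Hn n i)"
  unfolding Zn_def Hn_def by (rule Zpar_le_Hpar) auto

lemma Ks_le: "Ks n i \<le> sqrt (4 * (1 - Hs n i))"
  unfolding Ks_def Hs_def by (rule Kpar_le_Hpar) auto

lemma Hs_le: "Hs n i \<le> 3 / ln 2 * sqrt (1 - Ks n i)"
  unfolding Ks_def Hs_def by (rule Hpar_le_Kpar) auto

text \<open>A trivial \<open>E\<close> gives the chain rule for \<open>Hn\<close>, the pair of
  boundary states the one for \<open>Hs\<close>.\<close>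

lemma chain_step:
  assumes E: "simple_function M E"
  shows "Hpar M (pU n i t) (\<lambda>\<omega>. (pQ n i t \<omega>, E \<omega>))
    = ent M (\<lambda>\<omega>. (pQ n (Suc i) t \<omega>, E \<omega>)) - ent M (\<lambda>\<omega>. (pQ n i t \<omega>, E \<omega>))"
proof -
  have "ent M (\<lambda>\<omega>. (pU n i t \<omega>, pQ n i t \<omega>, E \<omega>)) = ent M (\<lambda>\<omega>. (pQ n (Suc i) t \<omega>, E \<omega>))"
    by (rule ent_same_partition) (auto simp: same_partition_def pQ_Suc)
  then show ?thesis using E by (subst obs_sum_hent) auto
qed

lemma chain_children:
  assumes E: "simple_function M E"
  shows "Hpar M (pU (Suc n) (2 * i) t) (\<lambda>\<omega>. (pQ (Suc n) (2 * i) t \<omega>, E \<omega>))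
      + Hpar M (pU (Suc n) (Suc (2 * i)) t) (\<lambda>\<omega>. (pQ (Suc n) (Suc (2 * i)) t \<omega>, E \<omega>))
    = cond_ent M (\<lambda>\<omega>. (pU n i t \<omega>, pU n i (t + 2 ^ n) \<omega>)) (\<lambda>\<omega>. ((pQ n i t \<omega>, pQ n i (t
        + 2 ^ n) \<omega>), E \<omega>))"
proof -
  have "ent M (\<lambda>\<omega>. (pQ (Suc n) (Suc (Suc (2 * i))) t \<omega>, E \<omega>))
      = ent M (\<lambda>\<omega>. ((pU n i t \<omega>, pU n i (t + 2 ^ n) \<omega>), ((pQ n i t \<omega>, pQ n i (t + 2 ^ n) \<omega>), E \<omega>)))"
    using pQ_double[of n "Suc i" t] by (intro ent_same_partition) (auto simp: same_partition_def
        pQ_Suc simp del: pU.simps)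
  moreover have "ent M (\<lambda>\<omega>. (pQ (Suc n) (2 * i) t \<omega>, E \<omega>))
      = ent M (\<lambda>\<omega>. ((pQ n i t \<omega>, pQ n i (t + 2 ^ n) \<omega>), E \<omega>))"
    by (rule ent_same_partition) (auto simp: same_partition_def pQ_double)
  ultimately show ?thesis unfolding chain_step[OF E] cond_ent_def by simp
qed

lemma chain_total:
  assumes E: "simple_function M E"
  shows "(\<Sum>i<2 ^ n. Hpar M (pU n i t) (\<lambda>\<omega>. (pQ n i t \<omega>, E \<omega>)))
      = cond_ent M (XB (2 ^ n) t) (\<lambda>\<omega>. (YB (2 ^ n) t \<omega>, E \<omega>))"
proof -
  have "(\<Sum>i<2 ^ n. Hpar M (pU n i t) (\<lambda>\<omega>. (pQ n i t \<omega>, E \<omega>)))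
      = ent M (\<lambda>\<omega>. (pQ n (2 ^ n) t \<omega>, E \<omega>)) - ent M (\<lambda>\<omega>. (pQ n 0 t \<omega>, E \<omega>))"
    unfolding chain_step[OF E] by (rule sum_lessThan_telescope)
  also have "ent M (\<lambda>\<omega>. (pQ n (2 ^ n) t \<omega>, E \<omega>)) = ent M (\<lambda>\<omega>. (XB (2 ^ n) t \<omega>, YB (2 ^ n) t \<omega>, E \<omega>))"
    by (rule ent_same_partition) (auto simp: same_partition_def pQ_eq_iff pU_all)
  also have "ent M (\<lambda>\<omega>. (pQ n 0 t \<omega>, E \<omega>)) = ent M (\<lambda>\<omega>. (YB (2 ^ n) t \<omega>, E \<omega>))"
    by (rule ent_same_partition) (auto simp: same_partition_def pQ_eq_iff)
  finally show ?thesis by (simp add: cond_ent_def)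
qed

lemma obs_sum_unit: "obs_sum M f U Q = obs_sum M f U (\<lambda>\<omega>. (Q \<omega>, ()))"
  by (rule obs_sum_same_partition) (simp add: same_partition_def)

lemma cond_ent_eq_Hpar:
  assumes "simple_function M U" "simple_function M Q"
  shows "cond_ent M U Q = Hpar M U Q"
  using obs_sum_hent[OF assms] by (simp add: cond_ent_def)

lemma Hn_children: "Hn (Suc n) (2 * i) + Hn (Suc n) (Suc (2 * i)) \<le> 2 * Hn n i"
proof -
  have "Hn (Suc n) (2 * i) + Hn (Suc n) (Suc (2 * i))
      = cond_ent M (\<lambda>\<omega>. (pU n i 0 \<omega>, pU n i (2 ^ n) \<omega>)) (\<lambda>\<omega>. ((pQ n i 0 \<omega>, pQ n i (2 ^ n) \<omega>), ()))"
    unfolding Hn_def using chain_children[of "\<lambda>_. ()" n i 0]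
        by (simp only: obs_sum_unit[symmetric] add_0) simp
  also have "\<dots> = cond_ent M (\<lambda>\<omega>. (pU n i 0 \<omega>, pU n i (2 ^ n) \<omega>)) (\<lambda>\<omega>. (pQ n i 0 \<omega>, pQ n i (2 ^ n) \<omega>))"
    by (rule cond_ent_same_partition) (auto simp: same_partition_def)
  also have "\<dots> \<le> cond_ent M (pU n i 0) (pQ n i 0) + cond_ent M (pU n i (2 ^ n)) (pQ n i (2 ^ n))"
    by (rule cond_ent_Pair_le) auto
  also have "\<dots> = 2 * Hn n i" by (simp add: cond_ent_eq_Hpar shift_polar)
  finally show ?thesis .
qed

text \<open>Each half keeps its outer boundary state, so that the middle state remains the separate
  conditioning state of the Markov property.\<close>

abbreviation pL :: "nat \<Rightarrow> nat \<Rightarrow> int \<Rightarrow> 'w \<Rightarrow> (bool list \<times> 'y list) \<times> 's" where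
  "pL n i t \<omega> \<equiv> (pQ n i t \<omega>, S t \<omega>)"

abbreviation pR :: "nat \<Rightarrow> nat \<Rightarrow> int \<Rightarrow> 'w \<Rightarrow> (bool list \<times> 'y list) \<times> 's" where
  "pR n i t \<omega> \<equiv> (pQ n i t \<omega>, S (t + 2 ^ n) \<omega>)"

lemma block_fun_pL: "block_fun (2 ^ n) (pL n i)"
  by (intro block_fun_Pair block_fun_pQ block_fun_S0)

lemma block_fun_pR: "block_fun (2 ^ n) (pR n i)"
  using block_fun_Pair[OF block_fun_pQ block_fun_S[of "2 ^ n" "2 ^ n"]] by simp

lemma obs_sum_pL: "obs_sum M f U (\<lambda>\<omega>. (pL n i t \<omega>, S (t + 2 ^ n) \<omega>)) = obs_sum M f U (pQs n i t)"
  by (rule obs_sum_same_partition) (auto simp: same_partition_def pQs_def)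

lemma obs_sum_pR: "obs_sum M f U (\<lambda>\<omega>. (pR n i t \<omega>, S t \<omega>)) = obs_sum M f U (pQs n i t)"
  by (rule obs_sum_same_partition) (auto simp: same_partition_def pQs_def)

text \<open>Given the middle state the two halves contribute additively; the joined block forgets
  that state, which can only raise the entropy.\<close>

lemma Hs_children: "2 * Hs n i \<le> Hs (Suc n) (2 * i) + Hs (Suc n) (Suc (2 * i))"
proof -
  let ?b = "2 ^ n :: int"
  let ?E = "\<lambda>\<omega>. (S 0 \<omega>, S (2 ^ Suc n) \<omega>)"
  have E: "simple_function M ?E" by auto
  have Hs: "Hs (Suc n) j = Hpar M (pU (Suc n) j 0) (\<lambda>\<omega>. (pQ (Suc n) j 0 \<omega>, ?E \<omega>))" for j
    unfolding Hs_def pQs_def by simp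
  have "2 * Hs n i = cond_ent M (pU n i 0) (\<lambda>\<omega>. (pL n i 0 \<omega>, S ?b \<omega>))
      + cond_ent M (pU n i ?b) (\<lambda>\<omega>. (pR n i ?b \<omega>, S ?b \<omega>))"
    using obs_sum_pL[of hent "pU n i 0" n i 0] obs_sum_pR[of hent "pU n i ?b" n i ?b]
    by (simp add: cond_ent_eq_Hpar shift_polar)
  also have "\<dots> = cond_ent M (\<lambda>\<omega>. (pU n i 0 \<omega>, pU n i ?b \<omega>)) (\<lambda>\<omega>. ((pL n i 0 \<omega>, pR n i ?b \<omega>), S ?b \<omega>))"
    by (rule cond_ent_markov[OF block_fun_pU block_fun_pL block_fun_pU block_fun_pR, symmetric]) simp
  also have "\<dots> \<le> cond_ent M (\<lambda>\<omega>. (pU n i 0 \<omega>, pU n i ?b \<omega>)) (\<lambda>\<omega>. (pL n i 0 \<omega>, pR n i ?b \<omega>))"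
    by (rule cond_ent_refine) auto
  also have "\<dots> = cond_ent M (\<lambda>\<omega>. (pU n i 0 \<omega>, pU n i ?b \<omega>)) (\<lambda>\<omega>. ((pQ n i 0 \<omega>, pQ n i ?b \<omega>), ?E \<omega>))"
    by (rule cond_ent_same_partition) (simp only: same_partition_def prod.inject two_power_add, blast)+
  also have "\<dots> = Hs (Suc n) (2 * i) + Hs (Suc n) (Suc (2 * i))"
    using chain_children[OF E, of n i 0] unfolding Hs by simp
  finally show ?thesis .
qed

section \<open>One-step bounds for \<open>Z\<close> and \<open>K\<close>, and the minus-minus
  gain\<close>

lemma pU_even: "pU (Suc n) (2 * i) t = (\<lambda>\<omega>. pU n i t \<omega> \<noteq> pU n i (t + 2 ^ n) \<omega>)"
  by (auto simp: fun_eq_iff)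

lemma pU_odd: "pU (Suc n) (Suc (2 * i)) t = pU n i (t + 2 ^ n)"
  by (auto simp: fun_eq_iff)

lemma Zn_minus: "Zn (Suc n) (2 * i) \<le> 2 * \<kappa> * Zn n i"
proof -
  have "Zn (Suc n) (2 * i) = Zpar M (\<lambda>\<omega>. pU n i 0 \<omega> \<noteq> pU n i (2 ^ n) \<omega>) (\<lambda>\<omega>. (pQ n i 0 \<omega>, pQ n i (2
      ^ n) \<omega>))"
    unfolding Zn_def pU_even add_0
    by (rule obs_sum_same_partition) (simp only: same_partition_def pQ_double prod.inject add_0, blast)
  also have "\<dots> \<le> \<kappa> * (Zpar M (pU n i 0) (pQ n i 0) + Zpar M (pU n i (2 ^ n)) (pQ n i (2 ^ n)))"
    by (rule Zpar_minus_le[OF block_fun_pU block_fun_pQ block_fun_pU block_fun_pQ]) simp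
  finally show ?thesis by (simp add: shift_polar)
qed

lemma Zn_plus: "Zn (Suc n) (Suc (2 * i)) \<le> \<kappa> * (Zn n i)\<^sup>2"
proof -
  have "Zn (Suc n) (Suc (2 * i)) = Zpar M (pU n i (2 ^ n))
      (\<lambda>\<omega>. ((pQ n i 0 \<omega>, pQ n i (2 ^ n) \<omega>), pU n i 0 \<omega> \<noteq> pU n i (2 ^ n) \<omega>))"
    unfolding Zn_def pU_odd add_0
    by (rule obs_sum_same_partition) (simp only: same_partition_def pQ_Suc pQ_double pU_even
        prod.inject add_0, blast)
  also have "\<dots> \<le> \<kappa> * (Zpar M (pU n i 0) (pQ n i 0) * Zpar M (pU n i (2 ^ n)) (pQ n i (2 ^ n)))"
    by (rule Zpar_plus_le[OF block_fun_pU block_fun_pQ block_fun_pU block_fun_pQ]) simp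
  finally show ?thesis by (simp add: shift_polar power2_eq_square)
qed

lemma pQs_double: "pQs (Suc n) (2 * i) 0 \<omega> = pQs (Suc n) (2 * i) 0 \<omega>' \<longleftrightarrow>
    pL n i 0 \<omega> = pL n i 0 \<omega>' \<and> pR n i (2 ^ n) \<omega> = pR n i (2 ^ n) \<omega>'"
  unfolding pQs_def prod.inject two_power_add pQ_double add_0 by blast

lemma pQs_Suc: "pQs n (Suc i) t \<omega> = pQs n (Suc i) t \<omega>' \<longleftrightarrow>
    pU n i t \<omega> = pU n i t \<omega>' \<and> pQs n i t \<omega> = pQs n i t \<omega>'"
  by (auto simp: pQs_def pQ_Suc)

lemma Ks_eq:
  "Kpar M (pU n i 0) (\<lambda>\<omega>. (pL n i 0 \<omega>, S (2 ^ n) \<omega>)) = Ks n i"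
  "Kpar M (pU n i (2 ^ n)) (\<lambda>\<omega>. (pR n i (2 ^ n) \<omega>, S (2 ^ n) \<omega>)) = Ks n i"
  using obs_sum_pL[of _ "pU n i 0" n i 0] obs_sum_pR[of _ "pU n i (2 ^ n)" n i "2 ^ n"]
  by (simp_all add: shift_polar)

text \<open>The joined block does not see the middle state; revealing it only raises
  \<open>K\<close> and makes the halves independent.\<close>

lemma Ks_minus: "Ks (Suc n) (2 * i) \<le> \<kappa> * (Ks n i)\<^sup>2"
proof -
  have "Ks (Suc n) (2 * i) = Kpar M (\<lambda>\<omega>. pU n i 0 \<omega> \<noteq> pU n i (2 ^ n) \<omega>) (\<lambda>\<omega>. (pL n i 0 \<omega>, pR n i (2
      ^ n) \<omega>))"
    unfolding Ks_def pU_even add_0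
    by (rule obs_sum_same_partition) (simp only: same_partition_def pQs_double prod.inject add_0, blast)
  also have "\<dots> \<le> Kpar M (\<lambda>\<omega>. pU n i 0 \<omega> \<noteq> pU n i (2 ^ n) \<omega>) (\<lambda>\<omega>. ((pL n i 0 \<omega>, pR n i (2 ^ n) \<omega>), S
      (2 ^ n) \<omega>))"
    by (rule Kpar_refine) (auto intro: simple_function_compose2)
  also have "\<dots> \<le> \<kappa> * (Kpar M (pU n i 0) (\<lambda>\<omega>. (pL n i 0 \<omega>, S (2 ^ n) \<omega>))
      * Kpar M (pU n i (2 ^ n)) (\<lambda>\<omega>. (pR n i (2 ^ n) \<omega>, S (2 ^ n) \<omega>)))"
    by (rule Kpar_minus_le[OF block_fun_pU block_fun_pL block_fun_pU block_fun_pR]) simp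
  also have "\<dots> = \<kappa> * (Ks n i * Ks n i)" unfolding Ks_eq ..
  finally show ?thesis by (simp add: power2_eq_square)
qed

lemma Ks_plus: "Ks (Suc n) (Suc (2 * i)) \<le> 2 * Ks n i"
proof -
  have simple_xor: "simple_function M (\<lambda>\<omega>. pU n i 0 \<omega> \<noteq> pU n i (2 ^ n) \<omega>)"
    using polar_simple(1)[of "Suc n" "2 * i" 0] unfolding pU_even add_0 .
  have "Ks (Suc n) (Suc (2 * i)) = Kpar M (pU n i (2 ^ n))
      (\<lambda>\<omega>. ((pL n i 0 \<omega>, pR n i (2 ^ n) \<omega>), pU n i 0 \<omega> \<noteq> pU n i (2 ^ n) \<omega>))"
    unfolding Ks_def pU_odd add_0
    by (rule obs_sum_same_partition)
      (simp only: same_partition_def pQs_Suc pQs_double pU_even prod.inject add_0, blast)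
  also have "\<dots> \<le> Kpar M (pU n i (2 ^ n))
      (\<lambda>\<omega>. (((pL n i 0 \<omega>, pR n i (2 ^ n) \<omega>), pU n i 0 \<omega> \<noteq> pU n i (2 ^ n) \<omega>), S (2 ^ n) \<omega>))"
    using simple_xor by (intro Kpar_refine) auto
  also have "\<dots> = Kpar M (pU n i (2 ^ n))
      (\<lambda>\<omega>. (((pL n i 0 \<omega>, pR n i (2 ^ n) \<omega>), S (2 ^ n) \<omega>), pU n i 0 \<omega> \<noteq> pU n i (2 ^ n) \<omega>))"
    by (rule obs_sum_same_partition) (auto simp: same_partition_def)
  also have "\<dots> \<le> Kpar M (pU n i 0) (\<lambda>\<omega>. (pL n i 0 \<omega>, S (2 ^ n) \<omega>))
      + Kpar M (pU n i (2 ^ n)) (\<lambda>\<omega>. (pR n i (2 ^ n) \<omega>, S (2 ^ n) \<omega>))"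
    by (rule Kpar_plus_le[OF block_fun_pU block_fun_pL block_fun_pU block_fun_pR]) simp
  also have "\<dots> = Ks n i + Ks n i" unfolding Ks_eq ..
  finally show ?thesis by simp
qed

text \<open>The minus-minus bit is the sum of the bits of four consecutive blocks. Revealing the two
  middle blocks and the states around them leaves the sum of the outer bits, up to a known bit, and
  only lowers the entropy.\<close>

lemma Hs_minus_minus:
  assumes c: "0 \<le> c" "\<And>s s'. c * \<pi> s * \<pi> s' \<le> trans_joint (2 * 2 ^ n) s s'"
  shows "Hs n i + c * (1 - Ks n i) * (1 - Hs n i) \<le> Hs (Suc (Suc n)) (2 * (2 * i))"
proof -
  let ?b = "2 ^ n :: int"
  let ?b' = "?b + 2 * ?b"
  let ?W = "\<lambda>b \<omega>. (pU n i b \<omega>, pQ n i b \<omega>, pU n i (b + ?b) \<omega>, pQ n i (b + ?b) \<omega>)"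
  let ?O = "\<lambda>\<omega>. ((pL n i 0 \<omega>, pR n i ?b' \<omega>), (?W ?b \<omega>, (S ?b \<omega>, S ?b' \<omega>)))"
  have pow: "0 + ?b = ?b" "?b + ?b = 2 * ?b" "2 ^ Suc n = 2 * ?b" "2 * ?b + ?b
      = ?b'" "2 ^ Suc (Suc n) = ?b' + ?b"
    by auto
  have W: "block_fun (2 * 2 ^ n) ?W"
  proof -
    have dU: "block_fun (2 * 2 ^ n) (\<lambda>t. V (t + 2 ^ n))" if "block_fun (2 ^ n) V" for V :: "int \<Rightarrow> 'w
        \<Rightarrow> bool"
      using block_fun_delay[OF that, of "2 ^ n"] by (simp add: mult_2)
    have dQ: "block_fun (2 * 2 ^ n) (\<lambda>t. V (t + 2 ^ n))" if "block_fun (2 ^ n) V" for V :: "int \<Rightarrow> 'w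
        \<Rightarrow> bool list \<times> 'y list"
      using block_fun_delay[OF that, of "2 ^ n"] by (simp add: mult_2)
    show ?thesis
      by (intro block_fun_Pair dU[OF block_fun_pU] dQ[OF block_fun_pQ]
          block_fun_mono[OF block_fun_pU] block_fun_mono[OF block_fun_pQ]) auto
  qed
  have "Hs n i + c * (1 - Ks n i) * (1 - Hs n i) \<le> Hpar M (\<lambda>\<omega>. pU n i 0 \<omega> \<noteq> pU n i ?b' \<omega>) ?O"
  proof -
    have 1: "Hs n i = Hpar M (pU n i 0) (\<lambda>\<omega>. (pL n i 0 \<omega>, S ?b \<omega>))"
      using obs_sum_pL[of hent "pU n i 0" n i 0] by (simp add: shift_polar)
    have 2: "Ks n i = Kpar M (pU n i ?b') (\<lambda>\<omega>. (pR n i ?b' \<omega>, S ?b' \<omega>))"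
      unfolding obs_sum_pR by (simp only: shift_polar)
    show ?thesis unfolding 1 2
      by (rule Hpar_convolution_ge[OF block_fun_pU block_fun_pL W block_fun_pU block_fun_pR _ _ c]) auto
  qed
  also have "\<dots> = Hpar M (pU (Suc (Suc n)) (2 * (2 * i)) 0) ?O"
  \<comment> \<open>\<open>g\<close> reads the sum of the two middle bits off the
    observation.\<close>
  proof (rule obs_sum_xor[where g = "\<lambda>(_, (u, _, v, _), _). u \<noteq> v"])
    fix \<omega>
    have "pU (Suc (Suc n)) (2 * (2 * i)) 0 \<omega> \<longleftrightarrow>
        (pU n i 0 \<omega> \<noteq> pU n i ?b \<omega>) \<noteq> (pU n i (?b + ?b) \<omega> \<noteq> pU n i ?b' \<omega>)"
      unfolding pU_even by simp
    then show "(pU n i 0 \<omega> \<noteq> pU n i ?b' \<omega>) \<longleftrightarrow> pU (Suc (Suc n)) (2 * (2 * i)) 0 \<omega> \<noteq>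
      (\<lambda>(_, (u, _, v, _), _). u \<noteq> v) (?O \<omega>)"
      unfolding split_conv by blast
  qed (rule hent_commute)
  also have "\<dots> \<le> Hs (Suc (Suc n)) (2 * (2 * i))"
  proof -
    have O: "simple_function M ?O" by auto
    have "Hpar M (pU (Suc (Suc n)) (2 * (2 * i)) 0) ?O
       = Hpar M (pU (Suc (Suc n)) (2 * (2 * i)) 0) (\<lambda>\<omega>. (pQs (Suc (Suc n)) (2 * (2 * i)) 0 \<omega>, ?O \<omega>))"
      by (rule obs_sum_same_partition)
        (simp only: same_partition_def pQs_def pQ_double prod.inject pow add_0 add.assoc, blast)
    also have "\<dots> \<le> Hs (Suc (Suc n)) (2 * (2 * i))"
      unfolding Hs_def by (intro Hpar_refine O polar_simple)
    finally show ?thesis .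
  qed
  finally show ?thesis .
qed

section \<open>Block entropies and the entropy rate\<close>

definition block_ent :: "nat \<Rightarrow> real" where
  "block_ent N = cond_ent M (XB N 0) (YB N 0)"

definition block_ent_states :: "nat \<Rightarrow> real" where
  "block_ent_states N = cond_ent M (XB N 0) (\<lambda>\<omega>. (YB N 0 \<omega>, S 0 \<omega>, S (int N) \<omega>))"

lemma sum_Hn: "(\<Sum>i<2 ^ n. Hn n i) = block_ent (2 ^ n)"
proof -
  have "(\<Sum>i<2 ^ n. Hn n i) = cond_ent M (XB (2 ^ n) 0) (\<lambda>\<omega>. (YB (2 ^ n) 0 \<omega>, ()))"
    unfolding Hn_def using chain_total[of "\<lambda>_. ()" n 0] unfolding obs_sum_unit[symmetric] by simp
  also have "\<dots> = block_ent (2 ^ n)"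
    unfolding block_ent_def by (rule cond_ent_same_partition) (auto simp: same_partition_def)
  finally show ?thesis .
qed

lemma sum_Hs: "(\<Sum>i<2 ^ n. Hs n i) = block_ent_states (2 ^ n)"
  using chain_total[of "\<lambda>\<omega>. (S 0 \<omega>, S (2 ^ n) \<omega>)" n 0]
  by (simp add: Hs_def pQs_def[abs_def] block_ent_states_def)

lemma block_ent_states_le: "block_ent_states N \<le> block_ent N"
  unfolding block_ent_states_def block_ent_def by (rule cond_ent_refine) auto

lemma ent_S: "ent M (S t) = ent M (S 0)"
  by (rule ent_shift[OF block_fun_S0])

lemma block_ent_le: "block_ent N \<le> block_ent_states N + 2 * ent M (S 0)"
proof -
  have "block_ent N \<le> cond_ent M (XB N 0) (\<lambda>\<omega>. (YB N 0 \<omega>, S 0 \<omega>)) + ent M (S 0)"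
    unfolding block_ent_def by (rule cond_ent_le_cent_cond) auto
  also have "cond_ent M (XB N 0) (\<lambda>\<omega>. (YB N 0 \<omega>, S 0 \<omega>))
      \<le> cond_ent M (XB N 0) (\<lambda>\<omega>. ((YB N 0 \<omega>, S 0 \<omega>), S (int N) \<omega>)) + ent M (S (int N))"
    by (rule cond_ent_le_cent_cond) auto
  also have "cond_ent M (XB N 0) (\<lambda>\<omega>. ((YB N 0 \<omega>, S 0 \<omega>), S (int N) \<omega>)) = block_ent_states N"
    unfolding block_ent_states_def by (rule cond_ent_same_partition) (simp only: same_partition_def
        prod.inject, blast)+
  finally show ?thesis using ent_S[of "int N"] by simp
qed

lemma cond_ent_shift:
  assumes "block_fun m A" "block_fun m B"
  shows "cond_ent M (A t) (B t) = cond_ent M (A 0) (B 0)"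
  unfolding cond_ent_def using ent_shift[OF block_fun_Pair[OF assms], of t] ent_shift[OF assms(2),
      of t] by simp

lemma block_ent_add_le: "block_ent (m + n) \<le> block_ent m + block_ent n"
proof -
  have "block_ent (m + n) = cond_ent M (\<lambda>\<omega>. (XB m 0 \<omega>, XB n (int m) \<omega>)) (\<lambda>\<omega>. (YB m 0 \<omega>, YB n (int m) \<omega>))"
    unfolding block_ent_def by (rule cond_ent_same_partition) (auto simp: same_partition_def XB_add
        YB_add)
  also have "\<dots> \<le> cond_ent M (XB m 0) (YB m 0) + cond_ent M (XB n (int m)) (YB n (int m))"
    by (rule cond_ent_Pair_le) auto
  also have "\<dots> = block_ent m + block_ent n"
    unfolding block_ent_def using cond_ent_shift[OF block_fun_XB block_fun_YB, of n "int m"] by simp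
  finally show ?thesis .
qed

text \<open>Additivity holds with the state between the blocks revealed; forgetting it only raises
  the entropy.\<close>

lemma block_ent_states_add_ge: "block_ent_states m + block_ent_states n \<le> block_ent_states (m + n)"
proof -
  let ?b = "int m"
  have "block_ent_states m = cond_ent M (XB m 0) (\<lambda>\<omega>. ((YB m 0 \<omega>, S 0 \<omega>), S ?b \<omega>))"
    unfolding block_ent_states_def by (rule cond_ent_same_partition) (auto simp: same_partition_def)
  moreover have "block_ent_states n = cond_ent M (XB n ?b) (\<lambda>\<omega>. ((YB n ?b \<omega>, S (?b + int n) \<omega>), S ?b \<omega>))"
  proof -
    have "block_ent_states n = cond_ent M (XB n ?b) (\<lambda>\<omega>. (YB n ?b \<omega>, S ?b \<omega>, S (?b + int n) \<omega>))"
      unfolding block_ent_states_def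
      using cond_ent_shift[OF block_fun_XB block_fun_Pair[OF block_fun_YB block_fun_Pair[OF
          block_fun_S0 block_fun_S[of n n]]], of ?b]
      by simp
    also have "\<dots> = cond_ent M (XB n ?b) (\<lambda>\<omega>. ((YB n ?b \<omega>, S (?b + int n) \<omega>), S ?b \<omega>))"
      by (rule cond_ent_same_partition) (auto simp: same_partition_def)
    finally show ?thesis .
  qed
  ultimately have "block_ent_states m + block_ent_states n
      = cond_ent M (\<lambda>\<omega>. (XB m 0 \<omega>, XB n ?b \<omega>)) (\<lambda>\<omega>. (((YB m 0 \<omega>, S 0 \<omega>), (YB n ?b \<omega>, S (?b
          + int n) \<omega>)), S ?b \<omega>))"
    using cond_ent_markov[OF block_fun_XB block_fun_Pair[OF block_fun_YB block_fun_S0] block_fun_XB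
        block_fun_Pair[OF block_fun_YB block_fun_S[of n n]], of ?b 0 m] by simp
  also have "\<dots> \<le> cond_ent M (\<lambda>\<omega>. (XB m 0 \<omega>, XB n ?b \<omega>)) (\<lambda>\<omega>. ((YB m 0 \<omega>, S 0 \<omega>), (YB n ?b \<omega>, S (?b
      + int n) \<omega>)))"
    by (rule cond_ent_refine) auto
  also have "\<dots> = block_ent_states (m + n)"
    unfolding block_ent_states_def
    by (rule cond_ent_same_partition) (auto simp: same_partition_def XB_add YB_add)
  finally show ?thesis .
qed

text \<open>Subadditivity of \<open>block_ent\<close> and superadditivity up to a constant give
  \<open>\<bar>a\<^sub>m / m - a\<^sub>n / n\<bar> \<le> c / m + c / n\<close> by comparison with the block length \<open>m * n\<close>.\<close>

lemma block_ent_convergent: "convergent (\<lambda>N. block_ent N / real N)"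
proof -
  \<comment> \<open>Passing between \<open>block_ent\<close> and \<open>block_ent_states\<close>
    costs \<open>2 * ent M (S 0)\<close> for each of the two summands.\<close>
  define c where "c = 2 * (2 * ent M (S 0))"
  have c0: "0 \<le> ent M (S 0)"
    using block_ent_le[of 1] block_ent_states_le[of 1] by linarith
  have add: "\<bar>block_ent (m + n) - block_ent m - block_ent n\<bar> \<le> c" for m n
    using block_ent_add_le[of m n] block_ent_states_add_ge[of m n] block_ent_states_le[of "m + n"]
      block_ent_le[of m] block_ent_le[of n] c0 by (simp add: c_def)
  have mult: "\<bar>block_ent (Suc k * m) - real (Suc k) * block_ent m\<bar> \<le> real k * c" for k m
  proof (induction k)
    case (Suc k)
    have "block_ent (Suc (Suc k) * m) = block_ent (m + Suc k * m)" by simp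
    then show ?case using Suc add[of m "Suc k * m"] by (simp add: algebra_simps)
  qed simp
  have near: "\<bar>block_ent (k * m) / real (k * m) - block_ent m / real m\<bar>
      \<le> c / real m" if "k > 0" "m > 0" for k m
  proof -
    obtain j where j: "k = Suc j" using \<open>k > 0\<close> gr0_implies_Suc by blast
    have "block_ent (k * m) / real (k * m) - block_ent m / real m
        = (block_ent (k * m) - real k * block_ent m) / real (k * m)"
      using that by (simp add: field_simps)
    also have "\<bar>\<dots>\<bar> \<le> real k * c / real (k * m)"
    proof -
      have "\<bar>block_ent (k * m) - real k * block_ent m\<bar> \<le> real k * c"
        using mult[of j m] c0 unfolding j by (simp add: c_def algebra_simps)
      then show ?thesis unfolding abs_divide abs_of_nat by (rule divide_right_mono) simp
    qed
    also have "\<dots> = c / real m" using that by simp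
    finally show ?thesis .
  qed
  have diff: "\<bar>block_ent k / real k - block_ent m / real m\<bar>
      \<le> c / real k + c / real m" if "k > 0" "m > 0" for k m
    using near[OF that] near[OF that(2,1)] by (simp add: mult.commute)
  have "Cauchy (\<lambda>N. block_ent N / real N)"
  proof (rule metric_CauchyI)
    fix e :: real assume e: "0 < e"
    obtain N where N: "2 * c / e < real N" using reals_Archimedean2 by blast
    have "dist (block_ent k / real k) (block_ent m / real m) < e" if "k \<ge> Suc N" "m \<ge> Suc N" for k m
    proof -
      have "c / real j < e / 2" if "j \<ge> Suc N" for j
      proof -
        have "2 * c / e < real j" using N that by linarith
        then show ?thesis using e that by (simp add: field_simps)
      qed
      moreover have "\<bar>block_ent k / real k - block_ent m / real m\<bar> \<le> c / real k + c / real m"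
        using that by (intro diff) auto
      ultimately show ?thesis unfolding dist_real_def using that by (smt (verit) field_sum_of_halves)
    qed
    then show "\<exists>N. \<forall>k\<ge>N. \<forall>m\<ge>N. dist (block_ent k / real k) (block_ent m / real m) < e" by blast
  qed
  then show ?thesis by (simp add: Cauchy_convergent_iff)
qed

end

section \<open>Processes on the binary tree\<close>

text \<open>Expectation over a uniform node of level \<open>n\<close>. The ancestor of node
  \<open>i\<close> at level \<open>m\<close> is \<open>i div 2 ^ (n - m)\<close>, so martingale
  arguments become finite sums.\<close>

definition avg :: "nat \<Rightarrow> (nat \<Rightarrow> real) \<Rightarrow> real" where
  "avg n g = (\<Sum>i<2 ^ n. g i) / 2 ^ n"

abbreviation frac_of :: "nat \<Rightarrow> (nat \<Rightarrow> bool) \<Rightarrow> real" where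
  "frac_of n P \<equiv> avg n (\<lambda>i. of_bool (P i))"

lemma frac_of_card: "frac_of n P = real (card {i. i < 2 ^ n \<and> P i}) / 2 ^ n"
proof -
  have "(\<Sum>i<2 ^ n. of_bool (P i) :: real) = real (card {i. i < 2 ^ n \<and> P i})"
    by (simp add: of_bool_def sum.If_cases Int_def lessThan_def)
  then show ?thesis by (simp add: avg_def)
qed

lemma sum_lessThan_double:
  fixes g :: "nat \<Rightarrow> real"
  shows "(\<Sum>i<2 * m. g i) = (\<Sum>i<m. g (2 * i) + g (Suc (2 * i)))"
  by (induction m) auto

lemma avg_Suc: "avg (Suc n) g = avg n (\<lambda>i. (g (2 * i) + g (Suc (2 * i))) / 2)"
  unfolding avg_def power_Suc sum_lessThan_double by (simp add: sum_divide_distrib[symmetric])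

lemma avg_mono: "(\<And>i. i < 2 ^ n \<Longrightarrow> f i \<le> g i) \<Longrightarrow> avg n f \<le> avg n g"
  unfolding avg_def by (intro divide_right_mono sum_mono) auto

lemma avg_add: "avg n (\<lambda>i. f i + g i) = avg n f + avg n g"
  by (simp add: avg_def sum.distrib add_divide_distrib)

lemma avg_diff: "avg n (\<lambda>i. f i - g i) = avg n f - avg n g"
  by (simp add: avg_def sum_subtractf diff_divide_distrib)

lemma avg_cmult: "avg n (\<lambda>i. c * g i) = c * avg n g"
  by (simp add: avg_def sum_distrib_left[symmetric])

lemma avg_const [simp]: "avg n (\<lambda>_. c) = c"
  by (simp add: avg_def)

lemma avg_nonneg: "(\<And>i. i < 2 ^ n \<Longrightarrow> 0 \<le> g i) \<Longrightarrow> 0 \<le> avg n g"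
  using avg_mono[of n "\<lambda>_. 0" g] by simp

lemma avg_ancestor:
  assumes "m \<le> n"
  shows "avg n (\<lambda>i. g (i div 2 ^ (n - m))) = avg m g"
  using assms
proof (induction n rule: dec_induct)
  case (step n)
  have "(2 * i) div 2 ^ (Suc n - m) = i div 2 ^ (n - m)" "Suc (2 * i) div 2 ^ (Suc n - m)
      = i div 2 ^ (n - m)" for i :: nat
    using step by (simp_all add: Suc_diff_le div_mult2_eq)
  then show ?case unfolding avg_Suc using step by simp
qed simp

lemma child_ancestor:
  assumes "j \<le> n" "c div 2 = i"
  shows "c div 2 ^ (Suc n - j) = (i :: nat) div 2 ^ (n - j)"
  using assms by (auto simp: Suc_diff_le div_mult2_eq)

section \<open>Supermartingale and second moment arguments on the tree\<close>

text \<open>Doob's argument, restricted to paths through nodes of level \<open>m\<close> with value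
  at most \<open>\<delta>\<close>.\<close>

theorem maximal_inequality:
  fixes G :: "nat \<Rightarrow> nat \<Rightarrow> real"
  assumes nonneg: "\<And>n i. 0 \<le> G n i"
    and super: "\<And>n i. G (Suc n) (2 * i) + G (Suc n) (Suc (2 * i)) \<le> 2 * G n i"
    and "0 < \<epsilon>" "0 \<le> \<delta>" "m \<le> n"
  shows "frac_of n (\<lambda>i. G m (i div 2 ^ (n - m)) \<le> \<delta> \<and> (\<exists>j\<in>{m..n}. \<epsilon> < G j (i div 2 ^ (n - j)))) \<le> \<delta> / \<epsilon>"
proof -
  define hit where "hit n i \<longleftrightarrow> (\<exists>j\<in>{m..n}. \<epsilon> < G j (i div 2 ^ (n - j)))" for n i
  \<comment> \<open>The process stopped at its first value above \<open>\<epsilon>\<close> and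
    frozen there at \<open>\<epsilon>\<close>; lowering the value at the hitting time preserves the
    supermartingale inequality.\<close>
  define V where "V n i = (if G m (i div 2 ^ (n - m))
      \<le> \<delta> then if hit n i then \<epsilon> else G n i else 0)" for n i
  have "avg n (V n) \<le> \<delta>" using \<open>m \<le> n\<close>
  proof (induction n rule: dec_induct)
    case base
    have "V m i \<le> \<delta>" for i using \<open>0 \<le> \<delta>\<close> by (auto simp: V_def hit_def)
    then show ?case using avg_mono[of m "V m" "\<lambda>_. \<delta>"] by simp
  next
    case (step n)
    have hit: "hit (Suc n) c \<longleftrightarrow> hit n i \<or> \<epsilon> < G (Suc n) c" if "c div 2 = i" for c i
    proof -
      have "{m..Suc n} = insert (Suc n) {m..n}" using step by auto
      then show ?thesis using child_ancestor[OF _ that] by (auto simp: hit_def)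
    qed
    have "avg (Suc n) (V (Suc n)) \<le> avg n (V n)"
      unfolding avg_Suc
    proof (rule avg_mono)
      fix i :: nat
      have c: "V (Suc n) c \<le> (if G m (i div 2 ^ (n - m))
          \<le> \<delta> then if hit n i then \<epsilon> else G (Suc n) c else 0)"
        if "c div 2 = i" for c
        using that hit[OF that] child_ancestor[OF step(1) that] by (auto simp: V_def)
      show "(V (Suc n) (2 * i) + V (Suc n) (Suc (2 * i))) / 2 \<le> V n i"
        using c[of "2 * i"] c[of "Suc (2 * i)"] super[of n i] by (auto simp: V_def split: if_splits)
    qed
    then show ?case using step by simp
  qed
  moreover have "\<epsilon> * frac_of n (\<lambda>i. G m (i div 2 ^ (n - m)) \<le> \<delta> \<and> hit n i) \<le> avg n (V n)"
    unfolding avg_cmult[symmetric] by (rule avg_mono) (use nonneg in \<open>auto simp: V_def\<close>)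
  ultimately have "\<epsilon> * frac_of n (\<lambda>i. G m (i div 2 ^ (n - m)) \<le> \<delta> \<and> hit n i) \<le> \<delta>" by simp
  then show ?thesis using \<open>0 < \<epsilon>\<close> unfolding hit_def by (simp add: field_simps)
qed

corollary stays_small:
  fixes G :: "nat \<Rightarrow> nat \<Rightarrow> real"
  assumes nonneg: "\<And>n i. 0 \<le> G n i"
    and super: "\<And>n i. G (Suc n) (2 * i) + G (Suc n) (Suc (2 * i)) \<le> 2 * G n i"
    and pos: "0 < \<epsilon>" "0 \<le> \<delta>" "m \<le> n"
  shows "frac_of m (\<lambda>i. G m i \<le> \<delta>) - \<delta> / \<epsilon> \<le> frac_of n (\<lambda>i. \<forall>j\<in>{m..n}. G j (i div 2 ^ (n - j)) \<le> \<epsilon>)"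
proof -
  have "frac_of m (\<lambda>i. G m i \<le> \<delta>) = frac_of n (\<lambda>i. G m (i div 2 ^ (n - m)) \<le> \<delta>)"
    by (rule avg_ancestor[symmetric, OF pos(3)])
  also have "\<dots> \<le> avg n (\<lambda>i. of_bool (\<forall>j\<in>{m..n}. G j (i div 2 ^ (n - j)) \<le> \<epsilon>)
      + of_bool (G m (i div 2 ^ (n - m)) \<le> \<delta> \<and> (\<exists>j\<in>{m..n}. \<epsilon> < G j (i div 2 ^ (n - j)))))"
    by (rule avg_mono) (auto simp: not_le)
  also have "\<dots> \<le> frac_of n (\<lambda>i. \<forall>j\<in>{m..n}. G j (i div 2 ^ (n - j)) \<le> \<epsilon>) + \<delta> / \<epsilon>"
    unfolding avg_add using maximal_inequality[where G = G, OF assms] by simp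
  finally show ?thesis by simp
qed

text \<open>The second moments \<open>avg n (h n)\<^sup>2\<close> of a bounded submartingale converge, so on average its
  increments over two levels tend to \<open>0\<close>; they are bounded below away from \<open>{0, 1}\<close>.\<close>

theorem polarization_in_probability:
  fixes h :: "nat \<Rightarrow> nat \<Rightarrow> real"
  assumes bounds: "\<And>n i. 0 \<le> h n i" "\<And>n i. h n i \<le> 1"
    and sub: "\<And>n i. 2 * h n i \<le> h (Suc n) (2 * i) + h (Suc n) (Suc (2 * i))"
    and incr: "\<And>n i. base \<le> n \<Longrightarrow> h n i + c * (h n i)\<^sup>2 * (1 - h n i) \<le> h (Suc (Suc n)) (2 * (2 * i))"
    and "0 < c" "0 < \<epsilon>"
  shows "(\<lambda>n. frac_of n (\<lambda>i. \<epsilon> < h n i \<and> h n i < 1 - \<epsilon>)) \<longlonglongrightarrow> 0"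
proof -
  define s where "s n = avg n (\<lambda>i. (h n i)\<^sup>2)" for n
  have "s n \<le> s (Suc n)" for n
    unfolding s_def avg_Suc
  proof (rule avg_mono)
    fix i
    let ?x = "h n i" and ?a = "h (Suc n) (2 * i)" and ?b = "h (Suc n) (Suc (2 * i))"
    \<comment> \<open>The second moment grows by the squared deviations of the children plus a drift
      term, nonnegative for a nonnegative submartingale.\<close>
    have "?a\<^sup>2 + ?b\<^sup>2 - 2 * ?x\<^sup>2 = (?a - ?x)\<^sup>2 + (?b - ?x)\<^sup>2 + 2 * ?x * (?a + ?b - 2 * ?x)"
      by (simp add: power2_eq_square algebra_simps)
    moreover have "0 \<le> 2 * ?x * (?a + ?b - 2 * ?x)"
      using bounds(1)[of n i] sub[of n i] by (intro mult_nonneg_nonneg) auto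
    ultimately have "2 * ?x\<^sup>2 \<le> ?a\<^sup>2 + ?b\<^sup>2"
      using zero_le_power2[of "?a - ?x"] zero_le_power2[of "?b - ?x"] by linarith
    then show "?x\<^sup>2 \<le> (?a\<^sup>2 + ?b\<^sup>2) / 2" by simp
  qed
  then have "incseq s" by (rule incseq_SucI)
  moreover have "s n \<le> 1" for n
    using avg_mono[of n "\<lambda>i. (h n i)\<^sup>2" "\<lambda>_. 1"] bounds by (simp add: s_def power_le_one)
  ultimately obtain l where l: "s \<longlonglongrightarrow> l" using incseq_convergent by blast
  have "(\<lambda>n. s (n + 2)) \<longlonglongrightarrow> l" by (rule LIMSEQ_ignore_initial_segment[OF l])
  from tendsto_diff[OF this l] have lim: "(\<lambda>n. s (n + 2) - s n) \<longlonglongrightarrow> 0" by simp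
  \<comment> \<open>A node strictly inside contributes the squared gain of one grandchild out of
    four, whence the division by \<open>4\<close>.\<close>
  define r where "r = (c * \<epsilon>\<^sup>2 * \<epsilon>)\<^sup>2 / 4"
  have r: "0 < r" using \<open>0 < c\<close> \<open>0 < \<epsilon>\<close> by (simp add: r_def)
  have average_four: "x + e \<le> ((A + B) / 2 + (C + D) / 2) / 2"
    if "4 * x + z \<le> A + B + (C + D)" "4 * e \<le> z" for x e z A B C D :: real
    using that by (simp add: field_simps)
  have key: "r * frac_of n (\<lambda>i. \<epsilon> < h n i \<and> h n i < 1 - \<epsilon>) \<le> s (n + 2) - s n" if "base \<le> n" for n
  proof -
    have "avg n (\<lambda>i. (h n i)\<^sup>2 + r * of_bool (\<epsilon> < h n i \<and> h n i < 1 - \<epsilon>)) \<le> s (n + 2)"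
      unfolding s_def add_2_eq_Suc' avg_Suc
    proof (rule avg_mono)
      fix i
      let ?x = "h n i"
      let ?a = "h (Suc (Suc n)) (2 * (2 * i))" and ?b = "h (Suc (Suc n)) (Suc (2 * (2 * i)))"
        and ?c = "h (Suc (Suc n)) (2 * Suc (2 * i))" and ?d = "h (Suc (Suc n)) (Suc (2 * Suc (2 * i)))"
      have four: "4 * ?x \<le> ?a + ?b + ?c + ?d"
        using sub[of n i] sub[of "Suc n" "2 * i"] sub[of "Suc n" "Suc (2 * i)"] by linarith
      have "?a\<^sup>2 + ?b\<^sup>2 + (?c\<^sup>2 + ?d\<^sup>2) - 4 * ?x\<^sup>2
        = (?a - ?x)\<^sup>2 + (?b - ?x)\<^sup>2 + (?c - ?x)\<^sup>2 + (?d - ?x)\<^sup>2 + 2 * ?x * (?a + ?b + ?c + ?d - 4 * ?x)"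
        by (simp add: power2_eq_square algebra_simps)
      moreover have "0 \<le> 2 * ?x * (?a + ?b + ?c + ?d - 4 * ?x)"
        using bounds(1)[of n i] four by (intro mult_nonneg_nonneg) auto
      ultimately have 1: "4 * ?x\<^sup>2 + (?a - ?x)\<^sup>2 \<le> ?a\<^sup>2 + ?b\<^sup>2 + (?c\<^sup>2 + ?d\<^sup>2)"
        using zero_le_power2[of "?b - ?x"] zero_le_power2[of "?c - ?x"] zero_le_power2[of "?d - ?x"]
            by linarith
      have 2: "4 * (r * of_bool (\<epsilon> < ?x \<and> ?x < 1 - \<epsilon>)) \<le> (?a - ?x)\<^sup>2"
      proof (cases "\<epsilon> < ?x \<and> ?x < 1 - \<epsilon>")
        case True
        have "c * \<epsilon>\<^sup>2 * \<epsilon> \<le> c * ?x\<^sup>2 * (1 - ?x)"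
          using True \<open>0 < c\<close> \<open>0 < \<epsilon>\<close> by (intro mult_mono power_mono mult_nonneg_nonneg) auto
        also have "\<dots> \<le> ?a - ?x" using incr[OF that, of i] by simp
        finally have "(c * \<epsilon>\<^sup>2 * \<epsilon>)\<^sup>2 \<le> (?a - ?x)\<^sup>2"
          using \<open>0 < c\<close> \<open>0 < \<epsilon>\<close> by (intro power_mono) auto
        then show ?thesis using True by (simp add: r_def)
      next
        case False
        then show ?thesis by auto
      qed
      show "?x\<^sup>2 + r * of_bool (\<epsilon> < ?x \<and> ?x < 1 - \<epsilon>) \<le> ((?a\<^sup>2 + ?b\<^sup>2) / 2 + (?c\<^sup>2 + ?d\<^sup>2) / 2) / 2"
        by (rule average_four[OF 1 2])
    qed
    then show ?thesis unfolding avg_add avg_cmult by (simp add: s_def)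
  qed
  show ?thesis
  proof (rule tendsto_sandwich[OF _ _ tendsto_const])
    show "(\<lambda>n. (s (n + 2) - s n) / r) \<longlonglongrightarrow> 0" using tendsto_divide[OF lim tendsto_const[of r]] r by simp
    show "\<forall>\<^sub>F n in sequentially. frac_of n (\<lambda>i. \<epsilon> < h n i \<and> h n i < 1 - \<epsilon>) \<le> (s (n + 2) - s n) / r"
      using key r by (intro eventually_sequentiallyI[of base]) (simp add: pos_le_divide_eq mult.commute)
  qed (auto intro!: always_eventually avg_nonneg)
qed

section \<open>Squaring steps along a path and fast decay\<close>

text \<open>The lowest bits of a node are its latest transforms, so this counts the squaring steps
  among the last \<open>k\<close>; \<open>d\<close> is the parity that squares.\<close>

fun low_count :: "bool \<Rightarrow> nat \<Rightarrow> nat \<Rightarrow> nat" where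
  "low_count d 0 i = 0"
| "low_count d (Suc k) i = (if odd i = d then 1 else 0) + low_count d k (i div 2)"

text \<open>\<open>k - 2 * low_count d k i\<close> is a simple random walk of \<open>k\<close>
  steps.\<close>

lemma low_count_second_moment:
  "k \<le> n \<Longrightarrow> avg n (\<lambda>i. (real k - 2 * real (low_count d k i))\<^sup>2) = real k"
proof (induction k arbitrary: n)
  case (Suc k)
  then obtain n' where n': "n = Suc n'" "k \<le> n'" by (cases n) auto
  have eq: "((real (Suc k) - 2 * real (low_count d (Suc k) (2 * i)))\<^sup>2
      + (real (Suc k) - 2 * real (low_count d (Suc k) (Suc (2 * i))))\<^sup>2) / 2
      = (real k - 2 * real (low_count d k i))\<^sup>2 + 1" for i
    by (cases d) (simp_all add: power2_eq_square field_simps)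
  show ?case unfolding n'(1) avg_Suc eq avg_add using Suc.IH[OF n'(2)] by simp
qed simp

lemma low_count_Chebyshev:
  assumes "0 < k" "k \<le> n" "0 < \<gamma>"
  shows "frac_of n (\<lambda>i. real (low_count d k i) \<le> (1 / 2 - \<gamma>) * real k) \<le> 1 / (4 * \<gamma>\<^sup>2 * real k)"
proof -
  have "(2 * \<gamma> * real k)\<^sup>2 * frac_of n (\<lambda>i. real (low_count d k i) \<le> (1 / 2 - \<gamma>) * real k)
      \<le> avg n (\<lambda>i. (real k - 2 * real (low_count d k i))\<^sup>2)"
    unfolding avg_cmult[symmetric]
  proof (rule avg_mono)
    fix i
    show "(2 * \<gamma> * real k)\<^sup>2 * of_bool (real (low_count d k i) \<le> (1 / 2 - \<gamma>) * real k)
      \<le> (real k - 2 * real (low_count d k i))\<^sup>2"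
    proof (cases "real (low_count d k i) \<le> (1 / 2 - \<gamma>) * real k")
      case True
      then have "2 * \<gamma> * real k \<le> real k - 2 * real (low_count d k i)" by (simp add: algebra_simps)
      then have "(2 * \<gamma> * real k)\<^sup>2 \<le> (real k - 2 * real (low_count d k i))\<^sup>2"
        using assms by (intro power_mono) auto
      then show ?thesis using True by simp
    qed simp
  qed
  also have "\<dots> = real k" by (rule low_count_second_moment[OF assms(2)])
  finally show ?thesis using assms by (simp add: field_simps power2_eq_square)
qed

text \<open>As long as \<open>T \<le> \<zeta>\<close> along the path, the factor \<open>\<kappa>\<close> costs at most a proportion \<open>\<gamma>\<close> of the
  exponent in each step, while each squaring step doubles it.\<close>

lemma squaring_path_bound:
  fixes T :: "nat \<Rightarrow> nat \<Rightarrow> real"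
  assumes nonneg: "\<And>n i. 0 \<le> T n i"
    and lin: "\<And>n i j. j div 2 = i \<Longrightarrow> T (Suc n) j \<le> \<kappa> * T n i"
    and sq: "\<And>n i j. j div 2 = i \<Longrightarrow> odd j = d \<Longrightarrow> T (Suc n) j \<le> \<kappa> * (T n i)\<^sup>2"
    and \<kappa>: "1 \<le> \<kappa>" and \<gamma>: "0 < \<gamma>" "\<gamma> < 1" and \<zeta>: "0 < \<zeta>" "\<zeta> < 1" "\<kappa> \<le> \<zeta> powr (- \<gamma>)"
    and "m \<le> n" "\<forall>j\<in>{m..n}. T j (i div 2 ^ (n - j)) \<le> \<zeta>"
  shows "T n i \<le> \<zeta> powr ((1 - \<gamma>) ^ (n - m) * 2 ^ low_count d (n - m) i)"
  using assms(10,11)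
proof (induction n arbitrary: i rule: dec_induct)
  case base
  then show ?case using \<zeta> by simp
next
  case (step n)
  define x where "x = (1 - \<gamma>) ^ (n - m) * 2 ^ low_count d (n - m) (i div 2)"
  \<comment> \<open>Since \<open>T \<le> \<zeta>\<close> on the path, the exponent may be taken at
    least \<open>1\<close>; the additive loss \<open>\<gamma>\<close> is then at most the proportion
    \<open>\<gamma>\<close> of it.\<close>
  define y where "y = max 1 x"
  have path: "\<forall>j\<in>{m..n}. T j (i div 2 div 2 ^ (n - j)) \<le> \<zeta>"
  proof
    fix j assume "j \<in> {m..n}"
    then have "j \<in> {m..Suc n}" "j \<le> n" by auto
    then show "T j (i div 2 div 2 ^ (n - j)) \<le> \<zeta>"
      using step.prems child_ancestor[of j n i "i div 2"] by metis
  qed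
  have "T n (i div 2) \<le> \<zeta> powr x" "T n (i div 2) \<le> \<zeta>"
    using step.IH[OF path] bspec[OF path, of n] step.hyps by (auto simp: x_def)
  then have Ty: "T n (i div 2) \<le> \<zeta> powr y" using \<zeta> by (auto simp: y_def max_def)
  have y: "1 \<le> y" "x \<le> y" by (auto simp: y_def)
  have low: "x * (1 - \<gamma>) \<le> y - \<gamma>"
  proof -
    have "x * (1 - \<gamma>) \<le> y * (1 - \<gamma>)" using y \<gamma> by (intro mult_right_mono) auto
    also have "\<dots> \<le> y - \<gamma>" using y \<gamma> by (simp add: algebra_simps)
    finally show ?thesis .
  qed
  have diff: "Suc n - m = Suc (n - m)" using step by simp
  show ?case
  proof (cases "odd i = d")
    case True
    have "T (Suc n) i \<le> \<kappa> * (T n (i div 2))\<^sup>2" by (rule sq[OF refl True])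
    also have "\<dots> \<le> \<zeta> powr (- \<gamma>) * (\<zeta> powr y)\<^sup>2"
      using \<zeta> \<kappa> Ty nonneg by (intro mult_mono power_mono) auto
    also have "\<dots> = \<zeta> powr (2 * y - \<gamma>)"
      using \<zeta> by (simp add: powr_add[symmetric] power2_eq_square algebra_simps)
    also have "\<dots> \<le> \<zeta> powr (2 * (x * (1 - \<gamma>)))"
      using \<zeta> low \<gamma> by (intro powr_mono') auto
    also have "2 * (x * (1 - \<gamma>)) = (1 - \<gamma>) ^ (Suc n - m) * 2 ^ low_count d (Suc n - m) i"
      unfolding diff using True by (simp add: x_def)
    finally show ?thesis .
  next
    case False
    have "T (Suc n) i \<le> \<kappa> * T n (i div 2)" by (rule lin[OF refl])
    also have "\<dots> \<le> \<zeta> powr (- \<gamma>) * \<zeta> powr y"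
      using \<zeta> \<kappa> Ty nonneg by (intro mult_mono) auto
    also have "\<dots> = \<zeta> powr (y - \<gamma>)"
      by (simp add: powr_add[symmetric])
    also have "\<dots> \<le> \<zeta> powr (x * (1 - \<gamma>))"
      using \<zeta> low by (intro powr_mono') auto
    also have "x * (1 - \<gamma>) = (1 - \<gamma>) ^ (Suc n - m) * 2 ^ low_count d (Suc n - m) i"
      unfolding diff using False by (simp add: x_def)
    finally show ?thesis .
  qed
qed

text \<open>After \<open>k\<close> steps with about \<open>k / 2\<close> squarings the exponent is
  about \<open>2 powr (k * (1 / 2 - \<gamma> + log 2 (1 - \<gamma>)))\<close>; as
  \<open>\<gamma>\<close> shrinks, every rate below \<open>1 / 2\<close> is reached.\<close>

theorem fast_decay:
  fixes T :: "nat \<Rightarrow> nat \<Rightarrow> real"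
  assumes nonneg: "\<And>n i. 0 \<le> T n i"
    and lin: "\<And>n i j. j div 2 = i \<Longrightarrow> T (Suc n) j \<le> \<kappa> * T n i"
    and sq: "\<And>n i j. j div 2 = i \<Longrightarrow> odd j = d \<Longrightarrow> T (Suc n) j \<le> \<kappa> * (T n i)\<^sup>2"
    and \<kappa>: "1 \<le> \<kappa>"
    and stays: "\<And>\<zeta> \<epsilon>. 0 < \<zeta> \<Longrightarrow> 0 < \<epsilon> \<Longrightarrow>
      \<exists>m. \<forall>n\<ge>m. p - \<epsilon> \<le> frac_of n (\<lambda>i. \<forall>j\<in>{m..n}. T j (i div 2 ^ (n - j)) \<le> \<zeta>)"
    and "\<beta> < 1 / 2" "0 < \<epsilon>"
  shows "\<forall>\<^sub>F n in sequentially. p - \<epsilon> \<le> frac_of n (\<lambda>i. T n i < 2 powr (- (2 powr (real n * \<beta>))))"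
proof -
  \<comment> \<open>Strictly between \<open>\<beta>\<close> and \<open>1 / 2\<close>, and positive
    even for negative \<open>\<beta>\<close>; the margin above \<open>\<beta>\<close> absorbs the
    first \<open>m\<close> levels.\<close>
  define \<beta>' where "\<beta>' = (max \<beta> 0 + 1 / 2) / 2"
  have \<beta>': "\<beta> < \<beta>'" "0 < \<beta>'" "\<beta>' < 1 / 2" using \<open>\<beta> < 1 / 2\<close> by (auto simp: \<beta>'_def max_def)
  have "((\<lambda>\<gamma>. 1 / 2 - \<gamma> + log 2 (1 - \<gamma>)) \<longlongrightarrow> 1 / 2 - 0 + log 2 (1 - 0)) (at_right (0::real))"
    by (intro tendsto_intros) auto
  then have "\<forall>\<^sub>F \<gamma> in at_right (0::real). \<beta>' < 1 / 2 - \<gamma> + log 2 (1 - \<gamma>)"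
    by (rule order_tendstoD(1)) (use \<beta>' in auto)
  moreover have "\<forall>\<^sub>F \<gamma> in at_right (0::real). \<gamma> < 1"
    by (auto simp: eventually_at_right_field intro: exI[of _ 1])
  moreover have "\<forall>\<^sub>F \<gamma> in at_right (0::real). 0 < \<gamma>"
    by (rule eventually_at_right_less)
  ultimately have "\<forall>\<^sub>F \<gamma> in at_right (0::real). \<beta>' < 1 / 2 - \<gamma> + log 2 (1 - \<gamma>) \<and> \<gamma> < 1 \<and> 0 < \<gamma>"
    by eventually_elim auto
  then obtain \<gamma> :: real where \<gamma>: "\<beta>' < 1 / 2 - \<gamma> + log 2 (1 - \<gamma>)" "0 < \<gamma>" "\<gamma> < 1"
    using eventually_happens'[OF trivial_limit_at_right_real] by blast
  \<comment> \<open>Small enough for one factor \<open>\<kappa>\<close> to be worth at most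
    \<open>\<zeta> powr (- \<gamma>)\<close>; the cap \<open>1 / 2\<close> turns powers of
    \<open>\<zeta>\<close> into powers of \<open>2\<close>.\<close>
  define \<zeta> where "\<zeta> = min (1 / 2) (\<kappa> powr (- (1 / \<gamma>)))"
  have \<zeta>: "0 < \<zeta>" "\<zeta> < 1" "\<zeta> \<le> 1 / 2" using \<kappa> by (auto simp: \<zeta>_def min_def)
  have \<kappa>\<zeta>: "\<kappa> \<le> \<zeta> powr (- \<gamma>)"
  proof -
    have "(\<kappa> powr (- (1 / \<gamma>))) powr (- \<gamma>) \<le> \<zeta> powr (- \<gamma>)"
      using \<zeta> \<gamma> \<kappa> by (intro powr_mono2') (auto simp: \<zeta>_def)
    then show ?thesis using \<kappa> \<gamma> by (simp add: powr_powr)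
  qed
  obtain m where m: "\<And>n. n \<ge> m \<Longrightarrow> p - \<epsilon> / 2 \<le> frac_of n (\<lambda>i. \<forall>j\<in>{m..n}. T j (i div 2 ^ (n - j)) \<le> \<zeta>)"
    using stays[OF \<zeta>(1), of "\<epsilon> / 2"] \<open>0 < \<epsilon>\<close> by auto
  \<comment> \<open>\<open>N1\<close> makes \<open>real n * \<beta>\<close> smaller than
    \<open>real (n - m) * \<beta>'\<close>, and \<open>N2\<close> brings the Chebyshev bound below
    \<open>\<epsilon> / 2\<close>.\<close>
  obtain N1 where N1: "real m * \<beta>' / (\<beta>' - \<beta>) < real N1" using reals_Archimedean2 by blast
  obtain N2 where N2: "1 / (2 * \<gamma>\<^sup>2 * \<epsilon>) < real N2" using reals_Archimedean2 by blast
  have "p - \<epsilon> \<le> frac_of n (\<lambda>i. T n i < 2 powr (- (2 powr (real n * \<beta>))))" if n: "n \<ge> m + N1 + N2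
      + 1" for n
  proof -
    let ?k = "n - m"
    have k: "0 < ?k" "?k \<le> n" "real ?k = real n - real m" using n by auto
    have n\<beta>: "real n * \<beta> < real ?k * \<beta>'"
    proof -
      have "real m * \<beta>' / (\<beta>' - \<beta>) < real n" using N1 n by linarith
      then show ?thesis using \<beta>'(1) unfolding k(3) by (simp add: field_simps)
    qed
    have cheb: "frac_of n (\<lambda>i. real (low_count d ?k i) \<le> (1 / 2 - \<gamma>) * real ?k) \<le> \<epsilon> / 2"
    proof -
      have "1 / (2 * \<gamma>\<^sup>2 * \<epsilon>) < real ?k" using N2 n by linarith
      then have "1 / (4 * \<gamma>\<^sup>2 * real ?k) \<le> \<epsilon> / 2"
        using \<gamma> \<open>0 < \<epsilon>\<close> k(1) by (simp add: field_simps)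
      then show ?thesis by (rule order_trans[OF low_count_Chebyshev[OF k(1,2) \<gamma>(2)]])
    qed
    have path: "T n i < 2 powr (- (2 powr (real n * \<beta>)))"
      if "\<forall>j\<in>{m..n}. T j (i div 2 ^ (n - j)) \<le> \<zeta>" "\<not> real (low_count d ?k i)
          \<le> (1 / 2 - \<gamma>) * real ?k" for i
    proof -
      let ?c = "low_count d ?k i"
      have "2 powr (real n * \<beta>) < 2 powr (real ?k * \<beta>')" using n\<beta> by simp
      also have "\<dots> \<le> 2 powr (real ?k * (1 / 2 - \<gamma> + log 2 (1 - \<gamma>)))"
        using \<gamma>(1) by (simp add: mult_left_mono)
      also have "\<dots> = 2 powr ((1 / 2 - \<gamma>) * real ?k) * (2 powr log 2 (1 - \<gamma>)) powr (real ?k)"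
        by (simp add: powr_powr powr_add[symmetric] algebra_simps)
      also have "\<dots> \<le> 2 powr (real ?c) * (1 - \<gamma>) ^ ?k"
      proof (rule mult_mono)
        show "2 powr ((1 / 2 - \<gamma>) * real ?k) \<le> 2 powr (real ?c)"
          using that(2) by (intro powr_mono) auto
      qed (use \<gamma> in \<open>auto simp: powr_realpow\<close>)
      also have "\<dots> = (1 - \<gamma>) ^ ?k * 2 ^ ?c" by (simp add: powr_realpow)
      finally have 1: "2 powr (real n * \<beta>) < (1 - \<gamma>) ^ ?k * 2 ^ ?c" .
      have "T n i \<le> \<zeta> powr ((1 - \<gamma>) ^ ?k * 2 ^ ?c)"
        using n by (intro squaring_path_bound[where T
            = T, OF nonneg lin sq \<kappa> \<gamma>(2,3) \<zeta>(1,2) \<kappa>\<zeta> _ that(1)]) auto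
      also have "\<dots> \<le> (1 / 2) powr ((1 - \<gamma>) ^ ?k * 2 ^ ?c)"
        using \<zeta> \<gamma> by (intro powr_mono2) auto
      also have "\<dots> < (1 / 2) powr (2 powr (real n * \<beta>))"
        using 1 by (intro powr_less_mono') auto
      also have "\<dots> = 2 powr (- (2 powr (real n * \<beta>)))"
        by (simp add: powr_minus powr_divide inverse_eq_divide)
      finally show ?thesis .
    qed
    have "p - \<epsilon> / 2 \<le> frac_of n (\<lambda>i. \<forall>j\<in>{m..n}. T j (i div 2 ^ (n - j)) \<le> \<zeta>)" using n by (intro m) auto
    also have "\<dots> \<le> avg n (\<lambda>i. of_bool (T n i < 2 powr (- (2 powr (real n * \<beta>))))
        + of_bool (real (low_count d ?k i) \<le> (1 / 2 - \<gamma>) * real ?k))"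
      by (rule avg_mono) (use path in auto)
    finally show ?thesis unfolding avg_add using cheb by linarith
  qed
  then show ?thesis by (rule eventually_sequentiallyI)
qed

section \<open>Polarization of FAIM processes\<close>

lemma bit_bitrev:
  assumes "t < n"
  shows "bit (bitrev n k) t \<longleftrightarrow> bit k (n - 1 - t)"
proof -
  have "bitrev n k = (\<Sum>t<n. if bit k (n - 1 - t) then 2 ^ t else 0)"
    unfolding bitrev_def by (rule sum.reindex_bij_witness[of _ "\<lambda>t. n - 1 - t" "\<lambda>t. n - 1 - t"]) auto
  also have "\<dots> = horner_sum of_bool 2 (map (\<lambda>t. bit k (n - 1 - t)) [0..<n])"
    unfolding horner_sum_eq_sum by (intro sum.cong) auto
  finally show ?thesis using assms by (simp add: bit_horner_sum_bit_iff)
qed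

lemma bitrev_less: "bitrev n k < 2 ^ n"
proof -
  have "bitrev n k = (\<Sum>t<n. if bit k (n - 1 - t) then 2 ^ t else 0)"
    unfolding bitrev_def by (rule sum.reindex_bij_witness[of _ "\<lambda>t. n - 1 - t" "\<lambda>t. n - 1 - t"]) auto
  also have "\<dots> \<le> (\<Sum>t<n. 2 ^ t)" by (intro sum_mono) auto
  also have "\<dots> < (2 :: nat) ^ n" by (induction n) auto
  finally show ?thesis .
qed

text \<open>The only zero entry of \<open>G2\<close> has row bit \<open>0\<close> and column bit
  \<open>1\<close>; a Kronecker power vanishes exactly where some digit position shows this
  pair.\<close>

lemma kron_pow_bits:
  assumes "a < 2 ^ n" "b < 2 ^ n"
  shows "kron_pow n a b \<longleftrightarrow> (\<forall>t<n. bit b t \<longrightarrow> bit a t)"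
  using assms
proof (induction n arbitrary: a b)
  case (Suc n)
  have top: "x div 2 ^ n < 2 \<and> (x div 2 ^ n = 1 \<longleftrightarrow> bit x n) \<and> (x div 2 ^ n = 0 \<longleftrightarrow> \<not> bit x n)"
    if "x < 2 ^ Suc n" for x :: nat
  proof -
    have "x div 2 ^ n < 2" using that by (simp add: less_mult_imp_div_less mult.commute)
    then show ?thesis unfolding bit_iff_odd by (auto simp: less_2_cases_iff)
  qed
  have "bit (x mod 2 ^ n) t \<longleftrightarrow> bit x t" if "t < n" for x t :: nat
    using that by (simp add: bit_take_bit_iff flip: take_bit_eq_mod)
  then show ?case
    using top[OF Suc.prems(1)] top[OF Suc.prems(2)]
    by (auto simp: kron_def G2_def Suc.IH less_Suc_eq)
qed simp

definition bit_match :: "nat \<Rightarrow> nat \<Rightarrow> nat \<Rightarrow> bool" where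
  "bit_match n k j \<longleftrightarrow> (\<forall>t<n. bit j t \<longrightarrow> bit k (n - 1 - t))"

lemma polar_matrix_bits:
  assumes "k < 2 ^ n" "j < 2 ^ n"
  shows "polar_matrix n k j \<longleftrightarrow> bit_match n k j"
proof -
  have "{l. l < 2 ^ n \<and> bitrev_perm n k l \<and> kron_pow n l j}
      = (if kron_pow n (bitrev n k) j then {bitrev n k} else {})"
    using assms bitrev_less[of n k] by (auto simp: bitrev_perm_def)
  then show ?thesis
    using kron_pow_bits[OF bitrev_less assms(2)]
    by (simp add: polar_matrix_def matmul2_def bit_match_def bit_bitrev)
qed

lemma bit_match_Suc:
  "bit_match (Suc n) k j \<longleftrightarrow> (odd j \<longrightarrow> bit k n) \<and> (\<forall>t<n. bit (j div 2) t \<longrightarrow> bit k (n - 1 - t))"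
  unfolding bit_match_def All_less_Suc2 by (simp add: bit_0 bit_Suc)

text \<open>Bit reversal pairs the lowest bit of the output index with the highest bit of the input
  index, which tells the halves of the block apart; this reproduces the recursion of
  \<open>pU\<close>.\<close>

lemma bit_match_low:
  assumes "k < 2 ^ n"
  shows "bit_match (Suc n) k j \<longleftrightarrow> even j \<and> bit_match n k (j div 2)"
proof -
  have "\<not> bit k n" using assms by (simp add: bit_iff_odd)
  then show ?thesis unfolding bit_match_Suc by (auto simp: bit_match_def)
qed

lemma bit_match_high:
  assumes "k < 2 ^ n"
  shows "bit_match (Suc n) (2 ^ n + k) j \<longleftrightarrow> bit_match n k (j div 2)"
proof -
  have "bit (2 ^ n + k) n" using assms by (simp add: bit_iff_odd)
  moreover have "bit (2 ^ n + k) t \<longleftrightarrow> bit k t" if "t < n" for t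
  proof -
    have "take_bit n (2 ^ n + k) = k" using assms by (simp add: take_bit_eq_mod)
    then show ?thesis using that by (metis bit_take_bit_iff)
  qed
  ultimately show ?thesis unfolding bit_match_Suc by (auto simp: bit_match_def)
qed

context faim
begin

text \<open>The selected inputs split into those of the left half, present only for even
  \<open>j\<close>, and the shifted ones of the right half; parities of disjoint sets add.\<close>

lemma pU_eq_bit_match:
  "pU n j t \<omega> \<longleftrightarrow> odd (card {k. k < 2 ^ n \<and> X (t + 1 + int k) \<omega> \<and> bit_match n k j})" if "j < 2 ^ n"
  using that
proof (induction n arbitrary: j t)
  case 0
  have "{k. k < (2::nat) ^ 0 \<and> X (t + 1 + int k) \<omega> \<and> bit_match 0 k j}
      = (if X (t + 1) \<omega> then {0} else {})"
    by (auto simp: bit_match_def)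
  then show ?case using 0 by simp
next
  case (Suc n)
  let ?f = "\<lambda>k. X (t + 1 + int k) \<omega>"
  let ?A = "{k. k < 2 ^ n \<and> ?f k \<and> bit_match n k (j div 2)}"
  let ?B = "{k. k < 2 ^ n \<and> X (t + 2 ^ n + 1 + int k) \<omega> \<and> bit_match n k (j div 2)}"
  let ?C = "{k. k < 2 ^ Suc n \<and> ?f k \<and> bit_match (Suc n) k j}"
  have j: "j div 2 < 2 ^ n" using Suc.prems by auto
  have high: "bit_match (Suc n) (k + 2 ^ n) j \<longleftrightarrow> bit_match n k (j div 2)" if "k < 2 ^ n" for k
    using bit_match_high[OF that, of j] by (simp add: add.commute)
  have C: "?C = (if even j then ?A else {}) \<union> (+) (2 ^ n) ` ?B"
  proof (intro set_eqI iffI)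
    fix k assume k: "k \<in> ?C"
    show "k \<in> (if even j then ?A else {}) \<union> (+) (2 ^ n) ` ?B"
    proof (cases "k < 2 ^ n")
      case True
      then show ?thesis using k bit_match_low[OF True] by auto
    next
      case False
      then have "k = 2 ^ n + (k - 2 ^ n)" "k - 2 ^ n < 2 ^ n" using k by auto
      moreover from this have "k - 2 ^ n \<in> ?B"
        using k bit_match_high[of "k - 2 ^ n" n j] False by (auto simp: of_nat_diff algebra_simps)
      ultimately show ?thesis by blast
    qed
  next
    fix k assume "k \<in> (if even j then ?A else {}) \<union> (+) (2 ^ n) ` ?B"
    then show "k \<in> ?C"
      by (auto simp: bit_match_low high algebra_simps split: if_splits)
  qed
  have "card ?C = (if even j then card ?A else 0) + card ?B"
    unfolding C by (subst card_Un_disjoint) (auto simp: card_image)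
  then show ?case using Suc.IH[OF j, of t] Suc.IH[OF j, of "t + 2 ^ n"] Suc.prems by auto
qed

lemma polar_U_eq: "j < 2 ^ n \<Longrightarrow> polar_U n X (Suc j) = pU n j 0"
proof (rule ext)
  fix \<omega> assume j: "j < 2 ^ n"
  have "{k. k < 2 ^ n \<and> X (int k + 1) \<omega> \<and> polar_matrix n k j}
      = {k. k < 2 ^ n \<and> X (0 + 1 + int k) \<omega> \<and> bit_match n k j}"
    using polar_matrix_bits[OF _ j] by (auto simp: add.commute)
  then show "polar_U n X (Suc j) \<omega> = pU n j 0 \<omega>"
    using pU_eq_bit_match[OF j, of 0 \<omega>] j by (simp add: polar_U_def)
qed

lemma block_eq: "block X N = XB N 0" "block Y N = YB N 0"
  unfolding block_def XB_def YB_def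
  by (auto simp: fun_eq_iff algebra_simps simp del: upt_Suc intro!: nth_equalityI)

lemma polar_Q_eq: "j < 2 ^ n \<Longrightarrow> polar_Q n X Y (Suc j) = pQ n j 0"
proof (rule ext)
  fix \<omega> assume j: "j < 2 ^ n"
  have "map (\<lambda>k. polar_U n X k \<omega>) [1..<Suc j] = map (\<lambda>k. polar_U n X (Suc k) \<omega>) [0..<j]"
    unfolding One_nat_def map_Suc_upt[symmetric] by simp
  also have "\<dots> = map (\<lambda>k. pU n k 0 \<omega>) [0..<j]" using j by (intro map_cong refl) (simp add: polar_U_eq)
  finally show "polar_Q n X Y (Suc j) \<omega> = pQ n j 0 \<omega>" by (simp add: polar_Q_def pQ_def block_eq)
qed

lemma bhattacharyya_eq_Zn:
  "j < 2 ^ n \<Longrightarrow> bhattacharyya M (polar_U n X (Suc j)) (polar_Q n X Y (Suc j)) = Zn n j"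
  by (simp add: bhattacharyya_eq_Zpar polar_U_eq polar_Q_eq Zn_def)

lemma cond_entropy_eq_block_ent: "cond_entropy M (block X N) (block Y N) = block_ent N"
  unfolding block_eq block_ent_def cond_ent_def by (rule cond_entropy_ent) auto

end

section \<open>Random paths driven by coin tosses\<close>

text \<open>Counted from \<open>0\<close>, with the first coin as most significant bit, so that
  cutting a path short is division by a power of \<open>2\<close>.\<close>

definition path_index :: "nat \<Rightarrow> bool stream \<Rightarrow> nat" where
  "path_index n b = (\<Sum>j\<in>{1..n}. if b !! (j - 1) then 2 ^ (n - j) else 0)"

lemma random_index_eq: "random_index n b = Suc (path_index n b)"
  by (simp add: random_index_def path_index_def)

lemma path_index_Suc: "path_index (Suc n) b = 2 * path_index n b + of_bool (b !! n)"
proof -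
  have "(\<Sum>j\<in>{1..n}. if b !! (j - 1) then 2 ^ (Suc n - j) else 0)
      = 2 * (\<Sum>j\<in>{1..n}. if b !! (j - 1) then 2 ^ (n - j) else (0::nat))"
    unfolding sum_distrib_left by (intro sum.cong) (auto simp: Suc_diff_le)
  then show ?thesis by (simp add: path_index_def)
qed

text \<open>Splits off the first coin, the top bit, as the product structure of the stream space
  requires; \<open>path_index_Suc\<close> splits off the last.\<close>

lemma path_index_SCons: "path_index (Suc n) (x ## b) = (if x then 2 ^ n else 0) + path_index n b"
  by (induction n) (simp_all add: path_index_Suc[of "Suc _"] path_index_Suc, simp_all add:
      path_index_def)

lemma path_index_less: "path_index n b < 2 ^ n"
  by (induction n) (auto simp: path_index_Suc, simp add: path_index_def)

lemma path_index_ancestor: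
  assumes "j \<le> n"
  shows "path_index n b div 2 ^ (n - j) = path_index j b"
  using assms
proof (induction n rule: dec_induct)
  case (step n)
  then show ?case
    using child_ancestor[of j n "path_index (Suc n) b" "path_index n b"] by (simp add: path_index_Suc)
qed simp

interpretation coin: prob_space coin_space
  unfolding coin_space_def by (rule prob_space.prob_space_stream_space) (rule prob_space_measure_pmf)

lemma space_coin: "space coin_space = UNIV"
  by (simp add: coin_space_def space_stream_space)

lemma path_index_measurable [measurable]: "path_index n \<in> measurable coin_space (count_space UNIV)"
proof -
  have sets: "sets coin_space = sets (stream_space (count_space UNIV))"
    unfolding coin_space_def by (rule sets_stream_space_cong) simp
  have "path_index n = (\<lambda>xs. \<Sum>j\<in>{1..n}. if xs ! (j - 1) then 2 ^ (n - j) else 0) \<circ> stake n"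
    by (auto simp: path_index_def fun_eq_iff intro!: sum.cong)
  moreover have "stake n \<in> measurable coin_space (count_space UNIV)"
    unfolding measurable_cong_sets[OF sets refl] by (rule measurable_stake)
  ultimately show ?thesis by (simp add: measurable_comp[of _ _ "count_space UNIV"])
qed

lemma sum_lessThan_add:
  fixes g :: "nat \<Rightarrow> real"
  shows "(\<Sum>i<m + n. g i) = (\<Sum>i<m. g i) + (\<Sum>i<n. g (m + i))"
  by (induction n) auto

lemma frac_of_split: "frac_of (Suc n) P = (frac_of n P + frac_of n (\<lambda>i. P (2 ^ n + i))) / 2"
  unfolding avg_def power_Suc mult_2 sum_lessThan_add by (simp add: add_divide_distrib)

text \<open>The node reached at level \<open>n\<close> is uniform: the first coin chooses the lower
  or upper half of the indices.\<close>

lemma coin_path_index: "measure coin_space {b \<in> space coin_space. P (path_index n b)} = frac_of n P"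
proof (induction n arbitrary: P)
  case 0
  then show ?case
    using coin.prob_space by (auto simp: path_index_def avg_def)
next
  case (Suc n)
  have sets: "{b \<in> space coin_space. P (path_index (Suc n) b)} \<in> sets coin_space" by measurable
  let ?g = "\<lambda>x. measure coin_space {b \<in> space coin_space. P (path_index (Suc n) (x ## b))}"
  have "ennreal (measure coin_space {b \<in> space coin_space. P (path_index (Suc n) b)})
      = (\<integral>\<^sup>+x. ennreal (?g x) \<partial>measure_pmf (bernoulli_pmf (1/2)))"
    using prob_space.prob_stream_space[OF prob_space_measure_pmf sets[unfolded coin_space_def]]
    unfolding coin_space_def .
  also have "\<dots> = ennreal (\<integral>x. ?g x \<partial>measure_pmf (bernoulli_pmf (1/2)))"
    by (rule nn_integral_eq_integral) (auto intro: integrable_measure_pmf_finite)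
  finally have "measure coin_space {b \<in> space coin_space. P (path_index (Suc n) b)}
      = (\<integral>x. ?g x \<partial>measure_pmf (bernoulli_pmf (1/2)))"
    by (subst (asm) ennreal_inj) (auto intro: Bochner_Integration.integral_nonneg)
  also have "\<dots> = (frac_of n P + frac_of n (\<lambda>i. P (2 ^ n + i))) / 2"
    using Suc[of P] Suc[of "\<lambda>i. P (2 ^ n + i)"] by (simp add: path_index_SCons)
  finally show ?case by (simp add: frac_of_split)
qed

lemma coin_path_stays:
  assumes "m \<le> n"
  shows "measure coin_space {b \<in> space coin_space. \<forall>j\<in>{m..n}. P j (path_index j b)}
    = frac_of n (\<lambda>i. \<forall>j\<in>{m..n}. P j (i div 2 ^ (n - j)))"
proof -
  have "(\<forall>j\<in>{m..n}. P j (path_index j b)) \<longleftrightarrow> (\<forall>j\<in>{m..n}. P j (path_index n b div 2 ^ (n - j)))" for b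
    by (auto simp: path_index_ancestor)
  then show ?thesis using coin_path_index[of "\<lambda>i. \<forall>j\<in>{m..n}. P j (i div 2 ^ (n - j))" n] by simp
qed

text \<open>The bound does not depend on \<open>n\<close>, so it passes to the limit of the
  decreasing events.\<close>

lemma coin_path_stays_forever:
  assumes "\<And>n. m \<le> n \<Longrightarrow> p \<le> frac_of n (\<lambda>i. \<forall>j\<in>{m..n}. P j (i div 2 ^ (n - j)))"
  shows "p \<le> measure coin_space {b \<in> space coin_space. \<forall>j\<ge>m. P j (path_index j b)}"
proof -
  let ?A = "\<lambda>n. {b \<in> space coin_space. \<forall>j\<in>{m..m + n}. P j (path_index j b)}"
  have "(\<lambda>n. measure coin_space (?A n)) \<longlonglongrightarrow> measure coin_space (\<Inter>n. ?A n)"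
    by (rule coin.finite_Lim_measure_decseq) (auto simp: decseq_def)
  moreover have "(\<Inter>n. ?A n) = {b \<in> space coin_space. \<forall>j\<ge>m. P j (path_index j b)}"
  proof (intro set_eqI iffI)
    fix b assume b: "b \<in> (\<Inter>n. ?A n)"
    have "P j (path_index j b)" if "m \<le> j" for j
      using INT_D[OF b UNIV_I, of "j - m"] that by auto
    then show "b \<in> {b \<in> space coin_space. \<forall>j\<ge>m. P j (path_index j b)}" by (simp add: space_coin)
  qed auto
  ultimately have lim: "(\<lambda>n. measure coin_space (?A n))
      \<longlonglongrightarrow> measure coin_space {b \<in> space coin_space. \<forall>j\<ge>m. P j (path_index j b)}" by simp
  have "p \<le> measure coin_space (?A n)" for n
    using assms[of "m + n"] coin_path_stays[of m "m + n" P] by simp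
  then show ?thesis by (intro LIMSEQ_le_const[OF lim]) auto
qed

section \<open>Limits of the mean entropies and fractions of extreme nodes\<close>

context faim
begin

lemma block_ent_limit:
  obtains L where "(\<lambda>N. block_ent N / real N) \<longlonglongrightarrow> L" "(\<lambda>n. avg n (Hn n)) \<longlonglongrightarrow> L" "(\<lambda>n. avg n (Hs n)) \<longlonglongrightarrow> L"
proof -
  obtain L where L: "(\<lambda>N. block_ent N / real N) \<longlonglongrightarrow> L"
    using block_ent_convergent by (auto simp: convergent_def)
  have "strict_mono (\<lambda>n. 2 ^ n :: nat)" by (rule strict_monoI) simp
  from LIMSEQ_subseq_LIMSEQ[OF L this]
  have 1: "(\<lambda>n. avg n (Hn n)) \<longlonglongrightarrow> L" by (simp add: o_def avg_def sum_Hn)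
  have "(\<lambda>n. 2 * ent M (S 0) * (1 / 2) ^ n) \<longlonglongrightarrow> 2 * ent M (S 0) * 0"
    by (intro tendsto_mult tendsto_const LIMSEQ_realpow_zero) auto
  then have 2: "(\<lambda>n. avg n (Hn n) - 2 * ent M (S 0) * (1 / 2) ^ n) \<longlonglongrightarrow> L"
    using tendsto_diff[OF 1] by fastforce
  have "(\<lambda>n. avg n (Hs n)) \<longlonglongrightarrow> L"
  proof (rule tendsto_sandwich[OF _ _ 2 1])
    show "\<forall>\<^sub>F n in sequentially. avg n (Hn n) - 2 * ent M (S 0) * (1 / 2) ^ n \<le> avg n (Hs n)"
    proof (rule always_eventually, rule allI)
      fix n
      have "block_ent (2 ^ n) / 2 ^ n \<le> (block_ent_states (2 ^ n) + 2 * ent M (S 0)) / 2 ^ n"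
        by (intro divide_right_mono block_ent_le) simp
      moreover have "2 * ent M (S 0) * (1 / 2) ^ n = 2 * ent M (S 0) / 2 ^ n"
        by (simp add: power_one_over)
      ultimately show "avg n (Hn n) - 2 * ent M (S 0) * (1 / 2) ^ n \<le> avg n (Hs n)"
        unfolding avg_def sum_Hn sum_Hs add_divide_distrib by linarith
    qed
    show "\<forall>\<^sub>F n in sequentially. avg n (Hs n) \<le> avg n (Hn n)"
      by (intro always_eventually allI avg_mono Hs_le_Hn)
  qed
  then show ?thesis using that L 1 by blast
qed

lemma Hs_polarizes:
  assumes "0 < \<epsilon>"
  shows "(\<lambda>n. frac_of n (\<lambda>i. \<epsilon> < Hs n i \<and> Hs n i < 1 - \<epsilon>)) \<longlonglongrightarrow> 0"
proof -
  obtain c N where c: "0 < c" "\<And>n s s'. N \<le> n \<Longrightarrow> c * \<pi> s * \<pi> s' \<le> trans_joint n s s'"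
    using trans_joint_mixing by blast
  define r :: real where "r = (3 / ln 2)\<^sup>2"
  have r: "0 < r" by (simp add: r_def)
  show ?thesis
  proof (rule polarization_in_probability[where c = "c / r" and base = N])
    fix n i assume n: "N \<le> n"
    \<comment> \<open>The middle window of \<open>2 * 2 ^ n\<close> steps exceeds the mixing time
      \<open>N\<close>.\<close>
    have "N \<le> 2 * 2 ^ n" using n less_exp[of n] by linarith
    then have 1: "Hs n i + c * (1 - Ks n i) * (1 - Hs n i) \<le> Hs (Suc (Suc n)) (2 * (2 * i))"
      using c by (intro Hs_minus_minus) auto
    have "(Hs n i)\<^sup>2 \<le> (3 / ln 2 * sqrt (1 - Ks n i))\<^sup>2"
      using polar_bounds by (intro power_mono Hs_le)
    also have "\<dots> = r * (1 - Ks n i)"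
      unfolding power_mult_distrib r_def using polar_bounds(6)[of n i] by simp
    finally have "(Hs n i)\<^sup>2 / r \<le> 1 - Ks n i" using r by (simp add: field_simps)
    then have "c * ((Hs n i)\<^sup>2 / r) * (1 - Hs n i) \<le> c * (1 - Ks n i) * (1 - Hs n i)"
      using c polar_bounds by (intro mult_right_mono mult_left_mono) auto
    then show "Hs n i + c / r * (Hs n i)\<^sup>2 * (1 - Hs n i) \<le> Hs (Suc (Suc n)) (2 * (2 * i))"
      using 1 by simp
  qed (use polar_bounds Hs_children c r assms in auto)
qed

context
  fixes L :: real
  assumes Ln: "(\<lambda>n. avg n (Hn n)) \<longlonglongrightarrow> L" and Ls: "(\<lambda>n. avg n (Hs n)) \<longlonglongrightarrow> L"
begin

text \<open>A mean near \<open>L\<close> of values nearly all close to \<open>0\<close> or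
  \<open>1\<close> forces a fraction of about \<open>L\<close> close to \<open>1\<close>.\<close>

lemma Hs_high:
  assumes "0 < \<delta>" "0 < \<epsilon>"
  shows "\<forall>\<^sub>F n in sequentially. L - \<delta> - \<epsilon> \<le> frac_of n (\<lambda>i. 1 - Hs n i \<le> \<delta>)"
proof -
  have "\<forall>\<^sub>F n in sequentially. L - \<epsilon> / 2 < avg n (Hs n)"
    using assms by (intro order_tendstoD(1)[OF Ls]) auto
  moreover have "\<forall>\<^sub>F n in sequentially. frac_of n (\<lambda>i. \<delta> < Hs n i \<and> Hs n i < 1 - \<delta>) < \<epsilon> / 2"
    using assms by (intro order_tendstoD(2)[OF Hs_polarizes]) auto
  ultimately show ?thesis
  proof eventually_elim
    case (elim n)
    have "avg n (Hs n) \<le> avg n (\<lambda>i. (of_bool (1 - Hs n i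
        \<le> \<delta>) + of_bool (\<delta> < Hs n i \<and> Hs n i < 1 - \<delta>)) + \<delta>)"
    proof (rule avg_mono)
      fix i
      show "Hs n i \<le> (of_bool (1 - Hs n i \<le> \<delta>) + of_bool (\<delta> < Hs n i \<and> Hs n i < 1 - \<delta>)) + \<delta>"
        using polar_bounds(4)[of n i] assms by (auto simp: of_bool_def)
    qed
    then show ?case using elim by (simp only: avg_add avg_const)
  qed
qed

text \<open>Polarization in probability passes from \<open>Hs\<close> to \<open>Hn\<close> by
  Markov's inequality for the nonnegative gap, whose mean tends to \<open>0\<close>.\<close>

lemma Hn_low:
  assumes "0 < \<delta>" "0 < \<epsilon>"
  shows "\<forall>\<^sub>F n in sequentially. 1 - L - \<delta> - \<epsilon> \<le> frac_of n (\<lambda>i. Hn n i \<le> \<delta>)"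
proof -
  have "(\<lambda>n. (2 / \<delta>) * (avg n (Hn n) - avg n (Hs n))) \<longlonglongrightarrow> (2 / \<delta>) * (L - L)"
    by (intro tendsto_mult tendsto_diff tendsto_const Ln Ls)
  from order_tendstoD(2)[OF this, of "\<epsilon> / 3"]
  have "\<forall>\<^sub>F n in sequentially. (2 / \<delta>) * (avg n (Hn n) - avg n (Hs n)) < \<epsilon> / 3"
    using assms by simp
  moreover have "\<forall>\<^sub>F n in sequentially. avg n (Hs n) < L + \<epsilon> / 3"
    using assms by (intro order_tendstoD(2)[OF Ls]) auto
  moreover have "\<forall>\<^sub>F n in sequentially. frac_of n (\<lambda>i. \<delta> / 2 < Hs n i \<and> Hs n i < 1 - \<delta> / 2) < \<epsilon> / 3"
    using assms by (intro order_tendstoD(2)[OF Hs_polarizes]) auto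
  ultimately show ?thesis
  proof eventually_elim
    case (elim n)
    \<comment> \<open>The term with \<open>2 / \<delta>\<close> is at least \<open>1\<close> on the
      exceptional nodes where \<open>Hn\<close> exceeds \<open>\<delta>\<close> but
      \<open>Hs\<close> is at most \<open>\<delta> / 2\<close>.\<close>
    have "avg n (\<lambda>i. 1 - Hs n i) \<le> avg n (\<lambda>i. ((of_bool (Hn n i \<le> \<delta>)
        + of_bool (\<delta> / 2 < Hs n i \<and> Hs n i < 1 - \<delta> / 2)) + (2 / \<delta>) * (Hn n i - Hs n i)) + \<delta> / 2)"
    proof (rule avg_mono)
      fix i
      have d: "0 \<le> (2 / \<delta>) * (Hn n i - Hs n i)" using assms Hs_le_Hn[of n i] by simp
      consider "Hn n i \<le> \<delta>" | "\<delta> / 2 < Hs n i" "Hs n i < 1 - \<delta> / 2" | "1 - \<delta> / 2 \<le> Hs n i"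
        | "\<delta> < Hn n i" "Hs n i \<le> \<delta> / 2" by linarith
      then show "1 - Hs n i \<le> ((of_bool (Hn n i \<le> \<delta>)
        + of_bool (\<delta> / 2 < Hs n i \<and> Hs n i < 1 - \<delta> / 2)) + (2 / \<delta>) * (Hn n i - Hs n i)) + \<delta> / 2"
      proof cases
        case 4
        then have "(2 / \<delta>) * (\<delta> / 2) \<le> (2 / \<delta>) * (Hn n i - Hs n i)"
          using assms by (intro mult_left_mono) auto
        then have e: "1 \<le> (2 / \<delta>) * (Hn n i - Hs n i)" using assms by simp
        have "(0::real) \<le> of_bool (Hn n i \<le> \<delta>)" "(0::real)
            \<le> of_bool (\<delta> / 2 < Hs n i \<and> Hs n i < 1 - \<delta> / 2)" by auto
        then show ?thesis using e polar_bounds(3)[of n i] assms by linarith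
      qed (use d polar_bounds(3)[of n i] assms in auto)
    qed
    then have "1 - avg n (Hs n) \<le> frac_of n (\<lambda>i. Hn n i \<le> \<delta>)
        + frac_of n (\<lambda>i. \<delta> / 2 < Hs n i \<and> Hs n i < 1 - \<delta> / 2)
        + (2 / \<delta>) * (avg n (Hn n) - avg n (Hs n)) + \<delta> / 2"
      by (simp only: avg_add avg_cmult avg_diff avg_const)
    then show ?case using elim assms by argo
  qed
qed

lemma Hs_stays_high:
  assumes "0 < \<zeta>" "0 < \<epsilon>"
  shows "\<exists>m. \<forall>n\<ge>m. L - \<epsilon> \<le> frac_of n (\<lambda>i. \<forall>j\<in>{m..n}. 1 - Hs j (i div 2 ^ (n - j)) \<le> \<zeta>)"
proof -
  \<comment> \<open>Makes both the loss \<open>\<delta>\<close> in the starting fraction and the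
    loss \<open>\<delta> / \<zeta>\<close> of the maximal inequality at most
    \<open>\<epsilon> / 4\<close>.\<close>
  define \<delta> where "\<delta> = min (\<epsilon> / 4) (\<zeta> * (\<epsilon> / 4))"
  have \<delta>: "0 < \<delta>" "\<delta> \<le> \<epsilon> / 4" "\<delta> / \<zeta> \<le> \<epsilon> / 4" using assms
      by (auto simp: \<delta>_def pos_divide_le_eq mult.commute)
  obtain m where m: "L - \<delta> - \<epsilon> / 4 \<le> frac_of m (\<lambda>i. 1 - Hs m i \<le> \<delta>)"
    using Hs_high[OF \<delta>(1), of "\<epsilon> / 4"] assms(2) by (auto dest: eventually_happens)
  have "L - \<epsilon> \<le> frac_of n (\<lambda>i. \<forall>j\<in>{m..n}. 1 - Hs j (i div 2 ^ (n - j)) \<le> \<zeta>)" if "m \<le> n" for n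
  proof -
    have "frac_of m (\<lambda>i. 1 - Hs m i \<le> \<delta>) - \<delta> / \<zeta> \<le> frac_of n (\<lambda>i. \<forall>j\<in>{m..n}. 1 - Hs j (i div 2 ^ (n
        - j)) \<le> \<zeta>)"
    proof (rule stays_small)
      show "1 - Hs (Suc n) (2 * i) + (1 - Hs (Suc n) (Suc (2 * i))) \<le> 2 * (1 - Hs n i)" for n i
        using Hs_children[of n i] by simp
    qed (use polar_bounds assms \<delta> that in auto)
    then show ?thesis using m \<delta> assms by linarith
  qed
  then show ?thesis by blast
qed

lemma Hn_stays_low:
  assumes "0 < \<zeta>" "0 < \<epsilon>"
  shows "\<exists>m. \<forall>n\<ge>m. 1 - L - \<epsilon> \<le> frac_of n (\<lambda>i. \<forall>j\<in>{m..n}. Hn j (i div 2 ^ (n - j)) \<le> \<zeta>)"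
proof -
  define \<delta> where "\<delta> = min (\<epsilon> / 4) (\<zeta> * (\<epsilon> / 4))"
  have \<delta>: "0 < \<delta>" "\<delta> \<le> \<epsilon> / 4" "\<delta> / \<zeta> \<le> \<epsilon> / 4" using assms
      by (auto simp: \<delta>_def pos_divide_le_eq mult.commute)
  obtain m where m: "1 - L - \<delta> - \<epsilon> / 4 \<le> frac_of m (\<lambda>i. Hn m i \<le> \<delta>)"
    using Hn_low[OF \<delta>(1), of "\<epsilon> / 4"] assms(2) by (auto dest: eventually_happens)
  have "1 - L - \<epsilon> \<le> frac_of n (\<lambda>i. \<forall>j\<in>{m..n}. Hn j (i div 2 ^ (n - j)) \<le> \<zeta>)" if "m \<le> n" for n
  proof -
    have "frac_of m (\<lambda>i. Hn m i \<le> \<delta>) - \<delta> / \<zeta> \<le> frac_of n (\<lambda>i. \<forall>j\<in>{m..n}. Hn j (i div 2 ^ (n - j)) \<le> \<zeta>)"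
      by (rule stays_small) (use polar_bounds Hn_children assms \<delta> that in auto)
    then show ?thesis using m \<delta> assms by linarith
  qed
  then show ?thesis by blast
qed

lemma Ks_stays_low:
  assumes "0 < \<zeta>" "0 < \<epsilon>"
  shows "\<exists>m. \<forall>n\<ge>m. L - \<epsilon> \<le> frac_of n (\<lambda>i. \<forall>j\<in>{m..n}. Ks j (i div 2 ^ (n - j)) \<le> \<zeta>)"
proof -
  have K: "Ks j i \<le> \<zeta>" if "1 - Hs j i \<le> \<zeta>\<^sup>2 / 4" for j i
  proof -
    have "Ks j i \<le> sqrt (4 * (1 - Hs j i))" by (rule Ks_le)
    also have "\<dots> \<le> sqrt (\<zeta>\<^sup>2)" using that by (intro real_sqrt_le_mono) (simp add: field_simps)
    finally show ?thesis using assms by simp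
  qed
  obtain m where m: "\<forall>n\<ge>m. L - \<epsilon> \<le> frac_of n (\<lambda>i. \<forall>j\<in>{m..n}. 1 - Hs j (i div 2 ^ (n - j)) \<le> \<zeta>\<^sup>2 / 4)"
    using Hs_stays_high[of "\<zeta>\<^sup>2 / 4" \<epsilon>] assms by auto
  have "frac_of n (\<lambda>i. \<forall>j\<in>{m..n}. 1 - Hs j (i div 2 ^ (n - j)) \<le> \<zeta>\<^sup>2 / 4)
      \<le> frac_of n (\<lambda>i. \<forall>j\<in>{m..n}. Ks j (i div 2 ^ (n - j)) \<le> \<zeta>)" for n
    by (rule avg_mono) (auto simp: K of_bool_def)
  then show ?thesis using m order_trans by blast
qed

lemma Zn_stays_low:
  assumes "0 < \<zeta>" "0 < \<epsilon>"
  shows "\<exists>m. \<forall>n\<ge>m. 1 - L - \<epsilon> \<le> frac_of n (\<lambda>i. \<forall>j\<in>{m..n}. Zn j (i div 2 ^ (n - j)) \<le> \<zeta>)"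
proof -
  have Z: "Zn j i \<le> \<zeta>" if "Hn j i \<le> \<zeta>\<^sup>2 / 2" for j i
  proof -
    have "Zn j i \<le> sqrt (2 * Hn j i)" by (rule Zn_le)
    also have "\<dots> \<le> sqrt (\<zeta>\<^sup>2)" using that by (intro real_sqrt_le_mono) (simp add: field_simps)
    finally show ?thesis using assms by simp
  qed
  obtain m where m: "\<forall>n\<ge>m. 1 - L - \<epsilon> \<le> frac_of n (\<lambda>i. \<forall>j\<in>{m..n}. Hn j (i div 2 ^ (n - j)) \<le> \<zeta>\<^sup>2 / 2)"
    using Hn_stays_low[of "\<zeta>\<^sup>2 / 2" \<epsilon>] assms by auto
  have "frac_of n (\<lambda>i. \<forall>j\<in>{m..n}. Hn j (i div 2 ^ (n - j)) \<le> \<zeta>\<^sup>2 / 2)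
      \<le> frac_of n (\<lambda>i. \<forall>j\<in>{m..n}. Zn j (i div 2 ^ (n - j)) \<le> \<zeta>)" for n
    by (rule avg_mono) (auto simp: Z of_bool_def)
  then show ?thesis using m order_trans by blast
qed

lemma Ks_fast:
  assumes "\<beta> < 1 / 2" "0 < \<epsilon>"
  shows "\<forall>\<^sub>F n in sequentially. L - \<epsilon> \<le> frac_of n (\<lambda>i. Ks n i < 2 powr (- (2 powr (real n * \<beta>))))"
\<comment> \<open>Even indices, the minus steps, square \<open>Ks\<close>, hence
  \<open>d = False\<close>; the constant \<open>2 * \<kappa>\<close> covers both kinds of
  step.\<close>
proof (rule fast_decay[where \<kappa> = "2 * \<kappa>" and d = False])
  fix n i j :: nat
  assume j: "j div 2 = i"
  have K: "0 \<le> Ks n i" "Ks n i \<le> 1" using polar_bounds by auto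
  show "Ks (Suc n) j \<le> 2 * \<kappa> * (Ks n i)\<^sup>2" if "odd j = False"
  proof -
    have "j = 2 * i" using that j by auto
    then have "Ks (Suc n) j \<le> \<kappa> * (Ks n i)\<^sup>2" using Ks_minus[of n i] by simp
    also have "\<dots> \<le> 2 * \<kappa> * (Ks n i)\<^sup>2" using \<kappa>_ge_1 by (intro mult_right_mono) auto
    finally show ?thesis .
  qed
  note even_case = this
  show "Ks (Suc n) j \<le> 2 * \<kappa> * Ks n i"
  proof (cases "odd j")
    case True
    then have "j = Suc (2 * i)" using j by (auto elim: oddE)
    then have "Ks (Suc n) j \<le> 2 * Ks n i" using Ks_plus[of n i] by simp
    also have "\<dots> \<le> 2 * \<kappa> * Ks n i" using \<kappa>_ge_1 K by (intro mult_right_mono) auto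
    finally show ?thesis .
  next
    case False
    have "(Ks n i)\<^sup>2 \<le> Ks n i" using K by (simp add: power2_eq_square mult_left_le)
    then have "2 * \<kappa> * (Ks n i)\<^sup>2 \<le> 2 * \<kappa> * Ks n i" using \<kappa>_ge_1 by (intro mult_left_mono) auto
    then show ?thesis using even_case False by simp
  qed
qed (use polar_bounds \<kappa>_ge_1 Ks_stays_low assms in auto)

lemma Zn_fast:
  assumes "\<beta> < 1 / 2" "0 < \<epsilon>"
  shows "\<forall>\<^sub>F n in sequentially. 1 - L - \<epsilon> \<le> frac_of n (\<lambda>i. Zn n i < 2 powr (- (2 powr (real n * \<beta>))))"
\<comment> \<open>For \<open>Zn\<close> the roles are exchanged: odd indices, the plus steps,
  square.\<close>
proof (rule fast_decay[where \<kappa> = "2 * \<kappa>" and d = True])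
  fix n i j :: nat
  assume j: "j div 2 = i"
  have Z: "0 \<le> Zn n i" "Zn n i \<le> 1" using polar_bounds by auto
  show "Zn (Suc n) j \<le> 2 * \<kappa> * (Zn n i)\<^sup>2" if "odd j = True"
  proof -
    have "j = Suc (2 * i)" using that j by (auto elim: oddE)
    then have "Zn (Suc n) j \<le> \<kappa> * (Zn n i)\<^sup>2" using Zn_plus[of n i] by simp
    also have "\<dots> \<le> 2 * \<kappa> * (Zn n i)\<^sup>2" using \<kappa>_ge_1 by (intro mult_right_mono) auto
    finally show ?thesis .
  qed
  note odd_case = this
  show "Zn (Suc n) j \<le> 2 * \<kappa> * Zn n i"
  proof (cases "odd j")
    case True
    have "(Zn n i)\<^sup>2 \<le> Zn n i" using Z by (simp add: power2_eq_square mult_left_le)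
    then have "2 * \<kappa> * (Zn n i)\<^sup>2 \<le> 2 * \<kappa> * Zn n i" using \<kappa>_ge_1 by (intro mult_left_mono) auto
    then show ?thesis using odd_case True by simp
  next
    case False
    then have "j = 2 * i" using j by auto
    then show ?thesis using Zn_minus[of n i] by simp
  qed
qed (use polar_bounds \<kappa>_ge_1 Zn_stays_low assms in auto)

text \<open>Nodes with tiny \<open>Ks\<close> give the lower bound. Nodes with tiny
  \<open>Zn\<close>, a fraction of about \<open>1 - L\<close>, lie below the threshold and give the
  upper bound.\<close>

lemma Zn_near_1_fraction:
  assumes "\<beta> < 1 / 2"
  shows "(\<lambda>n. frac_of n (\<lambda>i. 1 - 2 powr (- (2 powr (real n * \<beta>))) < Zn n i)) \<longlonglongrightarrow> L"
proof (rule tendstoI)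
  fix e :: real assume "0 < e"
  \<comment> \<open>Excludes that a node counts on both sides. For negative \<open>\<beta>\<close>
    the threshold for \<open>Zn\<close> decays only exponentially in \<open>n\<close>, while the
    bound with rate \<open>1 / 4\<close> decays doubly exponentially.\<close>
  have "\<forall>\<^sub>F n in sequentially. 2 powr (- (2 powr (real n / 4))) + 2 powr (- (2 powr (real n * \<beta>))) < 1"
  proof (cases "0 \<le> \<beta>")
    case True
    have "\<forall>\<^sub>F n in sequentially. 2 powr (- (2 powr (real n / 4))) < 1 / 2" by real_asymp
    then show ?thesis
    proof eventually_elim
      case (elim n)
      have "2 powr 0 \<le> 2 powr (real n * \<beta>)" using True by (intro powr_mono) auto
      then have "2 powr (- (2 powr (real n * \<beta>))) \<le> 2 powr (- 1 :: real)" by (intro powr_mono) auto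
      also have "2 powr (- 1 :: real) = 1 / 2" by (simp add: powr_minus_divide)
      finally show ?case using elim by argo
    qed
  next
    case False
    have "\<forall>\<^sub>F n in sequentially. 2 powr (- (2 powr (real n / 4))) + 2 powr (- (2 powr (real n * \<beta>))) < 1"
      using False by real_asymp
    then show ?thesis .
  qed
  moreover have "\<forall>\<^sub>F n in sequentially. L - e / 2 \<le> frac_of n (\<lambda>i. Ks n i
      < 2 powr (- (2 powr (real n * \<beta>))))"
    using assms \<open>0 < e\<close> by (intro Ks_fast) auto
  moreover have "\<forall>\<^sub>F n in sequentially. 1 - L - e / 2
      \<le> frac_of n (\<lambda>i. Zn n i < 2 powr (- (2 powr (real n * (1 / 4)))))"
    using \<open>0 < e\<close> by (intro Zn_fast) auto
  ultimately show "\<forall>\<^sub>F n in sequentially. dist (frac_of n (\<lambda>i. 1 - 2 powr (- (2 powr (real n * \<beta>)))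
      < Zn n i)) L < e"
  proof eventually_elim
    case (elim n)
    let ?F = "frac_of n (\<lambda>i. 1 - 2 powr (- (2 powr (real n * \<beta>))) < Zn n i)"
    have "frac_of n (\<lambda>i. Ks n i < 2 powr (- (2 powr (real n * \<beta>)))) \<le> ?F"
    proof (rule avg_mono)
      fix i
      show "(of_bool (Ks n i < 2 powr (- (2 powr (real n * \<beta>)))) :: real)
        \<le> of_bool (1 - 2 powr (- (2 powr (real n * \<beta>))) < Zn n i)"
        using Zn_ge[of n i] by auto
    qed
    moreover have "frac_of n (\<lambda>i. Zn n i < 2 powr (- (2 powr (real n * (1 / 4)))))
        \<le> avg n (\<lambda>i. 1 - of_bool (1 - 2 powr (- (2 powr (real n * \<beta>))) < Zn n i))"
      by (rule avg_mono) (use elim(1) in auto)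
    ultimately show ?case using elim(2,3) \<open>0 < e\<close> by (simp add: avg_diff dist_real_def abs_less_iff)
  qed
qed

section \<open>Almost sure convergence of the Bhattacharyya process\<close>

lemma coin_stays_high:
  assumes "0 < \<zeta>" "0 < \<epsilon>"
  shows "\<exists>m. L - \<epsilon> \<le> measure coin_space {b \<in> space coin_space. \<forall>j\<ge>m. 1 - \<zeta> \<le> Zn j (path_index j b)}"
proof -
  obtain m where m: "\<forall>n\<ge>m. L - \<epsilon> \<le> frac_of n (\<lambda>i. \<forall>j\<in>{m..n}. Ks j (i div 2 ^ (n - j)) \<le> \<zeta>)"
    using Ks_stays_low[OF assms] by blast
  have "frac_of n (\<lambda>i. \<forall>j\<in>{m..n}. Ks j (i div 2 ^ (n - j)) \<le> \<zeta>)
      \<le> frac_of n (\<lambda>i. \<forall>j\<in>{m..n}. 1 - \<zeta> \<le> Zn j (i div 2 ^ (n - j)))" for n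
  proof (rule avg_mono)
    fix i
    have "1 - \<zeta> \<le> Zn j k" if "Ks j k \<le> \<zeta>" for j k using Zn_ge[of j k] that by linarith
    then show "(of_bool (\<forall>j\<in>{m..n}. Ks j (i div 2 ^ (n - j)) \<le> \<zeta>) :: real)
      \<le> of_bool (\<forall>j\<in>{m..n}. 1 - \<zeta> \<le> Zn j (i div 2 ^ (n - j)))" by auto
  qed
  then show ?thesis using m order_trans
    by (intro exI[of _ m] coin_path_stays_forever[of m _ "\<lambda>j k. 1 - \<zeta> \<le> Zn j k"]) blast
qed

lemma coin_stays_low:
  assumes "0 < \<zeta>" "0 < \<epsilon>"
  shows "\<exists>m. 1 - L - \<epsilon> \<le> measure coin_space {b \<in> space coin_space. \<forall>j\<ge>m. Zn j (path_index j b) \<le> \<zeta>}"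
  using Zn_stays_low[OF assms] coin_path_stays_forever[of _ "1 - L - \<epsilon>" "\<lambda>j k. Zn j k \<le> \<zeta>"] by blast

text \<open>Defined on every path with values \<open>0\<close> and \<open>1\<close>, as
  \<open>polarizes_with_limit\<close> requires, and visibly measurable; almost surely it is the true
  limit.\<close>

definition Z_limit :: "bool stream \<Rightarrow> real" where
  "Z_limit b = of_bool (\<exists>m. \<forall>j\<ge>m. 1 / 2 < Zn j (path_index j b))"

text \<open>Staying high and staying low are disjoint events with probabilities at least about
  \<open>L\<close> and \<open>1 - L\<close>, so together they exhaust the space.\<close>

lemma coin_high_low:
  assumes "0 < \<zeta>"
  shows "AE b in coin_space. \<exists>m. (\<forall>j\<ge>m. 1 - \<zeta> \<le> Zn j (path_index j b)) \<or> (\<forall>j\<ge>m. Zn j (path_index j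
      b) \<le> \<zeta>)"
proof -
  \<comment> \<open>The cap \<open>1 / 3\<close> keeps the ranges above \<open>1 - \<eta>\<close>
    and below \<open>\<eta>\<close> apart.\<close>
  define \<eta> where "\<eta> = min \<zeta> (1 / 3)"
  have \<eta>: "0 < \<eta>" "\<eta> \<le> \<zeta>" "\<eta> \<le> 1 / 3" using assms by (auto simp: \<eta>_def)
  let ?G = "\<lambda>b. \<exists>m. (\<forall>j\<ge>m. 1 - \<eta> \<le> Zn j (path_index j b)) \<or> (\<forall>j\<ge>m. Zn j (path_index j b) \<le> \<eta>)"
  have near: "1 - \<epsilon> \<le> measure coin_space {b \<in> space coin_space. ?G b}" if "0 < \<epsilon>" for \<epsilon> :: real
  proof -
    obtain m1 where m1: "L - \<epsilon> / 2 \<le> measure coin_space {b \<in> space coin_space. \<forall>j\<ge>m1. 1 - \<eta>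
        \<le> Zn j (path_index j b)}" (is "_ \<le> measure _ ?A")
      using coin_stays_high[OF \<eta>(1), of "\<epsilon> / 2"] \<open>0 < \<epsilon>\<close> by auto
    obtain m2 where m2: "1 - L - \<epsilon> / 2 \<le> measure coin_space {b \<in> space coin_space. \<forall>j\<ge>m2. Zn j
        (path_index j b) \<le> \<eta>}" (is "_ \<le> measure _ ?B")
      using coin_stays_low[OF \<eta>(1), of "\<epsilon> / 2"] \<open>0 < \<epsilon>\<close> by auto
    have "b \<notin> ?B" if "b \<in> ?A" for b
    proof
      assume "b \<in> ?B"
      then have "1 - \<eta> \<le> Zn (max m1 m2) (path_index (max m1 m2) b)" "Zn (max m1 m2) (path_index (max
          m1 m2) b) \<le> \<eta>"
        using that by auto
      then show False using \<eta>(3) by linarith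
    qed
    then have "?A \<inter> ?B = {}" by blast
    then have "measure coin_space ?A + measure coin_space ?B = measure coin_space (?A \<union> ?B)"
      by (intro coin.finite_measure_Union[symmetric]) auto
    also have "\<dots> \<le> measure coin_space {b \<in> space coin_space. ?G b}"
      by (intro coin.finite_measure_mono) auto
    finally show ?thesis using m1 m2 by linarith
  qed
  have "1 \<le> measure coin_space {b \<in> space coin_space. ?G b}"
  proof (rule field_le_epsilon)
    fix \<epsilon> :: real assume "0 < \<epsilon>"
    from near[OF this] show "1 \<le> measure coin_space {b \<in> space coin_space. ?G b} + \<epsilon>" by linarith
  qed
  then have "measure coin_space {b \<in> space coin_space. ?G b} = 1"
    using coin.prob_le_1 by (intro antisym) auto
  then have "AE b in coin_space. ?G b"
    by (subst (asm) coin.prob_Collect_eq_1) auto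
  then show ?thesis
  proof eventually_elim
    case (elim b)
    then obtain m where "(\<forall>j\<ge>m. 1 - \<eta> \<le> Zn j (path_index j b)) \<or> (\<forall>j\<ge>m. Zn j (path_index j b)
        \<le> \<eta>)" by blast
    then show ?case using \<eta>(2) by (intro exI[of _ m]) (auto intro: order_trans)
  qed
qed

lemma Z_limit_AE: "AE b in coin_space. (\<lambda>n. Zn n (path_index n b)) \<longlonglongrightarrow> Z_limit b"
proof -
  \<comment> \<open>Countably many thresholds shrinking to \<open>0\<close>; all are at most
    \<open>1 / 3\<close>, so the side on which a path stays also decides
    \<open>Z_limit\<close>.\<close>
  have "AE b in coin_space. \<forall>r. \<exists>m. (\<forall>j\<ge>m. 1 - 1 / (real r + 3) \<le> Zn j (path_index j b))
      \<or> (\<forall>j\<ge>m. Zn j (path_index j b) \<le> 1 / (real r + 3))"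
    unfolding AE_all_countable by (intro allI coin_high_low) simp
  then show ?thesis
  proof eventually_elim
    case (elim b)
    let ?Z = "\<lambda>j. Zn j (path_index j b)"
    have small: "1 / (real r + 3) \<le> 1 / 3" for r by (simp add: field_simps)
    show ?case
    proof (rule LIMSEQ_I)
      fix e :: real assume "0 < e"
      obtain r where r: "1 / e < real r" using reals_Archimedean2 by blast
      have re: "1 / (real r + 3) < e" using r \<open>0 < e\<close> by (simp add: field_simps)
      obtain m where m: "(\<forall>j\<ge>m. 1 - 1 / (real r + 3) \<le> ?Z j) \<or> (\<forall>j\<ge>m. ?Z j \<le> 1 / (real r + 3))"
        using elim by blast
      show "\<exists>m. \<forall>n\<ge>m. norm (?Z n - Z_limit b) < e"
      proof (cases "\<forall>j\<ge>m. 1 - 1 / (real r + 3) \<le> ?Z j")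
        case True
        have "1 / 2 < ?Z j" if "m \<le> j" for j
        proof -
          have "1 - 1 / (real r + 3) \<le> ?Z j" using True that by blast
          then show ?thesis using small[of r] by linarith
        qed
        then have "Z_limit b = 1" by (auto simp: Z_limit_def)
        moreover have "norm (?Z n - 1) < e" if "m \<le> n" for n
        proof -
          have "1 - 1 / (real r + 3) \<le> ?Z n" "?Z n \<le> 1" using True that polar_bounds by auto
          then show ?thesis using re unfolding real_norm_def by linarith
        qed
        ultimately show ?thesis by auto
      next
        case False
        then have low: "\<forall>j\<ge>m. ?Z j \<le> 1 / (real r + 3)" using m by blast
        have "\<not> (\<forall>j\<ge>k. 1 / 2 < ?Z j)" for k
        proof
          assume "\<forall>j\<ge>k. 1 / 2 < ?Z j"
          then have "1 / 2 < ?Z (max k m)" by auto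
          moreover have "?Z (max k m) \<le> 1 / (real r + 3)" using low by auto
          ultimately show False using small[of r] by linarith
        qed
        then have "Z_limit b = 0" by (auto simp: Z_limit_def)
        moreover have "norm (?Z n - 0) < e" if "m \<le> n" for n
        proof -
          have "?Z n \<le> 1 / (real r + 3)" "0 \<le> ?Z n" using low that polar_bounds by auto
          then show ?thesis using re unfolding real_norm_def by linarith
        qed
        ultimately show ?thesis by auto
      qed
    qed
  qed
qed

lemma Z_limit_measurable: "Z_limit \<in> borel_measurable coin_space"
  unfolding Z_limit_def[abs_def] by measurable

lemma Z_limit_eq_1: "measure coin_space {b \<in> space coin_space. Z_limit b = 1} = L"
proof (rule antisym)
  let ?A = "{b \<in> space coin_space. Z_limit b = 1}"
  have A: "?A = {b \<in> space coin_space. \<exists>m. \<forall>j\<ge>m. 1 / 2 < Zn j (path_index j b)}"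
    by (auto simp: Z_limit_def)
  have sets: "?A \<in> sets coin_space" unfolding A by measurable
  show "L \<le> measure coin_space ?A"
  proof (rule field_le_epsilon)
    fix \<epsilon> :: real assume "0 < \<epsilon>"
    obtain m where m: "L - \<epsilon> \<le> measure coin_space {b \<in> space coin_space. \<forall>j\<ge>m. 1 - 1 / 3
        \<le> Zn j (path_index j b)}"
      using coin_stays_high[of "1 / 3" \<epsilon>] \<open>0 < \<epsilon>\<close> by auto
    also have "\<dots> \<le> measure coin_space ?A"
      by (intro coin.finite_measure_mono sets) (force simp: Z_limit_def)
    finally show "L \<le> measure coin_space ?A + \<epsilon>" by simp
  qed
  show "measure coin_space ?A \<le> L"
  proof (rule field_le_epsilon)
    fix \<epsilon> :: real assume "0 < \<epsilon>"
    obtain m where m: "1 - L - \<epsilon> \<le> measure coin_space {b \<in> space coin_space. \<forall>j\<ge>m. Zn j (path_index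
        j b) \<le> 1 / 3}"
      using coin_stays_low[of "1 / 3" \<epsilon>] \<open>0 < \<epsilon>\<close> by auto
    also have "\<dots> \<le> measure coin_space (space coin_space - ?A)"
    proof (intro coin.finite_measure_mono subsetI)
      fix b assume b: "b \<in> {b \<in> space coin_space. \<forall>j\<ge>m. Zn j (path_index j b) \<le> 1 / 3}"
      have "\<not> (\<forall>j\<ge>k. 1 / 2 < Zn j (path_index j b))" for k
      proof
        assume "\<forall>j\<ge>k. 1 / 2 < Zn j (path_index j b)"
        then have "1 / 2 < Zn (max k m) (path_index (max k m) b)" by auto
        moreover have "Zn (max k m) (path_index (max k m) b) \<le> 1 / 3" using b by auto
        ultimately show False by linarith
      qed
      then show "b \<in> space coin_space - ?A" using b by (auto simp: Z_limit_def)
    qed (use sets in auto)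
    also have "\<dots> = 1 - measure coin_space ?A" by (rule coin.prob_compl[OF sets])
    finally show "measure coin_space ?A \<le> L + \<epsilon>" by simp
  qed
qed

lemma bhatt_process_eq: "bhatt_process M X Y n b = Zn n (path_index n b)"
  by (simp add: bhatt_process_def random_index_eq bhattacharyya_eq_Zn path_index_less)

lemma bhatt_process_polarizes_fast: "polarizes_fast_to_1 coin_space (bhatt_process M X Y)"
  unfolding polarizes_fast_to_1_def
\<comment> \<open>Any rate strictly between \<open>0\<close> and \<open>1 / 2\<close> would serve as
  well as \<open>1 / 4\<close>.\<close>
proof (intro exI[of _ Z_limit] exI[of _ "1 / 4"] conjI)
  show "polarizes_with_limit coin_space (bhatt_process M X Y) Z_limit"
    unfolding polarizes_with_limit_def bhatt_process_eq
    using polar_bounds Z_limit_measurable Z_limit_AE by (auto simp: Z_limit_def)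
  show "(\<lambda>n. measure coin_space {b \<in> space coin_space. 1 - 2 powr (- (2 powr (real n * (1 / 4))))
      < bhatt_process M X Y n b})
      \<longlonglongrightarrow> measure coin_space {b \<in> space coin_space. Z_limit b = 1}"
    unfolding bhatt_process_eq Z_limit_eq_1
    using Zn_near_1_fraction[of "1 / 4"] coin_path_index[of "\<lambda>i. 1 - 2 powr (- (2 powr (real _
        * (1 / 4)))) < Zn _ i"]
    by simp
qed simp

lemma bhattacharyya_near_1_count:
  assumes "\<beta> < 1 / 2"
  shows "(\<lambda>n. real (card {i \<in> {1..2 ^ n}. bhattacharyya M (polar_U n X i) (polar_Q n X Y i)
    > 1 - 2 powr (- (real (2 ^ n) powr \<beta>))}) / real (2 ^ n)) \<longlonglongrightarrow> L"
proof -
  have "real (card {i \<in> {1..2 ^ n}. bhattacharyya M (polar_U n X i) (polar_Q n X Y i)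
    > 1 - 2 powr (- (real (2 ^ n) powr \<beta>))}) / real (2 ^ n)
    = frac_of n (\<lambda>i. 1 - 2 powr (- (2 powr (real n * \<beta>))) < Zn n i)" for n
  proof -
    have p: "real (2 ^ n) powr \<beta> = 2 powr (real n * \<beta>)"
      by (simp add: powr_powr flip: powr_realpow)
    have "{i \<in> {1..2 ^ n}. bhattacharyya M (polar_U n X i) (polar_Q n X Y i) > 1 - 2 powr (- (real
        (2 ^ n) powr \<beta>))}
      = Suc ` {i. i < 2 ^ n \<and> 1 - 2 powr (- (2 powr (real n * \<beta>))) < Zn n i}"
    proof (intro set_eqI iffI)
      fix i assume i: "i \<in> {i \<in> {1..2 ^ n}. bhattacharyya M (polar_U n X i) (polar_Q n X Y i) > 1 -
          2 powr (- (real (2 ^ n) powr \<beta>))}"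
      then obtain k where k: "i = Suc k" "k < 2 ^ n" by (cases i) auto
      then show "i \<in> Suc ` {i. i < 2 ^ n \<and> 1 - 2 powr (- (2 powr (real n * \<beta>))) < Zn n i}"
        using i unfolding p by (auto simp: bhattacharyya_eq_Zn)
    next
      fix i assume "i \<in> Suc ` {i. i < 2 ^ n \<and> 1 - 2 powr (- (2 powr (real n * \<beta>))) < Zn n i}"
      then show "i \<in> {i \<in> {1..2 ^ n}. bhattacharyya M (polar_U n X i) (polar_Q n X Y i) > 1 - 2 powr
          (- (real (2 ^ n) powr \<beta>))}"
        unfolding p by (auto simp: bhattacharyya_eq_Zn)
    qed
    then show ?thesis by (simp add: card_image frac_of_card)
  qed
  then show ?thesis using Zn_near_1_fraction[OF assms] by simp
qed

end

end

theorem theorem3: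
  fixes M :: "'w measure"
    and X :: "int \<Rightarrow> 'w \<Rightarrow> bool"
    and Y :: "int \<Rightarrow> 'w \<Rightarrow> 'y::finite"
    and S :: "int \<Rightarrow> 'w \<Rightarrow> 's::finite"
  assumes "faim_process M X Y S"
  shows "polarizes_fast_to_1 coin_space (bhatt_process M X Y)
       \<and> (\<exists>Hbar. (\<lambda>N. cond_entropy M (block X N) (block Y N) / real N) \<longlonglongrightarrow> Hbar
            \<and> (\<forall>\<beta>::real. \<beta> < 1/2 \<longrightarrow>
                 (\<lambda>n. real (card {i \<in> {1..2 ^ n}.
                          bhattacharyya M (polar_U n X i) (polar_Q n X Y i)
                            > 1 - 2 powr (- (real (2 ^ n) powr \<beta>))}) / real (2 ^ n))
                 \<longlonglongrightarrow> Hbar))"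
proof -
  interpret faim M X Y S by (rule faim.intro) (rule assms)
  \<comment> \<open>One \<open>L\<close> is the limit of the normalised block entropies and of both
    means, so the counts tend to the entropy rate.\<close>
  obtain L where L: "(\<lambda>N. block_ent N / real N) \<longlonglongrightarrow> L" "(\<lambda>n. avg n (Hn n)) \<longlonglongrightarrow> L" "(\<lambda>n. avg n (Hs n)) \<longlonglongrightarrow> L"
    by (rule block_ent_limit)
  show ?thesis
    using bhatt_process_polarizes_fast[OF L(2,3)] bhattacharyya_near_1_count[OF L(2,3)] L(1)
    unfolding cond_entropy_eq_block_ent by blast
qed

end
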